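(* Fix a finite relational language $L$ in which every relation symbol has arity at least $2$, and a function $\overline\alpha:L\to(0,1)\cap\mathbb{Q}$; let $S_{\overline\alpha}$ be the corresponding theory and $c$ the associated integer (see context). Let $\mathfrak{M},\mathfrak{N}$ be countable models of $S_{\overline\alpha}$. Then $\mathfrak{M}\cong\mathfrak{N}$ if and only if $\dim(\mathfrak{M})=\dim(\mathfrak{N})$; and $\dim(\mathfrak{M})=\infty$ if and only if $\mathfrak{M}$ is (isomorphic to) the generic for $(K_{\overline\alpha},\leq)$. Consequently $S_{\overline\alpha}$ has exactly $\aleph_0$ many pairwise non-isomorphic countable models. Moreover, each countable model of $S_{\overline\alpha}$ is isomorphic either to the generic for $(K_{\overline\alpha},\leq)$ or to the generic for $(K_{k/c},\leq)$ for some integer $k\geq 0$ (so each countable model is built as the generic of a subclass of $(K_{\overline\alpha},\leq)$).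
   Context: $K_L$ is the class of finite $L$-structures (including the empty one) in which every relation is interpreted symmetrically and irreflexively. For $\mathfrak{A}\in K_L$, $\delta(\mathfrak{A})=|A|-\sum_{E\in L}\overline\alpha(E)N_E(\mathfrak{A})$, where $N_E(\mathfrak{A})$ is the number of distinct subsets of $A$ on which $E$ holds. $K_{\overline\alpha}=\{\mathfrak{A}\in K_L:\delta(\mathfrak{A}')\geq 0\text{ for all }\mathfrak{A}'\subseteq\mathfrak{A}\}$. For $\mathfrak{A}\subseteq\mathfrak{B}$ in $K_L$, $\mathfrak{A}\leq\mathfrak{B}$ means $\delta(\mathfrak{A})\leq\delta(\mathfrak{A}')$ for all $\mathfrak{A}\subseteq\mathfrak{A}'\subseteq\mathfrak{B}$; $\delta(\mathfrak{B}/\mathfrak{A})=\delta(\mathfrak{B})-\delta(\mathfrak{A})$. For an $L$-structure $\mathfrak{M}$ all of whose finite substructures lie in $K_L$ and finite $\mathfrak{A}\subseteq\mathfrak{M}$, $\mathfrak{A}\leq\mathfrak{M}$ means $\mathfrak{A}\leq\mathfrak{B}$ for every finite $\mathfrak{A}\subseteq\mathfrak{B}\subseteq\mathfrak{M}$; an embedding with strong image is a strong embedding. The generic for $(K_{\overline\alpha},\leq)$ is the (unique up to isomorphism) countable $L$-structure $\mathfrak{M}$ all of whose finite substructures lie in $K_{\overline\alpha}$ such that $\mathfrak{M}$ is the union of a chain $\mathfrak{A}_0\leq\mathfrak{A}_1\leq\cdots$ in $K_{\overline\alpha}$, and whenever $\mathfrak{A}\leq\mathfrak{B}$ are in $K_{\overline\alpha}$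 and $\mathfrak{A}\leq\mathfrak{M}$, there is $\mathfrak{B}'\leq\mathfrak{M}$ with $\mathfrak{B}'\cong_{\mathfrak{A}}\mathfrak{B}$. $S_{\overline\alpha}$ is its (complete) theory; equivalently it is axiomatized by: every finite substructure lies in $K_{\overline\alpha}$, and for all $\mathfrak{A}\leq\mathfrak{B}$ in $K_{\overline\alpha}$ every embedding of $\mathfrak{A}$ into the model extends to an embedding of $\mathfrak{B}$. Writing $\overline\alpha(E)=p_E/q_E$ in lowest terms, $c=\mathrm{lcm}\{q_E:E\in L\}$. For $\mathfrak{M}\models S_{\overline\alpha}$ and finite $\mathfrak{A}\leq\mathfrak{M}$, $\dim(\mathfrak{M}/\mathfrak{A})=\max\{\delta(\mathfrak{B}/\mathfrak{A}):\mathfrak{A}\leq\mathfrak{B}\leq\mathfrak{M},\ B\text{ finite}\}$, and $\dim(\mathfrak{M}/\mathfrak{A})=\infty$ if these values are unbounded; $\dim(\mathfrak{M})=\dim(\mathfrak{M}/\emptyset)$. For an integer $k\geq0$, $K_{k/c}=\{\mathfrak{A}\in K_{\overline\alpha}:\delta(\mathfrak{A})=k/c\}$ with $\leq$ inherited from $K_{\overline\alpha}$; the generic for $(K_{k/c},\leq)$ is a countable structure all of whose finite substructures lie in $K_{\overline\alpha}$ which is the union of a $\leq$-chain of members of $K_{k/c}$, such that whenever $\mathfrak{A}\leq\mathfrak{B}$ are in $K_{k/c}$ and $\mathfrak{A}\leq\mathfrak{M}$ there is $\mathfrak{B}'\leq\mathfrak{M}$ with $\mathfrak{B}'\cong_{\mathfrak{A}}\mathfrak{B}$,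 and such that every finite $\mathfrak{A}\subseteq\mathfrak{M}$ is contained in some $\mathfrak{B}\in K_{k/c}$ with $\mathfrak{B}\leq\mathfrak{M}$.
   Formalization: The language L is assumed to contain at least one relation symbol; for empty L the theory is that of infinite sets, which has only one countable model up to isomorphism, so the claim of exactly aleph_0 countable models fails there. *)

theory Defs
  imports Complex_Main "HOL-Library.Extended" "HOL-Library.Equipollence"
begin

text \<open>
  A finite relational language is a finite type of relation symbols \<open>'e\<close> with an arity
  function \<open>ar\<close>. Since HOL types are inhabited, the language has at least one symbol (without
  relation symbols the theory is that of infinite sets, which has only one countable model).
\<close>

section \<open>Structures\<close>

record ('e, 'a) struct =
  universe :: "'a set"
  interp :: "'e \<Rightarrow> 'a list set"

definition is_struct :: "('e \<Rightarrow> nat) \<Rightarrow> ('e, 'a) struct \<Rightarrow> bool" where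
  "is_struct ar M \<longleftrightarrow>
     (\<forall>E. \<forall>xs \<in> interp M E. length xs = ar E \<and> set xs \<subseteq> universe M)"

definition empty_struct :: "('e, 'a) struct" where
  "empty_struct = \<lparr>universe = {}, interp = (\<lambda>E. {})\<rparr>"

definition substruct :: "('e, 'a) struct \<Rightarrow> ('e, 'a) struct \<Rightarrow> bool" where
  "substruct A M \<longleftrightarrow> universe A \<subseteq> universe M \<and>
     (\<forall>E. interp A E = {xs \<in> interp M E. set xs \<subseteq> universe A})"

definition iso_via ::
  "('a \<Rightarrow> 'b) \<Rightarrow> ('e, 'a) struct \<Rightarrow> ('e, 'b) struct \<Rightarrow> bool" where
  "iso_via f M N \<longleftrightarrow> bij_betw f (universe M) (universe N) \<and>
     (\<forall>E xs. set xs \<subseteq> universe M \<longrightarrow> (xs \<in> interp M E \<longleftrightarrow> map f xs \<in> interp N E))"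

definition isomorphic :: "('e, 'a) struct \<Rightarrow> ('e, 'b) struct \<Rightarrow> bool" where
  "isomorphic M N \<longleftrightarrow> (\<exists>f. iso_via f M N)"

definition isomorphic_over ::
  "('e, 'a) struct \<Rightarrow> ('e, 'a) struct \<Rightarrow> ('e, 'a) struct \<Rightarrow> bool" where
  "isomorphic_over A B B' \<longleftrightarrow> (\<exists>f. iso_via f B B' \<and> (\<forall>x \<in> universe A. f x = x))"

section \<open>The rank function and strong substructures\<close>

text \<open>Irreflexivity: a relation holds only of tuples of pairwise distinct elements.\<close>

definition K_L :: "('e \<Rightarrow> nat) \<Rightarrow> ('e, 'a) struct set" where
  "K_L ar = {A. is_struct ar A \<and> finite (universe A) \<and>
     (\<forall>E. \<forall>xs \<in> interp A E. distinct xs \<and>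
        (\<forall>ys. distinct ys \<and> set ys = set xs \<longrightarrow> ys \<in> interp A E))}"

definition num_edges :: "('e, 'a) struct \<Rightarrow> 'e \<Rightarrow> nat" where
  "num_edges A E = card {X. X \<subseteq> universe A \<and> (\<exists>xs \<in> interp A E. set xs = X)}"

definition \<delta> :: "('e::finite \<Rightarrow> rat) \<Rightarrow> ('e, 'a) struct \<Rightarrow> rat" where
  "\<delta> \<alpha> A = of_nat (card (universe A)) - (\<Sum>E\<in>UNIV. \<alpha> E * of_nat (num_edges A E))"

definition \<delta>_rel :: "('e::finite \<Rightarrow> rat) \<Rightarrow> ('e, 'a) struct \<Rightarrow> ('e, 'a) struct \<Rightarrow> rat" where
  "\<delta>_rel \<alpha> B A = \<delta> \<alpha> B - \<delta> \<alpha> A"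

definition K_\<alpha> :: "('e::finite \<Rightarrow> nat) \<Rightarrow> ('e \<Rightarrow> rat) \<Rightarrow> ('e, 'a) struct set" where
  "K_\<alpha> ar \<alpha> = {A \<in> K_L ar. \<forall>A'. substruct A' A \<longrightarrow> \<delta> \<alpha> A' \<ge> 0}"

text \<open>
  \<open>strong_fin\<close> is the relation \<open>\<le>\<close> between finite structures, \<open>strong\<close> its
  extension to an ambient structure that may be infinite.
\<close>

definition strong_fin ::
  "('e::finite \<Rightarrow> rat) \<Rightarrow> ('e, 'a) struct \<Rightarrow> ('e, 'a) struct \<Rightarrow> bool" where
  "strong_fin \<alpha> A B \<longleftrightarrow> substruct A B \<and>
     (\<forall>A'. substruct A A' \<and> substruct A' B \<longrightarrow> \<delta> \<alpha> A \<le> \<delta> \<alpha> A')"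

definition strong ::
  "('e::finite \<Rightarrow> rat) \<Rightarrow> ('e, 'a) struct \<Rightarrow> ('e, 'a) struct \<Rightarrow> bool" where
  "strong \<alpha> A M \<longleftrightarrow> finite (universe A) \<and> substruct A M \<and>
     (\<forall>B. finite (universe B) \<and> substruct A B \<and> substruct B M \<longrightarrow> strong_fin \<alpha> A B)"

section \<open>Generic structures\<close>

definition chain_union :: "(nat \<Rightarrow> ('e, 'a) struct) \<Rightarrow> ('e, 'a) struct" where
  "chain_union A = \<lparr>universe = (\<Union>i. universe (A i)), interp = (\<lambda>E. \<Union>i. interp (A i) E)\<rparr>"

text \<open>
  The requirements common to all generics considered, for a class \<open>K\<close> of finite structures.
  The structures \<open>B\<close> to be realised have their elements in the carrier type of \<open>M\<close>, but need
  not be related to \<open>M\<close> outside \<open>A\<close>. As the carrier type is infinite in all uses, every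
  isomorphism type of finite extensions of \<open>A\<close> is represented.
\<close>

definition generic_wrt ::
  "('e::finite \<Rightarrow> nat) \<Rightarrow> ('e \<Rightarrow> rat) \<Rightarrow> ('e, 'a) struct set \<Rightarrow> ('e, 'a) struct \<Rightarrow> bool" where
  "generic_wrt ar \<alpha> K M \<longleftrightarrow>
     is_struct ar M \<and> countable (universe M) \<and>
     (\<forall>A. finite (universe A) \<and> substruct A M \<longrightarrow> A \<in> K_\<alpha> ar \<alpha>) \<and>
     (\<exists>A. (\<forall>i. A i \<in> K \<and> strong_fin \<alpha> (A i) (A (Suc i))) \<and> M = chain_union A) \<and>
     (\<forall>A \<in> K. \<forall>B \<in> K. strong_fin \<alpha> A B \<and> strong \<alpha> A M \<longrightarrow>
        (\<exists>B'. strong \<alpha> B' M \<and> isomorphic_over A B B'))"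

definition is_generic ::
  "('e::finite \<Rightarrow> nat) \<Rightarrow> ('e \<Rightarrow> rat) \<Rightarrow> ('e, 'a) struct \<Rightarrow> bool" where
  "is_generic ar \<alpha> M \<longleftrightarrow> generic_wrt ar \<alpha> (K_\<alpha> ar \<alpha>) M"

definition common_denom :: "('e::finite \<Rightarrow> rat) \<Rightarrow> int" where
  "common_denom \<alpha> = Lcm (range (\<lambda>E. snd (quotient_of (\<alpha> E))))"

definition K_level ::
  "('e::finite \<Rightarrow> nat) \<Rightarrow> ('e \<Rightarrow> rat) \<Rightarrow> nat \<Rightarrow> ('e, 'a) struct set" where
  "K_level ar \<alpha> k = {A \<in> K_\<alpha> ar \<alpha>. \<delta> \<alpha> A = of_nat k / of_int (common_denom \<alpha>)}"

definition is_generic_level ::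
  "('e::finite \<Rightarrow> nat) \<Rightarrow> ('e \<Rightarrow> rat) \<Rightarrow> nat \<Rightarrow> ('e, 'a) struct \<Rightarrow> bool" where
  "is_generic_level ar \<alpha> k M \<longleftrightarrow> generic_wrt ar \<alpha> (K_level ar \<alpha> k) M \<and>
     (\<forall>A. finite (universe A) \<and> substruct A M \<longrightarrow>
        (\<exists>B \<in> K_level ar \<alpha> k. substruct A B \<and> strong \<alpha> B M))"

section \<open>First-order logic and the theory of the generic\<close>

datatype 'e formula =
    Eq nat nat
  | Rel 'e "nat list"
  | Neg "'e formula"
  | Conj "'e formula" "'e formula"
  | Ex nat "'e formula"

primrec wf_formula :: "('e \<Rightarrow> nat) \<Rightarrow> 'e formula \<Rightarrow> bool" where
  "wf_formula ar (Eq i j) \<longleftrightarrow> True"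
| "wf_formula ar (Rel E is) \<longleftrightarrow> length is = ar E"
| "wf_formula ar (Neg \<phi>) \<longleftrightarrow> wf_formula ar \<phi>"
| "wf_formula ar (Conj \<phi> \<psi>) \<longleftrightarrow> wf_formula ar \<phi> \<and> wf_formula ar \<psi>"
| "wf_formula ar (Ex i \<phi>) \<longleftrightarrow> wf_formula ar \<phi>"

primrec free_vars :: "'e formula \<Rightarrow> nat set" where
  "free_vars (Eq i j) = {i, j}"
| "free_vars (Rel E is) = set is"
| "free_vars (Neg \<phi>) = free_vars \<phi>"
| "free_vars (Conj \<phi> \<psi>) = free_vars \<phi> \<union> free_vars \<psi>"
| "free_vars (Ex i \<phi>) = free_vars \<phi> - {i}"

primrec sat :: "('e, 'a) struct \<Rightarrow> (nat \<Rightarrow> 'a) \<Rightarrow> 'e formula \<Rightarrow> bool" where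
  "sat M v (Eq i j) \<longleftrightarrow> v i = v j"
| "sat M v (Rel E is) \<longleftrightarrow> map v is \<in> interp M E"
| "sat M v (Neg \<phi>) \<longleftrightarrow> \<not> sat M v \<phi>"
| "sat M v (Conj \<phi> \<psi>) \<longleftrightarrow> sat M v \<phi> \<and> sat M v \<psi>"
| "sat M v (Ex i \<phi>) \<longleftrightarrow> (\<exists>x \<in> universe M. sat M (v(i := x)) \<phi>)"

definition sentences :: "('e \<Rightarrow> nat) \<Rightarrow> 'e formula set" where
  "sentences ar = {\<phi>. wf_formula ar \<phi> \<and> free_vars \<phi> = {}}"

text \<open>For a sentence the choice of the valuation is irrelevant.\<close>

definition holds_in :: "('e, 'a) struct \<Rightarrow> 'e formula \<Rightarrow> bool" where
  "holds_in M \<phi> \<longleftrightarrow> (\<forall>v. sat M v \<phi>)"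

definition complete_theory :: "('e \<Rightarrow> nat) \<Rightarrow> ('e, 'a) struct \<Rightarrow> 'e formula set" where
  "complete_theory ar M = {\<phi> \<in> sentences ar. holds_in M \<phi>}"

text \<open>The generic is unique up to isomorphism, so any copy of it on \<open>nat\<close> may be chosen.\<close>

definition S_\<alpha> :: "('e::finite \<Rightarrow> nat) \<Rightarrow> ('e \<Rightarrow> rat) \<Rightarrow> 'e formula set" where
  "S_\<alpha> ar \<alpha> = complete_theory ar (SOME G :: ('e, nat) struct. is_generic ar \<alpha> G)"

definition countable_models ::
  "('e::finite \<Rightarrow> nat) \<Rightarrow> ('e \<Rightarrow> rat) \<Rightarrow> ('e, 'a) struct set" where
  "countable_models ar \<alpha> =
     {M. is_struct ar M \<and> countable (universe M) \<and> (\<forall>\<phi> \<in> S_\<alpha> ar \<alpha>. holds_in M \<phi>)}"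

text \<open>
  Used with \<open>'a = nat\<close>: every countable structure is isomorphic to one whose universe is a
  set of natural numbers.
\<close>

definition iso_classes ::
  "('e::finite \<Rightarrow> nat) \<Rightarrow> ('e \<Rightarrow> rat) \<Rightarrow> ('e, 'a) struct set set" where
  "iso_classes ar \<alpha> = countable_models ar \<alpha> //
     {(M, N). M \<in> countable_models ar \<alpha> \<and> N \<in> countable_models ar \<alpha> \<and> isomorphic M N}"

section \<open>Dimension\<close>

definition dimension_over ::
  "('e::finite \<Rightarrow> rat) \<Rightarrow> ('e, 'a) struct \<Rightarrow> ('e, 'a) struct \<Rightarrow> rat extended" where
  "dimension_over \<alpha> M A =
     (let V = {\<delta>_rel \<alpha> B A | B. finite (universe B) \<and> strong_fin \<alpha> A B \<and> strong \<alpha> B M}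
      in if bdd_above V then Fin (GREATEST v. v \<in> V) else \<infinity>)"

definition dimension :: "('e::finite \<Rightarrow> rat) \<Rightarrow> ('e, 'a) struct \<Rightarrow> rat extended" where
  "dimension \<alpha> M = dimension_over \<alpha> M empty_struct"

end

theory Submission
  imports Defs
begin

text \<open>
  Submodularity of the predimension yields free amalgamation, and since its values lie in
  \<open>(1/c)\<int>\<close>, every finite subset of a model has a finite strong closure. The key construction
  adjoins to a sufficiently large finite structure a path of new points that lowers the
  predimension by exactly \<open>1/c\<close> although no proper subset of the new structure sees a drop.
  Repeating it, an extension \<open>B\<close> of \<open>A\<close>, \<open>A \<le> B\<close>, becomes part of an
  extension of relative predimension \<open>0\<close>, in which \<open>B\<close> is strong up to any prescribed
  finite size. A copy of an extension of relative predimension \<open>0\<close> over a strong set is itself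
  strong. Hence partial strong isomorphisms between models of equal dimension extend back and
  forth, and approximately strong ones extend far enough to show that the extension axioms are
  complete. Models of prescribed dimension are unions of chains built by the same amalgamation.
\<close>

text \<open>The extension axioms hand out embeddings and say nothing about the strength of their
  images; this is the obstacle behind most of the constructions. A copy of a free amalgam over a
  strong set may sit badly in a model, unless the amalgam has first been lowered to the predimension
  of the set it is built over. Its excess can be any multiple of \<open>1/c\<close>, so drops of
  exactly \<open>1/c\<close> are required; they come from Bezout's identity for \<open>c\<close> and
  the integers \<open>c * \<alpha> E\<close>. A strong \<open>B\<close> survives the lowering as
  long as the final predimension is not below that of \<open>B\<close>, and this is where dimension
  enters the classification. Otherwise only \<open>k\<close>-strength survives, for a
  \<open>k\<close> fixed in advance. Since strength is an infinite conjunction of first-order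
  conditions, elementary equivalence has to be argued with \<open>k\<close>-strength, the demand
  depending on the formula and on the number of parameters but not on the parameters themselves.
  Hence closures and amalgams carry size bounds that depend only on the sizes of what they start
  from, never on the particular sets.\<close>

definition induced :: "('e, 'a) struct \<Rightarrow> 'a set \<Rightarrow> ('e, 'a) struct" where
  "induced M X = \<lparr>universe = X, interp = (\<lambda>E. {xs \<in> interp M E. set xs \<subseteq> X})\<rparr>"

definition edges :: "('e, 'a) struct \<Rightarrow> 'e \<Rightarrow> 'a set set" where
  "edges M E = set ` interp M E"

definition edges_in :: "('e, 'a) struct \<Rightarrow> 'a set \<Rightarrow> 'e \<Rightarrow> 'a set set" where
  "edges_in M X E = {e \<in> edges M E. e \<subseteq> X}"

text \<open>This is \<open>K_L\<close> without finiteness, so that models and their finite parts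
  share one notion. Such a structure is determined by its universe and the sets
  \<open>edges M E\<close>.\<close>

definition hypergraph :: "('e \<Rightarrow> nat) \<Rightarrow> ('e, 'a) struct \<Rightarrow> bool" where
  "hypergraph ar M \<longleftrightarrow> is_struct ar M \<and>
     (\<forall>E. \<forall>xs \<in> interp M E. distinct xs \<and>
        (\<forall>ys. distinct ys \<and> set ys = set xs \<longrightarrow> ys \<in> interp M E))"

definition embeds :: "('a \<Rightarrow> 'b) \<Rightarrow> ('e, 'a) struct \<Rightarrow> ('e, 'b) struct \<Rightarrow> bool" where
  "embeds f A M \<longleftrightarrow> inj_on f (universe A) \<and> f ` universe A \<subseteq> universe M \<and>
     (\<forall>E xs. set xs \<subseteq> universe A \<longrightarrow> (xs \<in> interp A E \<longleftrightarrow> map f xs \<in> interp M E))"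

definition of_edges :: "'a set \<Rightarrow> ('e \<Rightarrow> 'a set set) \<Rightarrow> ('e, 'a) struct" where
  "of_edges U ed = \<lparr>universe = U, interp = (\<lambda>E. {xs. distinct xs \<and> set xs \<in> ed E})\<rparr>"

definition image_struct :: "('a \<Rightarrow> 'b) \<Rightarrow> ('e, 'a) struct \<Rightarrow> ('e, 'b) struct" where
  "image_struct h A = \<lparr>universe = h ` universe A, interp = (\<lambda>E. map h ` interp A E)\<rparr>"

section \<open>Induced substructures, and symmetric relations as families of edges\<close>

lemma universe_induced [simp]: "universe (induced M X) = X"
  and interp_induced [simp]: "interp (induced M X) E = {xs \<in> interp M E. set xs \<subseteq> X}"
  by (simp_all add: induced_def)

lemma universe_of_edges [simp]: "universe (of_edges U ed) = U"
  by (simp add: of_edges_def)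

lemma universe_image_struct [simp]: "universe (image_struct h A) = h ` universe A"
  by (simp add: image_struct_def)

lemma substruct_iff:
  "substruct A M \<longleftrightarrow> universe A \<subseteq> universe M \<and> A = induced M (universe A)"
  unfolding substruct_def
  by (cases A) (auto simp: induced_def fun_eq_iff)

lemma substruct_induced: "X \<subseteq> universe M \<Longrightarrow> substruct (induced M X) M"
  by (simp add: substruct_iff)

lemma substruct_trans: "substruct A B \<Longrightarrow> substruct B C \<Longrightarrow> substruct A C"
  unfolding substruct_def by fast

lemma induced_induced: "Y \<subseteq> X \<Longrightarrow> induced (induced M X) Y = induced M Y"
  by (auto simp: induced_def)

lemma induced_substruct: "substruct A M \<Longrightarrow> X \<subseteq> universe A \<Longrightarrow> induced A X = induced M X"
  by (metis induced_induced substruct_iff)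

lemma induced_universe: "is_struct ar M \<Longrightarrow> induced M (universe M) = M"
  by (cases M) (auto simp: induced_def is_struct_def fun_eq_iff)

lemma substruct_refl: "is_struct ar M \<Longrightarrow> substruct M M"
  by (simp add: substruct_iff induced_universe)

lemma hypergraph_is_struct: "hypergraph ar M \<Longrightarrow> is_struct ar M"
  by (simp add: hypergraph_def)

lemma hypergraphD:
  assumes "hypergraph ar M" "xs \<in> interp M E"
  shows "distinct xs" "length xs = ar E" "set xs \<subseteq> universe M"
    "\<And>ys. distinct ys \<Longrightarrow> set ys = set xs \<Longrightarrow> ys \<in> interp M E"
  using assms unfolding hypergraph_def is_struct_def by blast+

lemma is_struct_induced: "is_struct ar M \<Longrightarrow> is_struct ar (induced M X)"
  by (auto simp: is_struct_def)

lemma hypergraph_induced: "hypergraph ar M \<Longrightarrow> hypergraph ar (induced M X)"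
  unfolding hypergraph_def by (simp add: is_struct_induced) blast

lemma K_L_iff: "A \<in> K_L ar \<longleftrightarrow> hypergraph ar A \<and> finite (universe A)"
  by (auto simp: K_L_def hypergraph_def)

lemma edges_in_induced: "Y \<subseteq> X \<Longrightarrow> edges_in (induced M X) Y E = edges_in M Y E"
  by (auto simp: edges_in_def edges_def)

lemma edges_in_substruct:
  "substruct A M \<Longrightarrow> X \<subseteq> universe A \<Longrightarrow> edges_in A X E = edges_in M X E"
  by (metis edges_in_induced substruct_iff)

lemma finite_edges_in: "finite X \<Longrightarrow> finite (edges_in M X E)"
  by (rule finite_subset[of _ "Pow X"]) (auto simp: edges_in_def)

lemma hypergraph_edge:
  assumes "hypergraph ar M" "e \<in> edges M E"
  shows "e \<subseteq> universe M" "finite e" "card e = ar E"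
proof -
  obtain xs where "xs \<in> interp M E" "e = set xs" using assms(2) by (auto simp: edges_def)
  then show "e \<subseteq> universe M" "finite e" "card e = ar E"
    using hypergraphD(1-3)[OF assms(1)] by (simp_all add: distinct_card)
qed

lemma hypergraph_interp:
  assumes "hypergraph ar M"
  shows "interp M E = {xs. distinct xs \<and> set xs \<in> edges M E}"
proof -
  have "xs \<in> interp M E" if "distinct xs" "set xs \<in> edges M E" for xs
    using that hypergraphD(4)[OF assms] by (metis edges_def imageE)
  then show ?thesis using hypergraphD(1)[OF assms] by (auto simp: edges_def)
qed

lemma edges_of_edges:
  assumes "\<And>e. e \<in> ed E \<Longrightarrow> finite e"
  shows "edges (of_edges U ed) E = ed E"
  using assms finite_distinct_list by (fastforce simp: edges_def of_edges_def)

lemma hypergraph_of_edges: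
  assumes "\<And>E e. e \<in> ed E \<Longrightarrow> e \<subseteq> U \<and> finite e \<and> card e = ar E"
  shows "hypergraph ar (of_edges U ed)"
  using assms by (auto simp: hypergraph_def is_struct_def of_edges_def distinct_card subset_iff)
     (metis distinct_card)

lemma hypergraph_eqI:
  assumes "hypergraph ar A" "hypergraph ar B" "universe A = universe B"
    "\<And>E. edges A E = edges B E"
  shows "A = B"
proof -
  have "interp A = interp B"
    using assms hypergraph_interp by (metis (no_types, lifting) ext)
  with assms(3) show ?thesis by simp
qed

lemma edges_induced: "edges (induced M X) E = edges_in M X E"
  by (auto simp: edges_def edges_in_def)

lemma hypergraph_substructI:
  assumes "hypergraph ar A" "hypergraph ar M" "universe A \<subseteq> universe M"
    "\<And>E. edges A E = edges_in M (universe A) E"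
  shows "substruct A M"
  unfolding substruct_iff
  using assms by (auto intro!: hypergraph_eqI[OF assms(1)] hypergraph_induced simp: edges_induced)

lemma hypergraph_substruct: "hypergraph ar M \<Longrightarrow> substruct A M \<Longrightarrow> hypergraph ar A"
  by (metis hypergraph_induced substruct_iff)

section \<open>Embeddings\<close>

lemma embeds_induced_iff:
  "embeds f (induced A X) M \<longleftrightarrow> inj_on f X \<and> f ` X \<subseteq> universe M \<and>
     (\<forall>E xs. set xs \<subseteq> X \<longrightarrow> (xs \<in> interp A E \<longleftrightarrow> map f xs \<in> interp M E))"
  by (auto simp: embeds_def)

lemma embeds_subset: "embeds f A M \<Longrightarrow> X \<subseteq> universe A \<Longrightarrow> embeds f (induced A X) M"
  unfolding embeds_induced_iff unfolding embeds_def by (auto intro: inj_on_subset)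

lemma embeds_into_induced:
  "embeds f A M \<Longrightarrow> f ` universe A \<subseteq> Y \<Longrightarrow> embeds f A (induced M Y)"
  unfolding embeds_def by (auto simp: image_subset_iff subset_iff)

lemma embeds_from_induced: "embeds f A (induced M Y) \<Longrightarrow> Y \<subseteq> universe M \<Longrightarrow> embeds f A M"
  unfolding embeds_def by (auto simp: subset_iff)

lemma embeds_into_super: "embeds f A M \<Longrightarrow> substruct M N \<Longrightarrow> embeds f A N"
  by (metis embeds_from_induced substruct_iff)

lemma embeds_id: "substruct A M \<Longrightarrow> embeds (\<lambda>x. x) A M"
  by (auto simp: embeds_def substruct_def subset_iff)

lemma embeds_comp:
  assumes "embeds f A B" "embeds g B C"
  shows "embeds (g \<circ> f) A C"
proof -
  have "xs \<in> interp A E \<longleftrightarrow> map (g \<circ> f) xs \<in> interp C E" if "set xs \<subseteq> universe A" for xs E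
  proof -
    have "set (map f xs) \<subseteq> universe B"
      using that assms(1) by (auto simp: embeds_def)
    then show ?thesis
      using that assms by (metis embeds_def map_map)
  qed
  moreover have "inj_on (g \<circ> f) (universe A)"
    using assms by (meson comp_inj_on embeds_def inj_on_subset)
  moreover have "(g \<circ> f) ` universe A \<subseteq> universe C"
    using assms by (fastforce simp: embeds_def)
  ultimately show ?thesis by (simp add: embeds_def)
qed

lemma embeds_cong:
  assumes "embeds f A M" "\<And>x. x \<in> universe A \<Longrightarrow> f x = g x"
  shows "embeds g A M"
proof -
  have "map f xs = map g xs" if "set xs \<subseteq> universe A" for xs
    using that assms(2) by auto
  moreover have "inj_on f (universe A) = inj_on g (universe A)"
    using assms(2) by (rule inj_on_cong)
  moreover have "f ` universe A = g ` universe A"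
    using assms(2) by (rule image_cong[OF refl])
  ultimately show ?thesis using assms(1) unfolding embeds_def by metis
qed

lemma iso_via_iff_embeds: "iso_via f A M \<longleftrightarrow> embeds f A M \<and> f ` universe A = universe M"
  by (auto simp: iso_via_def embeds_def bij_betw_def)

lemma embeds_iso_via: "embeds f A M \<Longrightarrow> iso_via f A (induced M (f ` universe A))"
  by (simp add: iso_via_iff_embeds embeds_into_induced)

lemma embeds_inverse:
  assumes "embeds f A M"
  shows "embeds (inv_into (universe A) f) (induced M (f ` universe A)) A"
proof -
  let ?g = "inv_into (universe A) f"
  have inj: "inj_on f (universe A)" using assms by (simp add: embeds_def)
  have "ys \<in> interp M E \<longleftrightarrow> map ?g ys \<in> interp A E" if ys: "set ys \<subseteq> f ` universe A" for ys E
  proof -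
    have "map f (map ?g ys) = ys"
      using ys by (simp add: map_idI f_inv_into_f subset_iff)
    moreover have "set (map ?g ys) \<subseteq> universe A"
      using ys by (auto intro: inv_into_into)
    ultimately show ?thesis using assms by (metis embeds_def)
  qed
  then show ?thesis
    unfolding embeds_induced_iff
    by (auto intro: inv_into_into inj_on_inv_into)
qed

lemma embeds_image_struct:
  assumes "inj_on h (universe A)" "is_struct ar A"
  shows "embeds h A (image_struct h A)"
proof -
  have "xs \<in> interp A E" if "set xs \<subseteq> universe A" "map h xs = map h ys" "ys \<in> interp A E" for xs ys E
  proof -
    have "set ys \<subseteq> universe A" using assms(2) that(3) by (auto simp: is_struct_def)
    then have "xs = ys" using that assms(1) by (metis inj_on_map_eq_map inj_on_subset Un_least)
    then show ?thesis using that by simp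
  qed
  then show ?thesis using assms(1)
    by (auto simp: embeds_def image_struct_def)
qed

lemma is_struct_image_struct: "is_struct ar A \<Longrightarrow> is_struct ar (image_struct h A)"
  by (fastforce simp: is_struct_def image_struct_def)

lemma embeds_is_struct_hypergraph:
  assumes f: "embeds f A M" and A: "is_struct ar A" and M: "hypergraph ar M"
  shows "hypergraph ar A"
proof -
  have inj: "inj_on f (universe A)" using f by (simp add: embeds_def)
  have "distinct xs \<and> (\<forall>ys. distinct ys \<and> set ys = set xs \<longrightarrow> ys \<in> interp A E)"
    if xs: "xs \<in> interp A E" for xs E
  proof -
    have sub: "set xs \<subseteq> universe A" using A xs by (auto simp: is_struct_def)
    then have "map f xs \<in> interp M E" using f xs by (auto simp: embeds_def)
    then have d: "distinct (map f xs)" and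
      p: "\<And>ys. distinct ys \<Longrightarrow> set ys = set (map f xs) \<Longrightarrow> ys \<in> interp M E"
      using hypergraphD[OF M] by blast+
    have "ys \<in> interp A E" if "distinct ys" "set ys = set xs" for ys
    proof -
      have "distinct (map f ys)"
        using that inj sub by (auto simp: distinct_map intro: inj_on_subset)
      then have "map f ys \<in> interp M E" using p that by simp
      then show ?thesis using that sub f by (auto simp: embeds_def)
    qed
    then show ?thesis using d unfolding distinct_map by blast
  qed
  then show ?thesis using A unfolding hypergraph_def by blast
qed

lemma embeds_surj_hypergraph:
  assumes "embeds f A M" "universe M = f ` universe A" "is_struct ar M" "hypergraph ar A"
  shows "hypergraph ar M"
  using embeds_inverse[OF assms(1)] assms embeds_is_struct_hypergraph
  by (metis induced_universe)

lemma hypergraph_image_struct: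
  assumes "inj_on h (universe A)" "hypergraph ar A"
  shows "hypergraph ar (image_struct h A)"
  using embeds_surj_hypergraph[OF embeds_image_struct[OF assms(1)]]
    is_struct_image_struct assms hypergraph_is_struct by force

lemma embeds_edges_in:
  assumes f: "embeds f A M" and X: "X \<subseteq> universe A"
  shows "bij_betw ((`) f) (edges_in A X E) (edges_in M (f ` X) E)"
proof -
  have inj: "inj_on f (universe A)" using f by (simp add: embeds_def)
  have "inj_on ((`) f) (edges_in A X E)"
    using inj X by (intro inj_onI) (auto simp: edges_in_def inj_on_image_eq_iff[OF inj])
  moreover have "f ` e \<in> edges_in M (f ` X) E" if e: "e \<in> edges_in A X E" for e
  proof -
    obtain xs where "xs \<in> interp A E" "e = set xs" using e by (auto simp: edges_in_def edges_def)
    moreover have "e \<subseteq> X" using e by (simp add: edges_in_def)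
    ultimately have "map f xs \<in> interp M E" using f X by (auto simp: embeds_def)
    then have "f ` e \<in> edges M E"
      using \<open>e = set xs\<close> by (metis edges_def imageI list.set_map)
    then show ?thesis using \<open>e \<subseteq> X\<close> by (simp add: edges_in_def image_mono)
  qed
  moreover have "\<exists>e \<in> edges_in A X E. e' = f ` e" if e': "e' \<in> edges_in M (f ` X) E" for e'
  proof -
    obtain ys where ys: "ys \<in> interp M E" "e' = set ys" "set ys \<subseteq> f ` X"
      using e' by (auto simp: edges_in_def edges_def)
    obtain xs where xs: "ys = map f xs" "set xs \<subseteq> X"
    proof -
      have "ys \<in> lists (f ` X)" using ys(3) by auto
      then have "ys \<in> map f ` lists X" by (simp only: lists_image)
      then show thesis using that by auto
    qed
    moreover have "set xs \<subseteq> universe A" using xs X by blast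
    ultimately have "xs \<in> interp A E" using f ys unfolding embeds_def by blast
    then have "set xs \<in> edges_in A X E" using xs by (auto simp: edges_in_def edges_def)
    then show ?thesis using xs ys by auto
  qed
  ultimately show ?thesis unfolding bij_betw_def by blast
qed

section \<open>Predimension\<close>

locale rational_weights =
  fixes ar :: "'e::finite \<Rightarrow> nat" and \<alpha> :: "'e \<Rightarrow> rat"
  assumes ar_ge_2: "ar E \<ge> 2" and \<alpha>_pos: "0 < \<alpha> E" and \<alpha>_less_1: "\<alpha> E < 1"
begin

text \<open>For \<open>X\<close> inside the universe this is \<delta> of the substructure induced on
  \<open>X\<close>. As a function on the subsets of one ambient structure it combines directly with
  unions and intersections.\<close>

definition predim :: "('e, 'a) struct \<Rightarrow> 'a set \<Rightarrow> rat" where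
  "predim M X = of_nat (card X) - (\<Sum>E\<in>UNIV. \<alpha> E * of_nat (card (edges_in M X E)))"

text \<open>The finitary approximation of strength: only extensions by at most \<open>k\<close>
  points are tested, so for sets of a given size the condition is within reach of a first-order
  formula.\<close>

definition k_strong :: "nat \<Rightarrow> ('e, 'a) struct \<Rightarrow> 'a set \<Rightarrow> bool" where
  "k_strong k M X \<longleftrightarrow> finite X \<and> X \<subseteq> universe M \<and>
     (\<forall>Y. finite Y \<and> X \<subseteq> Y \<and> Y \<subseteq> universe M \<and> card (Y - X) \<le> k \<longrightarrow>
        predim M X \<le> predim M Y)"

definition strong_in :: "('e, 'a) struct \<Rightarrow> 'a set \<Rightarrow> bool" where
  "strong_in M X \<longleftrightarrow> finite X \<and> X \<subseteq> universe M \<and>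
     (\<forall>Y. finite Y \<and> X \<subseteq> Y \<and> Y \<subseteq> universe M \<longrightarrow> predim M X \<le> predim M Y)"

lemma \<delta>_eq_predim: "\<delta> \<alpha> A = predim A (universe A)"
proof -
  have "{X. X \<subseteq> universe A \<and> (\<exists>xs \<in> interp A E. set xs = X)} = edges_in A (universe A) E" for E
    by (auto simp: edges_in_def edges_def)
  then show ?thesis by (simp add: \<delta>_def predim_def num_edges_def)
qed

lemma predim_substruct:
  assumes "substruct A M" "X \<subseteq> universe A"
  shows "predim A X = predim M X"
  using edges_in_substruct[OF assms] by (simp add: predim_def)

lemma \<delta>_substruct: "substruct A M \<Longrightarrow> \<delta> \<alpha> A = predim M (universe A)"
  by (simp add: \<delta>_eq_predim predim_substruct)

lemma predim_embeds:
  assumes "embeds f A M" "X \<subseteq> universe A"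
  shows "predim M (f ` X) = predim A X"
proof -
  have "card (f ` X) = card X"
    using assms by (meson card_image embeds_def inj_on_subset)
  moreover have "card (edges_in A X E) = card (edges_in M (f ` X) E)" for E
    by (rule bij_betw_same_card[OF embeds_edges_in[OF assms]])
  ultimately show ?thesis by (simp add: predim_def)
qed

lemma predim_induced: "X \<subseteq> Y \<Longrightarrow> predim (induced M Y) X = predim M X"
  by (simp add: predim_def edges_in_induced)

lemma K_\<alpha>_iff:
  "A \<in> K_\<alpha> ar \<alpha> \<longleftrightarrow> hypergraph ar A \<and> finite (universe A) \<and>
     (\<forall>X \<subseteq> universe A. 0 \<le> predim A X)"
proof -
  have "(\<forall>A'. substruct A' A \<longrightarrow> \<delta> \<alpha> A' \<ge> 0) \<longleftrightarrow> (\<forall>X \<subseteq> universe A. 0 \<le> predim A X)"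
  proof (intro iffI allI impI)
    fix X assume "\<forall>A'. substruct A' A \<longrightarrow> \<delta> \<alpha> A' \<ge> 0" and X: "X \<subseteq> universe A"
    then have "\<delta> \<alpha> (induced A X) \<ge> 0" by (simp add: substruct_induced)
    then show "0 \<le> predim A X" using \<delta>_substruct[OF substruct_induced[OF X]] by simp
  next
    fix A' assume "\<forall>X \<subseteq> universe A. 0 \<le> predim A X" and A': "substruct A' A"
    then show "\<delta> \<alpha> A' \<ge> 0" by (simp add: \<delta>_substruct[OF A'] substruct_iff)
  qed
  then show ?thesis by (auto simp: K_\<alpha>_def K_L_iff)
qed

lemma strong_in_finite: "strong_in M X \<Longrightarrow> finite X"
  and strong_in_subset: "strong_in M X \<Longrightarrow> X \<subseteq> universe M"
  and strong_in_le: "strong_in M X \<Longrightarrow> finite Y \<Longrightarrow> X \<subseteq> Y \<Longrightarrow> Y \<subseteq> universe M \<Longrightarrow>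
    predim M X \<le> predim M Y"
  by (simp_all add: strong_in_def)

lemma k_strong_subset: "k_strong k M X \<Longrightarrow> X \<subseteq> universe M"
  and k_strong_le: "k_strong k M X \<Longrightarrow> finite Y \<Longrightarrow> X \<subseteq> Y \<Longrightarrow> Y \<subseteq> universe M \<Longrightarrow>
    card (Y - X) \<le> k \<Longrightarrow> predim M X \<le> predim M Y"
  by (simp_all add: k_strong_def)

lemma k_strong_mono: "k_strong k M X \<Longrightarrow> j \<le> k \<Longrightarrow> k_strong j M X"
  by (auto simp: k_strong_def)

lemma strong_in_k_strong: "strong_in M X \<Longrightarrow> k_strong k M X"
  by (simp add: strong_in_def k_strong_def)

lemma strong_in_iff_k_strong: "strong_in M X \<longleftrightarrow> (\<forall>k. k_strong k M X)"
  unfolding strong_in_def k_strong_def by blast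

lemma strong_in_substruct:
  assumes "strong_in M X" "substruct B M" "X \<subseteq> universe B"
  shows "strong_in B X"
  using assms predim_substruct[OF assms(2)] by (auto simp: strong_in_def substruct_iff)

lemma strong_fin_iff:
  assumes "finite (universe B)"
  shows "strong_fin \<alpha> A B \<longleftrightarrow> substruct A B \<and> strong_in B (universe A)"
proof (cases "substruct A B")
  case True
  have "(\<forall>A'. substruct A A' \<and> substruct A' B \<longrightarrow> \<delta> \<alpha> A \<le> \<delta> \<alpha> A') \<longleftrightarrow>
        (\<forall>Y. finite Y \<and> universe A \<subseteq> Y \<and> Y \<subseteq> universe B \<longrightarrow>
           predim B (universe A) \<le> predim B Y)"
  proof (intro iffI allI impI)
    fix Y assume *: "\<forall>A'. substruct A A' \<and> substruct A' B \<longrightarrow> \<delta> \<alpha> A \<le> \<delta> \<alpha> A'"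
      and Y: "finite Y \<and> universe A \<subseteq> Y \<and> Y \<subseteq> universe B"
    then have "substruct (induced B Y) B" "substruct A (induced B Y)"
      using True by (auto simp: substruct_iff induced_induced)
    then have "\<delta> \<alpha> A \<le> \<delta> \<alpha> (induced B Y)" using * by blast
    then show "predim B (universe A) \<le> predim B Y"
      using \<delta>_substruct[OF True] \<delta>_substruct[OF \<open>substruct (induced B Y) B\<close>] by simp
  next
    fix A' assume *: "\<forall>Y. finite Y \<and> universe A \<subseteq> Y \<and> Y \<subseteq> universe B \<longrightarrow>
           predim B (universe A) \<le> predim B Y" and A': "substruct A A' \<and> substruct A' B"
    then have "universe A \<subseteq> universe A'" "universe A' \<subseteq> universe B"
      by (auto simp: substruct_iff)
    then show "\<delta> \<alpha> A \<le> \<delta> \<alpha> A'"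
      using * A' True assms by (metis \<delta>_substruct finite_subset)
  qed
  then show ?thesis
    using True assms by (auto simp: strong_fin_def strong_in_def substruct_iff intro: finite_subset)
qed (simp add: strong_fin_def)

lemma strong_iff: "strong \<alpha> A M \<longleftrightarrow> substruct A M \<and> strong_in M (universe A)"
proof
  assume A: "strong \<alpha> A M"
  then have sub: "substruct A M" and fin: "finite (universe A)" by (simp_all add: strong_def)
  have "predim M (universe A) \<le> predim M Y"
    if Y: "finite Y" "universe A \<subseteq> Y" "Y \<subseteq> universe M" for Y
  proof -
    have s: "substruct (induced M Y) M" "substruct A (induced M Y)"
      using sub Y by (auto simp: substruct_iff induced_induced)
    then have "strong_fin \<alpha> A (induced M Y)" using A Y unfolding strong_def by simp
    then have "strong_in (induced M Y) (universe A)" using Y by (simp add: strong_fin_iff)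
    then show ?thesis using strong_in_le[of "induced M Y" "universe A" Y] Y
      by (simp add: predim_induced)
  qed
  then show "substruct A M \<and> strong_in M (universe A)"
    using sub fin by (auto simp: strong_in_def substruct_iff)
next
  assume "substruct A M \<and> strong_in M (universe A)"
  then show "strong \<alpha> A M"
    unfolding strong_def
    by (auto simp: strong_fin_iff strong_in_finite
        intro!: strong_in_substruct[of M] dest: substruct_iff[THEN iffD1])
qed

lemma embeds_k_strong:
  assumes f: "embeds f B M" and X: "k_strong k B X"
  shows "k_strong k (induced M (f ` universe B)) (f ` X)"
proof -
  have inj: "inj_on f (universe B)" using f by (simp add: embeds_def)
  have Xs: "finite X" "X \<subseteq> universe B" using X by (simp_all add: k_strong_def)
  have "predim M (f ` X) \<le> predim M Y"
    if Y: "finite Y" "f ` X \<subseteq> Y" "Y \<subseteq> f ` universe B" "card (Y - f ` X) \<le> k" for Y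
  proof -
    obtain Z where Z: "Y = f ` Z" "Z \<subseteq> universe B" using Y(3) by (meson subset_imageE)
    have injZ: "inj_on f Z" using inj Z(2) by (rule inj_on_subset)
    have "X \<subseteq> Z" using Y(2) Z Xs inj_on_image_mem_iff[OF inj _ Z(2)] by blast
    moreover have "finite Z" using Y(1) Z(1) injZ by (metis finite_imageD)
    moreover have "Y - f ` X = f ` (Z - X)"
      using inj_on_image_set_diff[OF inj, of Z X] Z Xs by auto
    then have "card (Z - X) \<le> k"
      using Y(4) injZ by (metis card_image inj_on_subset Diff_subset)
    ultimately have "predim B X \<le> predim B Z" using k_strong_le[OF X] Z(2) by blast
    then show ?thesis using predim_embeds[OF f] Z Xs by simp
  qed
  then show ?thesis using Xs by (auto simp: k_strong_def predim_induced)
qed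

lemma embeds_strong_in:
  "embeds f B M \<Longrightarrow> strong_in B X \<Longrightarrow> strong_in (induced M (f ` universe B)) (f ` X)"
  using embeds_k_strong unfolding strong_in_iff_k_strong by blast

text \<open>Cardinality is modular. Edges inside both sets are exactly those inside the
  intersection, whereas the union may carry further edges inside neither set; these only lower the
  left side.\<close>

lemma predim_submodular:
  assumes "finite X" "finite Y"
  shows "predim M (X \<union> Y) + predim M (X \<inter> Y) \<le> predim M X + predim M Y"
proof -
  have "\<alpha> E * of_nat (card (edges_in M X E)) + \<alpha> E * of_nat (card (edges_in M Y E))
      \<le> \<alpha> E * of_nat (card (edges_in M (X \<union> Y) E)) + \<alpha> E * of_nat (card (edges_in M (X \<inter> Y) E))" for E
  proof -
    have "edges_in M X E \<union> edges_in M Y E \<subseteq> edges_in M (X \<union> Y) E"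
      "edges_in M X E \<inter> edges_in M Y E = edges_in M (X \<inter> Y) E"
      by (auto simp: edges_in_def)
    then have "card (edges_in M X E) + card (edges_in M Y E)
      \<le> card (edges_in M (X \<union> Y) E) + card (edges_in M (X \<inter> Y) E)"
      using assms by (metis add_le_mono1 card_Un_Int card_mono finite_UnI finite_edges_in)
    then have "of_nat (card (edges_in M X E) + card (edges_in M Y E))
      \<le> (of_nat (card (edges_in M (X \<union> Y) E) + card (edges_in M (X \<inter> Y) E)) :: rat)"
      by (rule of_nat_mono)
    then show ?thesis using \<alpha>_pos[of E]
      by (simp flip: distrib_left)
  qed
  then have "(\<Sum>E\<in>UNIV. \<alpha> E * of_nat (card (edges_in M X E)) + \<alpha> E * of_nat (card (edges_in M Y E)))
      \<le> (\<Sum>E\<in>UNIV. \<alpha> E * of_nat (card (edges_in M (X \<union> Y) E)) + \<alpha> E * of_nat (card (edges_in M (X \<inter> Y) E)))"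
    by (intro sum_mono)
  moreover have "of_nat (card X) + of_nat (card Y) =
      (of_nat (card (X \<union> Y)) + of_nat (card (X \<inter> Y)) :: rat)"
    using card_Un_Int[OF assms] by (metis of_nat_add)
  ultimately show ?thesis by (simp add: predim_def sum.distrib)
qed

lemma predim_empty:
  assumes "hypergraph ar M"
  shows "predim M {} = 0"
proof -
  have "e \<noteq> {}" if "e \<in> edges M E" for e E
    using hypergraph_edge(3)[OF assms that] ar_ge_2[of E] by auto
  then have "edges_in M {} E = {}" for E by (auto simp: edges_in_def)
  then show ?thesis by (simp add: predim_def)
qed

lemma predim_le_card: "predim M X \<le> of_nat (card X)"
  using \<alpha>_pos by (simp add: predim_def sum_nonneg less_imp_le)

text \<open>Submodularity for \<open>Y\<close> and the universe of \<open>D\<close>. Both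
  \<open>Y \<union> D\<close> over \<open>D\<close> and \<open>Y \<inter> D\<close> over
  \<open>X\<close> add at most \<open>card (Y - X)\<close> points, so the same \<open>k\<close>
  serves in all three places.\<close>

lemma k_strong_trans:
  assumes D: "k_strong k M (universe D)" "substruct D M" and X: "k_strong k D X"
  shows "k_strong k M X"
proof -
  have fin: "finite X" "finite (universe D)" and sub: "X \<subseteq> universe D" "universe D \<subseteq> universe M"
    using assms by (auto simp: k_strong_def)
  have "predim M X \<le> predim M Y"
    if Y: "finite Y" "X \<subseteq> Y" "Y \<subseteq> universe M" "card (Y - X) \<le> k" for Y
  proof -
    let ?D = "universe D"
    have "card (Y \<union> ?D - ?D) \<le> card (Y - X)" "card (Y \<inter> ?D - X) \<le> card (Y - X)"
      using Y(1) sub(1) by (auto intro!: card_mono)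
    then have c: "card (Y \<union> ?D - ?D) \<le> k" "card (Y \<inter> ?D - X) \<le> k" using Y(4) by auto
    have "predim M ?D \<le> predim M (Y \<union> ?D)"
      using k_strong_le[OF D(1)] Y fin sub c by auto
    moreover have "predim D X \<le> predim D (Y \<inter> ?D)"
      using k_strong_le[OF X] Y fin sub c by auto
    then have "predim M X \<le> predim M (Y \<inter> ?D)"
      using predim_substruct[OF D(2)] sub by auto
    ultimately show ?thesis
      using predim_submodular[OF Y(1) fin(2), of M] by linarith
  qed
  then show ?thesis using fin sub by (auto simp: k_strong_def)
qed

lemma strong_in_trans:
  assumes "strong_in M (universe D)" "substruct D M" "strong_in D X"
  shows "strong_in M X"
  using assms k_strong_trans unfolding strong_in_iff_k_strong by blast

section \<open>Discreteness\<close>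

abbreviation c :: rat where "c \<equiv> of_int (common_denom \<alpha>)"

lemma c_pos: "0 < c"
proof -
  have "common_denom \<alpha> \<noteq> 0"
    unfolding common_denom_def
    by (subst Lcm_0_iff) (auto, metis quotient_of_denom_pos' less_irrefl)
  moreover have "common_denom \<alpha> \<ge> 0" by (simp add: common_denom_def)
  ultimately show ?thesis by simp
qed

lemma \<alpha>_grid: "\<alpha> E * c \<in> \<int>"
proof -
  obtain p q where pq: "quotient_of (\<alpha> E) = (p, q)" by fastforce
  have "q dvd common_denom \<alpha>"
    unfolding common_denom_def by (rule dvd_Lcm) (metis pq rangeI snd_conv)
  then obtain r where "common_denom \<alpha> = q * r" by blast
  moreover have "\<alpha> E = of_int p / of_int q" using quotient_of_div[OF pq] .
  moreover have "q > 0" using quotient_of_denom_pos[OF pq] .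
  ultimately have "\<alpha> E * c = of_int (p * r)" by simp
  then show ?thesis by (metis Ints_of_int)
qed

lemma predim_grid: "predim M X * c \<in> \<int>"
proof -
  have "predim M X * c = of_nat (card X) * c - (\<Sum>E\<in>UNIV. (\<alpha> E * c) * of_nat (card (edges_in M X E)))"
    by (simp add: predim_def right_diff_distrib sum_distrib_left mult_ac)
  also have "\<dots> \<in> \<int>" by (intro Ints_diff Ints_mult Ints_sum \<alpha>_grid Ints_of_nat Ints_of_int)
  finally show ?thesis .
qed

lemma grid_gap:
  fixes x y :: rat
  assumes "x * c \<in> \<int>" "y * c \<in> \<int>" "x < y"
  shows "x + 1 / c \<le> y"
proof -
  obtain m n where mn: "x * c = of_int m" "y * c = of_int n"
    using assms by (auto elim!: Ints_cases)
  have "x * c < y * c" using assms(3) c_pos by simp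
  then have "m + 1 \<le> n" by (simp add: mn)
  then have "of_int (m + 1) \<le> (of_int n :: rat)" by (simp only: of_int_le_iff)
  then have "x * c + 1 \<le> y * c" by (simp add: mn)
  then show ?thesis using c_pos by (simp add: field_simps)
qed

lemma predim_gap: "predim M X < predim N Y \<Longrightarrow> predim M X + 1 / c \<le> predim N Y"
  by (intro grid_gap predim_grid)

lemma \<alpha>_ge: "1 / c \<le> \<alpha> E"
  using grid_gap[of 0 "\<alpha> E"] \<alpha>_grid \<alpha>_pos by simp

lemma c_ge_1: "1 \<le> c"
  using c_pos by (metis of_int_0_less_iff of_int_1_le_iff int_one_le_iff_zero_less)

text \<open>Bezout's identity: \<open>c\<close> and the integers \<open>c * \<alpha> E\<close> have
  no common divisor \<open>n > 1\<close>, since otherwise \<open>c / n\<close> would be a smaller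
  common denominator of all weights.\<close>

lemma unit_combination: "\<exists>a b. 1 / c = of_int a + (\<Sum>E\<in>UNIV. of_int (b E) * \<alpha> E)"
proof -
  define p where "p E = \<lfloor>\<alpha> E * c\<rfloor>" for E
  have p: "of_int (p E) = \<alpha> E * c" for E unfolding p_def using \<alpha>_grid by (metis floor_of_int Ints_cases)
  define H where "H = {common_denom \<alpha> * a + (\<Sum>E\<in>UNIV. b E * p E) | a b. True}"
  have H_diff: "x - k * y \<in> H" if xy: "x \<in> H" "y \<in> H" for x y k
  proof -
    obtain a b a' b' where "x = common_denom \<alpha> * a + (\<Sum>E\<in>UNIV. b E * p E)"
      "y = common_denom \<alpha> * a' + (\<Sum>E\<in>UNIV. b' E * p E)" using xy unfolding H_def by blast
    then have "x - k * y = common_denom \<alpha> * (a - k * a') + (\<Sum>E\<in>UNIV. (b E - k * b' E) * p E)"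
      by (simp add: algebra_simps sum_subtractf sum_distrib_left)
    then show ?thesis by (auto simp: H_def)
  qed
  have cH: "common_denom \<alpha> \<in> H"
    unfolding H_def by (intro CollectI exI[of _ 1] exI[of _ "\<lambda>_. 0"]) simp
  have pH: "p E \<in> H" for E
    unfolding H_def by (intro CollectI exI[of _ 0] exI[of _ "\<lambda>E'. if E' = E then 1 else 0"])
      (simp add: if_distrib[of "\<lambda>x. x * _"] cong: if_cong)
  \<comment> \<open>\<open>H\<close> is a subgroup of the integers; its least positive element
    divides all its elements.\<close>
  have "\<exists>n::nat. n > 0 \<and> int n \<in> H"
    using cH c_pos by (intro exI[of _ "nat (common_denom \<alpha>)"]) simp
  then obtain n :: nat where n: "n > 0" "int n \<in> H" and least: "\<And>m. m < n \<Longrightarrow> \<not> (m > 0 \<and> int m \<in> H)"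
    using exists_least_iff[of "\<lambda>n::nat. n > 0 \<and> int n \<in> H"] by auto
  have dvd: "int n dvd x" if "x \<in> H" for x
  proof -
    have "x mod int n = x - (x div int n) * int n" by (simp add: minus_div_mult_eq_mod)
    then have "x mod int n \<in> H" using H_diff[OF that n(2)] by metis
    moreover have "0 \<le> x mod int n" "x mod int n < int n" using n(1) by auto
    ultimately have "x mod int n = 0"
      using least[of "nat (x mod int n)"] n(1) by (metis nat_0_le nat_less_iff not_le_imp_less
          le_zero_eq nat_le_0 nat_eq_iff2 zero_less_nat_eq le_less)
    then show ?thesis by (simp add: dvd_eq_mod_eq_0)
  qed
  \<comment> \<open>\<open>r\<close>, the quotient of \<open>c\<close> by \<open>n\<close>, is again
    a common denominator of the weights, hence a multiple of \<open>c\<close>; this forces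
    \<open>n = 1\<close>.\<close>
  obtain r where r: "common_denom \<alpha> = int n * r" using dvd[OF cH] by blast
  have r_pos: "r > 0" using r c_pos n(1) by (simp add: zero_less_mult_iff)
  have "snd (quotient_of (\<alpha> E)) dvd r" for E
  proof -
    obtain s where s: "p E = int n * s" using dvd[OF pH] by blast
    have "\<alpha> E = of_int (p E) / c" using p[of E] c_pos by (simp add: field_simps)
    also have "\<dots> = of_int s / of_int r" using n(1) r_pos by (simp add: r s)
    finally have *: "\<alpha> E = of_int s / of_int r" .
    obtain u v where uv: "quotient_of (\<alpha> E) = (u, v)" by fastforce
    have "\<alpha> E = of_int u / of_int v" "v > 0" "coprime u v"
      using quotient_of_div[OF uv] quotient_of_denom_pos[OF uv] quotient_of_coprime[OF uv] by auto
    then have "of_int u * of_int r = (of_int s * of_int v :: rat)"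
      using * r_pos by (simp add: field_simps)
    then have "u * r = s * v" by (metis of_int_eq_iff of_int_mult)
    then have "v dvd r" using \<open>coprime u v\<close>
      by (metis coprime_commute coprime_dvd_mult_right_iff dvd_triv_right)
    then show ?thesis by (simp add: uv)
  qed
  then have "common_denom \<alpha> dvd r" unfolding common_denom_def by (intro Lcm_least) auto
  then have "int n * r \<le> r" using r r_pos by (metis zdvd_imp_le)
  then have "n = 1" using r_pos n(1) by simp
  then obtain a b where "1 = common_denom \<alpha> * a + (\<Sum>E\<in>UNIV. b E * p E)"
    using n(2) by (auto simp: H_def)
  then have "(1::rat) = of_int (common_denom \<alpha> * a + (\<Sum>E\<in>UNIV. b E * p E))" by simp
  also have "\<dots> = c * of_int a + (\<Sum>E\<in>UNIV. of_int (b E) * \<alpha> E * c)"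
    by (simp add: p mult.assoc)
  also have "\<dots> = c * (of_int a + (\<Sum>E\<in>UNIV. of_int (b E) * \<alpha> E))"
    by (simp add: sum_distrib_left algebra_simps)
  finally have "1 / c = of_int a + (\<Sum>E\<in>UNIV. of_int (b E) * \<alpha> E)"
    using c_pos by (simp add: field_simps)
  then show ?thesis by blast
qed

section \<open>Closures\<close>

lemma closure_exists:
  assumes nonneg: "\<And>X. finite X \<Longrightarrow> X \<subseteq> universe M \<Longrightarrow> 0 \<le> predim M X"
    and F: "finite F" "F \<subseteq> universe M"
  shows "\<exists>X. F \<subseteq> X \<and> strong_in M X"
proof -
  let ?P = "\<lambda>X. finite X \<and> F \<subseteq> X \<and> X \<subseteq> universe M"
  obtain X where X: "?P X" and
    least: "\<And>Y. ?P Y \<Longrightarrow> nat \<lfloor>predim M X * c\<rfloor> \<le> nat \<lfloor>predim M Y * c\<rfloor>"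
    using ex_has_least_nat[of ?P F "\<lambda>X. nat \<lfloor>predim M X * c\<rfloor>"] F by blast
  have "predim M X \<le> predim M Y" if Y: "finite Y" "X \<subseteq> Y" "Y \<subseteq> universe M" for Y
  proof -
    have "\<lfloor>predim M X * c\<rfloor> \<le> \<lfloor>predim M Y * c\<rfloor>"
      using least[of Y] X Y nonneg[of Y] c_pos
      by (simp add: nat_le_eq_zle subset_trans[of F X Y])
    then have "predim M X * c \<le> predim M Y * c"
      using predim_grid[of M X] predim_grid[of M Y] by (auto elim!: Ints_cases)
    then show ?thesis using c_pos by simp
  qed
  then show ?thesis using X unfolding strong_in_def by blast
qed

text \<open>A set that fails the demand has a witness with at most \<open>g (card F)\<close> further
  points and smaller predimension; replace the set by the witness. Each replacement costs at least
  \<open>1/c\<close>, so their number is bounded in terms of \<open>s\<close>, and so is the final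
  size.\<close>

lemma bounded_closure_exists:
  fixes g :: "nat \<Rightarrow> nat"
  assumes nonneg: "\<And>X. finite X \<Longrightarrow> X \<subseteq> universe M \<Longrightarrow> 0 \<le> predim M X"
  shows "\<exists>b. \<forall>F. finite F \<and> F \<subseteq> universe M \<and> card F \<le> s \<longrightarrow>
    (\<exists>X. F \<subseteq> X \<and> card X \<le> b \<and> k_strong (g (card X)) M X)"
proof -
  \<comment> \<open>Induction on an upper bound \<open>j\<close> for \<open>c\<close> times the
    predimension. The size bound \<open>s\<close> must vary with it, because the witness is larger
    than \<open>F\<close>.\<close>
  have "\<exists>b. \<forall>F. finite F \<and> F \<subseteq> universe M \<and> card F \<le> s \<and> predim M F * c \<le> of_nat j \<longrightarrow>
    (\<exists>X. F \<subseteq> X \<and> card X \<le> b \<and> k_strong (g (card X)) M X)" for j s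
  proof (induction j arbitrary: s)
    case 0
    have "k_strong (g (card F)) M F"
      if F: "finite F" "F \<subseteq> universe M" "predim M F * c \<le> 0" for F
    proof -
      have "predim M F \<le> 0" using F(3) c_pos by (simp add: mult_le_0_iff)
      then show ?thesis using F nonneg unfolding k_strong_def by (meson order_trans)
    qed
    then show ?case by (intro exI[of _ s]) auto
  next
    case (Suc j)
    define G where "G = Max (g ` {..s})"
    have G: "g i \<le> G" if "i \<le> s" for i unfolding G_def using that by (intro Max_ge) auto
    obtain b where b: "\<forall>F. finite F \<and> F \<subseteq> universe M \<and> card F \<le> s + G \<and>
        predim M F * c \<le> of_nat j \<longrightarrow>
        (\<exists>X. F \<subseteq> X \<and> card X \<le> b \<and> k_strong (g (card X)) M X)"
      using Suc.IH[of "s + G"] by (rule exE)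
    have "\<exists>X. F \<subseteq> X \<and> card X \<le> max b s \<and> k_strong (g (card X)) M X"
      if F: "finite F" "F \<subseteq> universe M" "card F \<le> s" "predim M F * c \<le> of_nat (Suc j)" for F
    proof (cases "k_strong (g (card F)) M F")
      case True
      then show ?thesis using F by (intro exI[of _ F]) auto
    next
      case False
      then obtain Y where Y: "finite Y" "F \<subseteq> Y" "Y \<subseteq> universe M" "card (Y - F) \<le> g (card F)"
        "predim M Y < predim M F"
        using F unfolding k_strong_def not_le[symmetric] by blast
      have "card Y = card F + card (Y - F)"
        using Y(1,2) F(1) by (simp add: card_Diff_subset card_mono)
      then have "card Y \<le> s + G" using Y(4) F(3) G[OF F(3)] by linarith
      moreover have "predim M Y * c + 1 \<le> predim M F * c"
        using predim_gap[OF Y(5)] c_pos by (simp add: field_simps)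
      then have "predim M Y * c \<le> of_nat j" using F(4) by simp
      ultimately obtain X where "Y \<subseteq> X" "card X \<le> b" "k_strong (g (card X)) M X"
        using b[rule_format, of Y] Y by blast
      then show ?thesis using Y by (intro exI[of _ X]) auto
    qed
    then show ?case by (intro exI[of _ "max b s"]) blast
  qed
  \<comment> \<open>A set with at most \<open>s\<close> points has predimension at most
    \<open>s\<close>, so \<open>c * s\<close> is a sufficient starting value.\<close>
  from this[of s "nat (common_denom \<alpha>) * s"] obtain b where
    b: "\<forall>F. finite F \<and> F \<subseteq> universe M \<and> card F \<le> s \<and>
        predim M F * c \<le> of_nat (nat (common_denom \<alpha>) * s) \<longrightarrow>
        (\<exists>X. F \<subseteq> X \<and> card X \<le> b \<and> k_strong (g (card X)) M X)" by (rule exE)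
  have "predim M F * c \<le> of_nat (nat (common_denom \<alpha>) * s)" if "card F \<le> s" for F
  proof -
    have "predim M F \<le> of_nat s"
      using predim_le_card[of M F] that by (meson of_nat_mono order_trans)
    then have "predim M F * c \<le> of_nat s * c" using c_pos by simp
    also have "\<dots> = of_nat (nat (common_denom \<alpha>) * s)" using c_pos by simp
    finally show ?thesis .
  qed
  then show ?thesis using b by blast
qed

end

section \<open>Minimal pairs\<close>

text \<open>The new universe \<open>U\<close> is a separate argument, so that a fresh point and the
  edge linking it can be added in one step.\<close>

definition add_edge :: "('e, 'a) struct \<Rightarrow> 'a set \<Rightarrow> 'e \<Rightarrow> 'a set \<Rightarrow> ('e, 'a) struct" where
  "add_edge D U E e = of_edges U ((edges D)(E := insert e (edges D E)))"

lemma universe_add_edge [simp]: "universe (add_edge D U E e) = U"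
  by (simp add: add_edge_def)

lemma edges_add_edge:
  assumes "hypergraph ar D" "finite e"
  shows "edges (add_edge D U E e) E' = (if E' = E then insert e (edges D E) else edges D E')"
  unfolding add_edge_def
  using assms hypergraph_edge(2)[OF assms(1)] by (subst edges_of_edges) (auto split: if_splits)

lemma hypergraph_add_edge:
  assumes "hypergraph ar D" "universe D \<subseteq> U" "e \<subseteq> U" "finite e" "card e = ar E"
  shows "hypergraph ar (add_edge D U E e)"
  unfolding add_edge_def
proof (rule hypergraph_of_edges)
  fix E' e' assume "e' \<in> ((edges D)(E := insert e (edges D E))) E'"
  then have "e' = e \<and> E' = E \<or> e' \<in> edges D E'" by (simp split: if_splits)
  then show "e' \<subseteq> U \<and> finite e' \<and> card e' = ar E'"
    using assms(2-5) hypergraph_edge[OF assms(1)] by (elim disjE) (simp, blast)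
qed

lemma substruct_add_edge:
  assumes "hypergraph ar D" "universe D \<subseteq> U" "e \<subseteq> U" "finite e" "card e = ar E"
    and "substruct A D" "\<not> e \<subseteq> universe A"
  shows "substruct A (add_edge D U E e)"
proof (rule hypergraph_substructI)
  show "hypergraph ar A" using assms(1,6) by (rule hypergraph_substruct)
  show "hypergraph ar (add_edge D U E e)" using assms by (intro hypergraph_add_edge)
  show "universe A \<subseteq> universe (add_edge D U E e)"
    using assms by (auto simp: substruct_iff)
  show "edges A E' = edges_in (add_edge D U E e) (universe A) E'" for E'
  proof -
    have "edges A E' = edges_in D (universe A) E'"
      using assms(6) by (metis edges_induced substruct_iff)
    then show ?thesis using assms(7)
      by (auto simp: edges_in_def edges_add_edge[OF assms(1,4)])
  qed
qed

lemma exists_superset_card: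
  assumes "finite U" "S \<subseteq> U" "card S \<le> n" "n \<le> card U"
  shows "\<exists>e. S \<subseteq> e \<and> e \<subseteq> U \<and> card e = n"
proof -
  have fS: "finite S" using assms finite_subset by blast
  have "n - card S \<le> card (U - S)" using assms fS by (simp add: card_Diff_subset)
  then obtain T where T: "T \<subseteq> U - S" "card T = n - card S" "finite T"
    by (rule obtain_subset_with_card_n)
  then have "card (S \<union> T) = n" using assms fS by (subst card_Un_disjoint) auto
  then show ?thesis using T assms by (intro exI[of _ "S \<union> T"]) auto
qed

section \<open>A path of new points that lowers the predimension by \<open>1/c\<close>\<close>

context rational_weights
begin

lemma predim_add_edge:
  assumes "hypergraph ar D" "finite e" "e \<notin> edges D E" "finite Y"
  shows "predim (add_edge D U E e) Y = predim D Y - (if e \<subseteq> Y then \<alpha> E else 0)"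
proof -
  have 1: "edges_in (add_edge D U E e) Y E' =
      (if E' = E \<and> e \<subseteq> Y then insert e (edges_in D Y E) else edges_in D Y E')" for E'
    by (auto simp: edges_in_def edges_add_edge[OF assms(1,2)])
  have "e \<notin> edges_in D Y E" using assms(3) by (simp add: edges_in_def)
  then have "\<alpha> E' * of_nat (card (edges_in (add_edge D U E e) Y E')) =
      \<alpha> E' * of_nat (card (edges_in D Y E')) + (if E' = E then if e \<subseteq> Y then \<alpha> E else 0 else 0)" for E'
    using finite_edges_in[OF assms(4), of D E] unfolding 1 by (simp add: algebra_simps)
  then show ?thesis by (simp add: predim_def sum.distrib)
qed

lemma predim_insert_isolated:
  assumes "finite Y" "x \<notin> Y" "\<And>E e. e \<in> edges D E \<Longrightarrow> x \<notin> e"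
  shows "predim D (insert x Y) = predim D Y + 1"
proof -
  have "edges_in D (insert x Y) E = edges_in D Y E" for E
    using assms(3) by (auto simp: edges_in_def)
  then show ?thesis using assms(1,2) by (simp add: predim_def)
qed

text \<open>The budget of the path: its first point counts \<open>1\<close>, each of
  \<open>l\<close> further points counts \<open>1 - \<alpha> E0\<close> because it brings a linking
  edge, and \<open>m E\<close> more edges of type \<open>E\<close> are placed. The equation says
  that the total is \<open>-1/c\<close>. The bound \<open>K\<close> makes the path long and the
  extra edges numerous.\<close>

lemma load_combination:
  "\<exists>l m. K \<le> l \<and> K \<le> (\<Sum>E\<in>UNIV. m E) \<and>
     of_nat l * (1 - \<alpha> E0) + 1 + 1 / c = (\<Sum>E\<in>UNIV. of_nat (m E) * \<alpha> E)"
proof -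
  obtain a b where ab: "1 / c = of_int a + (\<Sum>E\<in>UNIV. of_int (b E) * \<alpha> E)"
    using unit_combination by blast
  define d where "d = common_denom \<alpha>"
  define p where "p E = \<lfloor>\<alpha> E * c\<rfloor>" for E
  have p: "of_int (p E) = \<alpha> E * c" for E
    unfolding p_def using \<alpha>_grid by (metis floor_of_int Ints_cases)
  have d_pos: "d > 0" using c_pos by (simp add: d_def)
  have p_pos: "p E > 0" for E
    using p[of E] \<alpha>_pos[of E] c_pos by (metis mult_pos_pos of_int_0_less_iff)
  have p_less: "p E < d" for E
  proof -
    have "of_int (p E) < (of_int d :: rat)" using p[of E] \<alpha>_less_1[of E] c_pos by (simp add: d_def)
    then show ?thesis by simp
  qed
  \<comment> \<open>The coefficients \<open>b E\<close> may be negative. Raising each by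
    \<open>d * T\<close> makes it at least \<open>K\<close> and changes the sum by the integer
    \<open>T * P\<close>.\<close>
  define T where "T = int K + (\<Sum>E\<in>UNIV. \<bar>b E\<bar>)"
  define P where "P = (\<Sum>E\<in>UNIV. p E)"
  \<comment> \<open>The points \<open>l\<close> and the extra edges \<open>z\<close> of type
    \<open>E0\<close> are tied by \<open>l + z = d * y\<close>, so that
    \<open>\<alpha> E0 * (l + z)\<close> is the integer \<open>p E0 * y\<close>. As
    \<open>0 < p E0 < d\<close>, a large \<open>y\<close> makes both of them large; it absorbs the
    integer error left by \<open>a\<close> and \<open>T * P\<close>.\<close>
  define y where "y = int K + 1 + \<bar>a\<bar> + T * P"
  define z where "z = (d - p E0) * y - T * P + 1 + a"
  define l where "l = T * P + p E0 * y - 1 - a"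
  have T_ge: "T \<ge> int K + \<bar>b E\<bar>" for E
    unfolding T_def using member_le_sum[of E UNIV "\<lambda>E. \<bar>b E\<bar>"] by simp
  have "T \<ge> 0" using T_ge[of E0] by linarith
  moreover have "P \<ge> 0" unfolding P_def using p_pos by (simp add: sum_nonneg less_imp_le)
  ultimately have TP: "T * P \<ge> 0" by simp
  then have y: "y \<ge> int K + 1 + \<bar>a\<bar>" "y \<ge> 1 + \<bar>a\<bar> + T * P" by (simp_all add: y_def)
  then have "1 * y \<le> p E0 * y" "1 * y \<le> (d - p E0) * y"
    using p_pos[of E0] p_less[of E0] by (intro mult_right_mono; linarith)+
  then have l: "l \<ge> int K" and z: "z \<ge> 0" using y TP by (simp_all add: l_def z_def)
  define m where "m E = nat (b E + d * T + (if E = E0 then z else 0))" for E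
  have dT: "d * T \<ge> T" using \<open>T \<ge> 0\<close> d_pos by (metis mult_right_mono mult_1 int_one_le_iff_zero_less)
  have m: "int (m E) = b E + d * T + (if E = E0 then z else 0)" for E
    unfolding m_def using T_ge[of E] dT z by (subst nat_0_le) auto
  have "int K \<le> int (m E0)" using m[of E0] T_ge[of E0] dT z by auto
  then have "K \<le> m E0" by simp
  also have "m E0 \<le> (\<Sum>E\<in>UNIV. m E)" by (rule member_le_sum) auto
  finally have mK: "K \<le> (\<Sum>E\<in>UNIV. m E)" .
  have "of_nat (m E) * \<alpha> E = of_int (b E) * \<alpha> E + of_int T * of_int (p E) +
      (if E = E0 then of_int z * \<alpha> E0 else 0)" for E
  proof -
    have "of_nat (m E) = (of_int (int (m E)) :: rat)" by simp
    also have "\<dots> = of_int (b E) + c * of_int T + (if E = E0 then of_int z else 0)"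
      unfolding m by (simp add: d_def)
    finally show ?thesis using p[of E] by (simp add: algebra_simps)
  qed
  then have "(\<Sum>E\<in>UNIV. of_nat (m E) * \<alpha> E) =
      (\<Sum>E\<in>UNIV. of_int (b E) * \<alpha> E) + of_int T * of_int P + of_int z * \<alpha> E0"
    by (simp add: sum.distrib P_def sum_distrib_left)
  moreover have "of_int l + 1 + of_int a - of_int T * of_int P = \<alpha> E0 * c * of_int y"
  proof -
    have "l + 1 + a - T * P = p E0 * y" by (simp add: l_def)
    then have "of_int (l + 1 + a - T * P) = (of_int (p E0 * y) :: rat)" by simp
    then show ?thesis by (simp add: p)
  qed
  moreover have "of_int z + of_int l = c * of_int y"
  proof -
    have "z + l = d * y" by (simp add: l_def z_def algebra_simps)
    then have "of_int (z + l) = (of_int (d * y) :: rat)" by simp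
    then show ?thesis by (simp add: d_def)
  qed
  then have "\<alpha> E0 * (of_int z + of_int l) = \<alpha> E0 * c * of_int y" by simp
  ultimately have "of_int l * (1 - \<alpha> E0) + 1 + 1 / c = (\<Sum>E\<in>UNIV. of_nat (m E) * \<alpha> E)"
    using ab by (simp add: algebra_simps)
  moreover have "of_int l = (of_nat (nat l) :: rat)" using l by simp
  moreover have "K \<le> nat l" using l by simp
  ultimately show ?thesis using mK by (metis (no_types, lifting))
qed

text \<open>
  The state of a greedy construction: the points of \<open>D'\<close> outside \<open>D\<close> form a path
  ending in \<open>x\<close>, and \<open>v\<close> is their relative predimension. It remains to prolong the path by
  \<open>n\<close> points, linked by edges of type \<open>E0\<close>, and to place \<open>m E\<close> further edges of
  type \<open>E\<close>, each at the current end point of the path.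
\<close>

definition path_state ::
  "'e \<Rightarrow> ('e, nat) struct \<Rightarrow> ('e, nat) struct \<Rightarrow> nat \<Rightarrow> rat \<Rightarrow> nat \<Rightarrow> ('e \<Rightarrow> nat) \<Rightarrow> bool" where
  "path_state E0 D D' x v n m \<longleftrightarrow>
     hypergraph ar D' \<and> finite (universe D') \<and> substruct D D' \<and>
     x \<in> universe D' - universe D \<and>
     (\<forall>Z \<subseteq> universe D' - universe D. x \<notin> Z \<longrightarrow>
        predim D (universe D) \<le> predim D' (universe D \<union> Z)) \<and>
     (\<forall>Z. Z \<subset> universe D' - universe D \<longrightarrow> x \<in> Z \<longrightarrow>
        predim D (universe D) + v + 1 / c \<le> predim D' (universe D \<union> Z)) \<and>
     predim D' (universe D') = predim D (universe D) + v \<and>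
     (0 \<le> v \<or> n = 0) \<and>
     (\<Sum>E\<in>UNIV. \<alpha> E * of_nat (card {e \<in> edges D' E. x \<in> e})) + v \<le> 2 \<and>
     v + of_nat n * (1 - \<alpha> E0) + 1 / c = (\<Sum>E\<in>UNIV. of_nat (m E) * \<alpha> E) \<and>
     card {d \<in> universe D. \<forall>E. \<forall>e \<in> edges D' E. d \<in> e \<longrightarrow> e \<subseteq> universe D} \<le> (\<Sum>E\<in>UNIV. m E)"

lemma path_stateD:
  assumes "path_state E0 D D' x v n m"
  shows "hypergraph ar D'" "finite (universe D')" "substruct D D'" "x \<in> universe D' - universe D"
    "Z \<subseteq> universe D' - universe D \<Longrightarrow> x \<notin> Z \<Longrightarrow>
      predim D (universe D) \<le> predim D' (universe D \<union> Z)"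
    "Z \<subset> universe D' - universe D \<Longrightarrow> x \<in> Z \<Longrightarrow>
      predim D (universe D) + v + 1 / c \<le> predim D' (universe D \<union> Z)"
    "predim D' (universe D') = predim D (universe D) + v" "0 \<le> v \<or> n = 0"
    "(\<Sum>E\<in>UNIV. \<alpha> E * of_nat (card {e \<in> edges D' E. x \<in> e})) + v \<le> 2"
    "v + of_nat n * (1 - \<alpha> E0) + 1 / c = (\<Sum>E\<in>UNIV. of_nat (m E) * \<alpha> E)"
    "card {d \<in> universe D. \<forall>E. \<forall>e \<in> edges D' E. d \<in> e \<longrightarrow> e \<subseteq> universe D} \<le> (\<Sum>E\<in>UNIV. m E)"
  using assms unfolding path_state_def by simp_all

text \<open>By discreteness \<open>v < \<alpha> E0\<close> leaves the gap
  \<open>v + 1/c \<le> \<alpha> E0\<close>. A set containing the new end \<open>x'\<close> but not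
  \<open>x\<close> misses the linking edge and pays \<open>1\<close> for \<open>x'\<close>, which by
  the gap is at least \<open>1/c\<close> above the new total
  \<open>v + 1 - \<alpha> E0\<close>.\<close>

lemma path_state_add_point:
  assumes S: "path_state E0 D D' x v (Suc n) m" and v: "v < \<alpha> E0"
    and large: "ar E0 \<le> card (universe D)"
  shows "\<exists>D'' x'. path_state E0 D D'' x' (v + 1 - \<alpha> E0) n m \<and>
    card (universe D'') = Suc (card (universe D'))"
proof -
  note D' = path_stateD(1-3)[OF S] and x = path_stateD(4)[OF S] and S1 = path_stateD(5)[OF S]
    and S2 = path_stateD(6)[OF S] and S3 = path_stateD(7)[OF S] and S6 = path_stateD(10)[OF S]
    and S7 = path_stateD(11)[OF S]
  have S4: "0 \<le> v" using path_stateD(8)[OF S] by simp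
  have sub: "universe D \<subseteq> universe D'" using D'(3) by (simp add: substruct_iff)
  obtain x' where x': "x' \<notin> universe D'" using ex_new_if_finite[OF infinite_UNIV_nat D'(2)] by blast
  define U where "U = insert x' (universe D')"
  have U: "finite U" "universe D' \<subseteq> U" using D'(2) by (auto simp: U_def)
  have "card {x, x'} \<le> ar E0" using ar_ge_2[of E0] x x' by (simp add: card_insert_if)
  moreover have "ar E0 \<le> card U" using large sub U by (meson card_mono order_trans subset_trans)
  ultimately obtain e where e: "{x, x'} \<subseteq> e" "e \<subseteq> U" "card e = ar E0"
    using exists_superset_card[OF U(1), of "{x, x'}" "ar E0"] x by (auto simp: U_def)
  have fe: "finite e" using e(2) U(1) finite_subset by blast
  have x'_edge: "x' \<notin> e'" if "e' \<in> edges D' E" for E e'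
    using hypergraph_edge(1)[OF D'(1) that] x' by blast
  then have e_new: "e \<notin> edges D' E0" using e(1) by blast
  define D'' where "D'' = add_edge D' U E0 e"
  have hyp: "hypergraph ar D''"
    unfolding D''_def using D'(1) U e fe by (intro hypergraph_add_edge)
  have uni: "universe D'' = U" by (simp add: D''_def)
  have subs: "substruct D D''"
    unfolding D''_def using D' U e fe x x' sub by (intro substruct_add_edge) auto
  have pd: "predim D'' Y = predim D' Y - (if e \<subseteq> Y then \<alpha> E0 else 0)" if "finite Y" for Y
    unfolding D''_def by (rule predim_add_edge[OF D'(1) fe e_new that])
  have ed: "edges D'' E = (if E = E0 then insert e (edges D' E0) else edges D' E)" for E
    unfolding D''_def by (rule edges_add_edge[OF D'(1) fe])
  have gap: "v + 1 / c \<le> \<alpha> E0"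
  proof (rule grid_gap)
    have "v = predim D' (universe D') - predim D (universe D)" using S3 by simp
    then show "v * c \<in> \<int>" by (simp only: left_diff_distrib Ints_diff predim_grid)
  qed (use v \<alpha>_grid in auto)
  have pd1: "predim D' (insert x' Y) = predim D' Y + 1" if "finite Y" "x' \<notin> Y" for Y
    using predim_insert_isolated[OF that] x'_edge by blast
  have "path_state E0 D D'' x' (v + 1 - \<alpha> E0) n m"
    unfolding path_state_def
  proof (intro conjI allI impI)
    fix Z assume Z: "Z \<subseteq> universe D'' - universe D" "x' \<notin> Z"
    then have Z': "Z \<subseteq> universe D' - universe D" by (auto simp: uni U_def)
    then have "finite (universe D \<union> Z)" using D'(2) sub finite_subset by (metis Diff_subset Un_least subset_trans)
    moreover have "\<not> e \<subseteq> universe D \<union> Z" using e(1) Z(2) x' sub by auto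
    ultimately have *: "predim D'' (universe D \<union> Z) = predim D' (universe D \<union> Z)"
      by (simp add: pd)
    \<comment> \<open>The old end \<open>x\<close> is now an interior point, so sets containing it,
      including the whole old path, must also stay above \<open>D\<close>; here
      \<open>0 \<le> v\<close> is used.\<close>
    consider "x \<notin> Z" | "x \<in> Z" "Z = universe D' - universe D" | "Z \<subset> universe D' - universe D" "x \<in> Z"
      using Z' by blast
    then show "predim D (universe D) \<le> predim D'' (universe D \<union> Z)"
    proof cases
      case 1
      then show ?thesis using S1[OF Z'] * by simp
    next
      case 2
      then have "universe D \<union> Z = universe D'" using sub by blast
      then show ?thesis using S3 S4 * by simp
    next
      case 3
      have "1 / c > 0" using c_pos by simp
      then show ?thesis using S2[OF 3] S4 * by linarith
    qed
  next
    fix Z assume Z: "Z \<subset> universe D'' - universe D" "x' \<in> Z"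
    define W where "W = Z - {x'}"
    have W: "W \<subset> universe D' - universe D" "x' \<notin> W" "Z = insert x' W"
      using Z x' sub by (auto simp: uni U_def W_def)
    have fin: "finite (universe D \<union> W)" using D'(2) sub W(1) finite_subset
      by (metis Diff_subset Un_least psubset_imp_subset subset_trans)
    have eq: "universe D \<union> Z = insert x' (universe D \<union> W)" using W(3) by simp
    have "x' \<notin> universe D \<union> W" using W x' sub by auto
    then have pZ: "predim D'' (universe D \<union> Z) = predim D' (universe D \<union> W) + 1
        - (if e \<subseteq> universe D \<union> Z then \<alpha> E0 else 0)"
      using fin pd[of "universe D \<union> Z"] by (simp add: eq pd1)
    show "predim D (universe D) + (v + 1 - \<alpha> E0) + 1 / c \<le> predim D'' (universe D \<union> Z)"
    proof (cases "x \<in> W")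
      case True
      then show ?thesis using S2[OF W(1)] pZ \<alpha>_pos[of E0] by (auto split: if_splits)
    next
      case False
      then have "x \<notin> universe D \<union> Z" using x W x' by auto
      then have "\<not> e \<subseteq> universe D \<union> Z" using e(1) by blast
      moreover have "predim D (universe D) \<le> predim D' (universe D \<union> W)"
        using S1[of W] W(1) False by blast
      ultimately show ?thesis using pZ gap by simp
    qed
  next
    show "predim D'' (universe D'') = predim D (universe D) + (v + 1 - \<alpha> E0)"
      using pd[OF U(1)] pd1[OF D'(2) x'] e(2) S3 by (simp add: uni U_def)
    show "0 \<le> v + 1 - \<alpha> E0 \<or> n = 0" using S4 \<alpha>_less_1[of E0] by linarith
  next
    \<comment> \<open>The new end lies on the linking edge alone, so its degree budget is
      \<open>\<alpha> E0 + (v + 1 - \<alpha> E0) = v + 1\<close>, which is below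
      \<open>2\<close>.\<close>
    have "{e' \<in> edges D'' E. x' \<in> e'} = (if E = E0 then {e} else {})" for E
      using e(1) x'_edge by (auto simp: ed)
    then have "\<alpha> E * of_nat (card {e' \<in> edges D'' E. x' \<in> e'}) = (if E = E0 then \<alpha> E0 else 0)" for E
      by simp
    then have "(\<Sum>E\<in>UNIV. \<alpha> E * of_nat (card {e \<in> edges D'' E. x' \<in> e})) = \<alpha> E0" by simp
    then show "(\<Sum>E\<in>UNIV. \<alpha> E * of_nat (card {e \<in> edges D'' E. x' \<in> e})) + (v + 1 - \<alpha> E0) \<le> 2"
      using v \<alpha>_less_1[of E0] by simp
  next
    show "v + 1 - \<alpha> E0 + of_nat n * (1 - \<alpha> E0) + 1 / c = (\<Sum>E\<in>UNIV. of_nat (m E) * \<alpha> E)"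
      using S6 by (simp add: algebra_simps)
  next
    have "edges D' E \<subseteq> edges D'' E" for E by (auto simp: ed)
    moreover have "finite (universe D)" using D'(2) sub finite_subset by blast
    ultimately have "card {d \<in> universe D. \<forall>E. \<forall>e \<in> edges D'' E. d \<in> e \<longrightarrow> e \<subseteq> universe D}
        \<le> card {d \<in> universe D. \<forall>E. \<forall>e \<in> edges D' E. d \<in> e \<longrightarrow> e \<subseteq> universe D}"
      by (intro card_mono) (simp, blast)
    then show "card {d \<in> universe D. \<forall>E. \<forall>e \<in> edges D'' E. d \<in> e \<longrightarrow> e \<subseteq> universe D} \<le> (\<Sum>E\<in>UNIV. m E)"
      using S7 by linarith
  qed (use hyp U subs x' sub in \<open>auto simp: uni U_def\<close>)
  moreover have "card (universe D'') = Suc (card (universe D'))"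
    using D'(2) x' by (simp add: uni U_def)
  ultimately show ?thesis by blast
qed

text \<open>An edge at \<open>x\<close> affects only sets containing \<open>x\<close>: their lower
  bound falls together with \<open>v\<close>. The edge passes through a point of \<open>D\<close>
  that still needs an edge leaving \<open>D\<close>, if there is one. Otherwise it only has to be
  new, and the invariant bounding the weighted degree of \<open>x\<close> plus \<open>v\<close>
  guarantees room; an added edge leaves that sum unchanged.\<close>

lemma path_state_add_edge:
  assumes S: "path_state E0 D D' x v n m" and m: "m E > 0" and v: "\<alpha> E \<le> v \<or> n = 0"
    and large: "3 < \<alpha> E * of_nat (card (universe D) - ar E)"
  shows "\<exists>D''. path_state E0 D D'' x (v - \<alpha> E) n (m(E := m E - 1)) \<and>
    universe D'' = universe D'"
proof -
  note D' = path_stateD(1-3)[OF S] and x = path_stateD(4)[OF S] and S1 = path_stateD(5)[OF S]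
    and S2 = path_stateD(6)[OF S] and S3 = path_stateD(7)[OF S] and S6 = path_stateD(10)[OF S]
    and S7 = path_stateD(11)[OF S] and S4 = path_stateD(8)[OF S] and S5 = path_stateD(9)[OF S]
  \<comment> \<open>The points of \<open>D\<close> on no edge that leaves \<open>D\<close>. Every
    point must finally lie on such an edge, and the number of edges still to be placed is kept at
    least the number of these points.\<close>
  define un where "un F = {d \<in> universe D. \<forall>E. \<forall>e \<in> edges F E. d \<in> e \<longrightarrow> e \<subseteq> universe D}"
    for F :: "('e, nat) struct"
  have sub: "universe D \<subseteq> universe D'" using D'(3) by (simp add: substruct_iff)
  have fD: "finite (universe D)" using sub D'(2) finite_subset by blast
  have arD: "ar E < card (universe D)"
  proof (rule ccontr)
    assume "\<not> ?thesis"
    then have "card (universe D) - ar E = 0" by simp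
    with large show False by simp
  qed
  have at_x: "finite {e \<in> edges D' E. x \<in> e}" for E
  proof (rule finite_subset)
    show "{e \<in> edges D' E. x \<in> e} \<subseteq> Pow (universe D')"
      using hypergraph_edge(1)[OF D'(1), of _ E] by blast
  qed (use D'(2) in simp)
  have "\<exists>e. x \<in> e \<and> e \<subseteq> universe D' \<and> card e = ar E \<and> e \<notin> edges D' E \<and> (un D' = {} \<or> e \<inter> un D' \<noteq> {})"
  proof (cases "un D' = {}")
    case False
    then obtain d where d: "d \<in> un D'" by blast
    have "ar E \<le> card (universe D')" using arD card_mono[OF D'(2) sub] by linarith
    moreover have "card {x, d} \<le> ar E" using ar_ge_2[of E] by (simp add: card_insert_if)
    ultimately obtain e where e: "{x, d} \<subseteq> e" "e \<subseteq> universe D'" "card e = ar E"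
      using exists_superset_card[OF D'(2), of "{x, d}" "ar E"] x d sub by (auto simp: un_def)
    then have "e \<notin> edges D' E" using d x by (auto simp: un_def)
    then show ?thesis using e d by auto
  next
    case True
    \<comment> \<open>No point is left to cover. With \<open>S\<close> fixed, the candidates
      \<open>{x, y} \<union> S\<close> differ in \<open>y\<close> alone and number more than
      \<open>card (universe D) - ar E\<close>; were all of them edges, the degree budget of
      \<open>x\<close> would force \<open>v < -1\<close>.\<close>
    obtain S where S: "S \<subseteq> universe D" "card S = ar E - 2" "finite S"
      using obtain_subset_with_card_n[of "ar E - 2" "universe D"] arD by (metis diff_le_self le_trans less_imp_le)
    let ?f = "\<lambda>y. insert x (insert y S)"
    have "\<exists>y \<in> universe D - S. ?f y \<notin> edges D' E"
    proof (rule ccontr)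
      assume "\<not> ?thesis"
      then have "?f ` (universe D - S) \<subseteq> {e \<in> edges D' E. x \<in> e}" by auto
      moreover have "inj_on ?f (universe D - S)" using x by (auto simp: inj_on_def)
      ultimately have "card (universe D - S) \<le> card {e \<in> edges D' E. x \<in> e}"
        using at_x[of E] by (intro card_inj_on_le)
      then have "card (universe D) - ar E \<le> card {e \<in> edges D' E. x \<in> e}"
        using S by (simp add: card_Diff_subset)
      then have "of_nat (card (universe D) - ar E) \<le> (of_nat (card {e \<in> edges D' E. x \<in> e}) :: rat)"
        by (rule of_nat_mono)
      then have "3 < \<alpha> E * of_nat (card {e \<in> edges D' E. x \<in> e})"
        using large \<alpha>_pos[of E] by (meson less_le_trans mult_left_mono less_imp_le)
      also have "\<dots> \<le> (\<Sum>E\<in>UNIV. \<alpha> E * of_nat (card {e \<in> edges D' E. x \<in> e}))"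
        using \<alpha>_pos by (intro member_le_sum) (auto simp: less_imp_le)
      finally have "v < -1" using S5 by simp
      \<comment> \<open>With no point left to add, \<open>v\<close> may be negative, but the balance
        equation still gives \<open>v + 1/c \<ge> 0\<close>.\<close>
      moreover have "v \<ge> -1"
      proof (cases "n = 0")
        case True
        have "0 \<le> (\<Sum>E\<in>UNIV. of_nat (m E) * \<alpha> E)" using \<alpha>_pos by (simp add: sum_nonneg less_imp_le)
        moreover have "1 / c \<le> 1" using c_ge_1 by simp
        ultimately show ?thesis using S6 True by simp
      qed (use S4 in simp)
      ultimately show False by simp
    qed
    then obtain y where y: "y \<in> universe D - S" "?f y \<notin> edges D' E" by blast
    have "card (?f y) = ar E" using S x y ar_ge_2[of E] by (auto simp: card_insert_if)
    then show ?thesis using y S x sub True by (intro exI[of _ "?f y"]) auto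
  qed
  then obtain e where e: "x \<in> e" "e \<subseteq> universe D'" "card e = ar E" "e \<notin> edges D' E"
    and e_un: "un D' = {} \<or> e \<inter> un D' \<noteq> {}" by blast
  have fe: "finite e" using e(2) D'(2) finite_subset by blast
  define D'' where "D'' = add_edge D' (universe D') E e"
  have hyp: "hypergraph ar D''"
    unfolding D''_def using D'(1) e fe by (intro hypergraph_add_edge) auto
  have uni: "universe D'' = universe D'" by (simp add: D''_def)
  have subs: "substruct D D''"
    unfolding D''_def using D' e fe x by (intro substruct_add_edge) auto
  have pd: "predim D'' Y = predim D' Y - (if e \<subseteq> Y then \<alpha> E else 0)" if "finite Y" for Y
    unfolding D''_def by (rule predim_add_edge[OF D'(1) fe e(4) that])
  have ed: "edges D'' E' = (if E' = E then insert e (edges D' E) else edges D' E')" for E'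
    unfolding D''_def by (rule edges_add_edge[OF D'(1) fe])
  have fin: "finite (universe D \<union> Z)" if "Z \<subseteq> universe D' - universe D" for Z
    using that D'(2) sub finite_subset by (metis Diff_subset Un_least subset_trans)
  have sum_m: "of_nat (m E') * \<alpha> E' = of_nat ((m(E := m E - 1)) E') * \<alpha> E' + (if E' = E then \<alpha> E else 0)" for E'
    using m by (simp add: of_nat_diff algebra_simps Suc_le_eq)
  have "m E' = (m(E := m E - 1)) E' + (if E' = E then 1 else 0)" for E' using m by simp
  then have "(\<Sum>E'\<in>UNIV. m E') = (\<Sum>E'\<in>UNIV. (m(E := m E - 1)) E' + (if E' = E then 1 else 0))"
    by (intro sum.cong) auto
  then have m_Suc: "(\<Sum>E'\<in>UNIV. m E') = Suc (\<Sum>E'\<in>UNIV. (m(E := m E - 1)) E')"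
    by (simp only: sum.distrib) simp
  have "path_state E0 D D'' x (v - \<alpha> E) n (m(E := m E - 1))"
    unfolding path_state_def
  proof (intro conjI allI impI)
    fix Z assume Z: "Z \<subseteq> universe D'' - universe D" "x \<notin> Z"
    then have "\<not> e \<subseteq> universe D \<union> Z" using e(1) x by auto
    then show "predim D (universe D) \<le> predim D'' (universe D \<union> Z)"
      using S1[of Z] Z pd[OF fin] by (simp add: uni)
  next
    fix Z assume Z: "Z \<subset> universe D'' - universe D" "x \<in> Z"
    then have "predim D (universe D) + v + 1 / c \<le> predim D' (universe D \<union> Z)"
      using S2[of Z] by (simp add: uni)
    moreover have "predim D'' (universe D \<union> Z) \<ge> predim D' (universe D \<union> Z) - \<alpha> E"
      using pd[OF fin, of Z] Z \<alpha>_pos[of E] by (auto simp: uni)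
    ultimately show "predim D (universe D) + (v - \<alpha> E) + 1 / c \<le> predim D'' (universe D \<union> Z)"
      by linarith
  next
    show "predim D'' (universe D'') = predim D (universe D) + (v - \<alpha> E)"
      using pd[OF D'(2)] e(2) S3 by (simp add: uni)
    show "0 \<le> v - \<alpha> E \<or> n = 0" using v by auto
  next
    have "{e' \<in> edges D'' E'. x \<in> e'} =
        (if E' = E then insert e {e' \<in> edges D' E. x \<in> e'} else {e' \<in> edges D' E'. x \<in> e'})" for E'
      using e(1) by (auto simp: ed)
    then have "\<alpha> E' * of_nat (card {e' \<in> edges D'' E'. x \<in> e'}) =
        \<alpha> E' * of_nat (card {e' \<in> edges D' E'. x \<in> e'}) + (if E' = E then \<alpha> E else 0)" for E'
      using at_x[of E] e(4) by (simp add: algebra_simps)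
    then show "(\<Sum>E\<in>UNIV. \<alpha> E * of_nat (card {e \<in> edges D'' E. x \<in> e})) + (v - \<alpha> E) \<le> 2"
      using S5 by (simp add: sum.distrib)
  next
    have "(\<Sum>E'\<in>UNIV. of_nat (m E') * \<alpha> E') =
        (\<Sum>E'\<in>UNIV. of_nat ((m(E := m E - 1)) E') * \<alpha> E' + (if E' = E then \<alpha> E else 0))"
      using sum_m by (rule sum.cong[OF refl])
    then have "(\<Sum>E'\<in>UNIV. of_nat (m E') * \<alpha> E') =
        (\<Sum>E'\<in>UNIV. of_nat ((m(E := m E - 1)) E') * \<alpha> E') + \<alpha> E"
      by (simp only: sum.distrib) simp
    then show "v - \<alpha> E + of_nat n * (1 - \<alpha> E0) + 1 / c =
        (\<Sum>E'\<in>UNIV. of_nat ((m(E := m E - 1)) E') * \<alpha> E')"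
      using S6 by simp
  next
    have "un D'' \<subseteq> un D' - e" using x e(1) by (auto simp: un_def ed)
    moreover have "finite (un D')" using fD by (simp add: un_def)
    ultimately have "card (un D'') \<le> card (un D' - e)" by (meson card_mono finite_Diff)
    moreover have "card (un D' - e) < card (un D') \<or> un D' = {}"
      using e_un \<open>finite (un D')\<close> by (metis Diff_subset Int_Diff Int_commute psubsetI psubset_card_mono
          Diff_disjoint Diff_triv inf_commute)
    ultimately have "card (un D'') \<le> (\<Sum>E'\<in>UNIV. (m(E := m E - 1)) E')"
      using S7 m_Suc unfolding un_def[of D', symmetric] by auto
    then show "card {d \<in> universe D. \<forall>E. \<forall>e \<in> edges D'' E. d \<in> e \<longrightarrow> e \<subseteq> universe D}
        \<le> (\<Sum>E'\<in>UNIV. (m(E := m E - 1)) E')"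
      by (simp add: un_def)
  qed (use hyp D' subs x in \<open>auto simp: uni\<close>)
  then show ?thesis using uni by blast
qed


text \<open>While \<open>v \<ge> \<alpha> E0\<close> any outstanding edge may be placed, since
  \<open>\<alpha> E0\<close> is the largest weight and \<open>v\<close> stays nonnegative; below
  that threshold a point is added. Once all points are there, the end point stays fixed and sets
  avoiding it are out of danger, so \<open>v\<close> may become negative. The balance equation then
  leaves \<open>v = -1/c\<close>.\<close>

lemma path_state_complete:
  assumes "path_state E0 D D' x v n m" and max: "\<And>E. \<alpha> E \<le> \<alpha> E0"
    and large: "\<And>E. 3 < \<alpha> E * of_nat (card (universe D) - ar E)"
  shows "\<exists>D''. hypergraph ar D'' \<and> finite (universe D'') \<and> substruct D D'' \<and>
    card (universe D'') = card (universe D') + n \<and>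
    predim D'' (universe D'') = predim D (universe D) - 1 / c \<and>
    (\<forall>Z. Z \<subset> universe D'' - universe D \<longrightarrow>
       predim D (universe D) \<le> predim D'' (universe D \<union> Z)) \<and>
    (\<forall>d \<in> universe D. \<exists>E. \<exists>e \<in> edges D'' E. d \<in> e \<and> \<not> e \<subseteq> universe D)"
  using assms(1)
proof (induction "n + (\<Sum>E\<in>UNIV. m E)" arbitrary: D' x v n m rule: less_induct)
  case less
  note S = less.prems
  note S1 = path_stateD(5)[OF S] and S2 = path_stateD(6)[OF S] and S4 = path_stateD(8)[OF S]
    and S6 = path_stateD(10)[OF S]
  show ?case
  proof (cases "\<exists>E. m E > 0")
    case False
    then have m: "m E = 0" for E by simp
    have eq: "v + of_nat n * (1 - \<alpha> E0) + 1 / c = 0" using S6 by (simp add: m)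
    \<comment> \<open>The edges cannot run out before the points: the balance equation would be a
      sum of nonnegative terms and \<open>1/c\<close> equal to \<open>0\<close>.\<close>
    have n: "n = 0"
    proof (rule ccontr)
      assume "n \<noteq> 0"
      then have "0 \<le> v" "0 \<le> of_nat n * (1 - \<alpha> E0)" using S4 \<alpha>_less_1[of E0] by simp_all
      moreover have "1 / c > 0" using c_pos by simp
      ultimately show False using eq by linarith
    qed
    then have v: "v = - (1 / c)" using eq by simp
    have 1: "predim D (universe D) \<le> predim D' (universe D \<union> Z)"
      if Z: "Z \<subset> universe D' - universe D" for Z
    proof (cases "x \<in> Z")
      case True
      then show ?thesis using S2[OF Z] v by simp
    next
      case False
      then show ?thesis using S1[OF psubset_imp_subset[OF Z]] by simp
    qed
    have fin: "finite (universe D')" "substruct D D'" using S by (auto simp: path_state_def)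
    let ?un = "{d \<in> universe D. \<forall>E. \<forall>e \<in> edges D' E. d \<in> e \<longrightarrow> e \<subseteq> universe D}"
    have "finite ?un" using fin by (auto simp: substruct_iff intro: finite_subset)
    moreover have "card ?un \<le> 0" using S unfolding path_state_def by (simp add: m)
    ultimately have "?un = {}" by simp
    then have 2: "\<forall>d \<in> universe D. \<exists>E. \<exists>e \<in> edges D' E. d \<in> e \<and> \<not> e \<subseteq> universe D"
      unfolding Collect_empty_eq by meson
    have "predim D' (universe D') = predim D (universe D) - 1 / c" "hypergraph ar D'"
      using S v unfolding path_state_def by simp_all
    then show ?thesis using 1 2 n fin by (intro exI[of _ D']) simp
  next
    case True
    then obtain E where E: "m E > 0" by blast
    show ?thesis
    proof (cases "n = 0 \<or> \<alpha> E0 \<le> v")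
      case True
      then have "\<alpha> E \<le> v \<or> n = 0" using max[of E] by auto
      then obtain D'' where D'': "path_state E0 D D'' x (v - \<alpha> E) n (m(E := m E - 1))"
        "universe D'' = universe D'"
        using path_state_add_edge[OF S E _ large[of E]] by blast
      have "(\<Sum>E'\<in>UNIV. (m(E := m E - 1)) E') < (\<Sum>E'\<in>UNIV. m E')"
        using E by (intro sum_strict_mono_ex1) auto
      then show ?thesis using less.hyps[OF _ D''(1)] D''(2) by simp
    next
      case False
      then obtain n' where n': "n = Suc n'" "v < \<alpha> E0" by (cases n) auto
      have "card (universe D) - ar E0 \<noteq> 0" using large[of E0] by (metis mult_zero_right not_numeral_less_zero of_nat_0)
      then have "ar E0 \<le> card (universe D)" by simp
      then obtain D'' x' where D'': "path_state E0 D D'' x' (v + 1 - \<alpha> E0) n' m"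
        "card (universe D'') = Suc (card (universe D'))"
        using path_state_add_point S n' by blast
      show ?thesis using less.hyps[OF _ D''(1)] D''(2) n'(1) by simp
    qed
  qed
qed

text \<open>The last clause compares \<open>Y\<close> with its trace on \<open>D\<close>, not with
  \<open>D\<close> itself. Hence a set strong in \<open>D\<close> can lose its strength only against
  the whole of \<open>D'\<close>.\<close>

definition minimal_extension :: "nat \<Rightarrow> ('e, 'a) struct \<Rightarrow> ('e, 'a) struct \<Rightarrow> bool" where
  "minimal_extension n D D' \<longleftrightarrow>
     hypergraph ar D' \<and> finite (universe D') \<and> substruct D D' \<and>
     card (universe D') = card (universe D) + n \<and>
     predim D' (universe D') = predim D (universe D) - 1 / c \<and>
     (\<forall>Y. Y \<subset> universe D' \<longrightarrow> predim D (Y \<inter> universe D) \<le> predim D' Y)"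

text \<open>The number \<open>n\<close> depends on \<open>N\<close> and \<open>k\<close> but not on
  \<open>D\<close>; this uniformity feeds all later size bounds. \<open>N0\<close> makes
  \<open>D\<close> large enough for the degree argument at the end of the path.\<close>

lemma minimal_extension_exists:
  "\<exists>N0. \<forall>N \<ge> N0. \<forall>k. \<exists>n > k. \<forall>D :: ('e, nat) struct.
     D \<in> K_L ar \<and> card (universe D) = N \<longrightarrow> (\<exists>D'. minimal_extension n D D')"
proof -
  have "Max (range \<alpha>) \<in> range \<alpha>" by (rule Max_in) auto
  then obtain E0 where E0: "Max (range \<alpha>) = \<alpha> E0" by blast
  have max: "\<alpha> E \<le> \<alpha> E0" for E unfolding E0[symmetric] by (rule Max_ge) auto
  have "\<exists>k. 3 < of_nat k * \<alpha> E" for E using ex_less_of_nat_mult[OF \<alpha>_pos] by blast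
  then obtain L where L: "\<And>E. 3 < of_nat (L E) * \<alpha> E" by metis
  define N0 where "N0 = (\<Sum>E\<in>UNIV. L E + ar E)"
  have large: "3 < \<alpha> E * of_nat (N - ar E)" if "N0 \<le> N" for N E
  proof -
    have "L E + ar E \<le> N0" unfolding N0_def by (rule member_le_sum) auto
    then have "L E \<le> N - ar E" using that by linarith
    then have "of_nat (L E) \<le> (of_nat (N - ar E) :: rat)" by (rule of_nat_mono)
    then have "of_nat (L E) * \<alpha> E \<le> of_nat (N - ar E) * \<alpha> E"
      using \<alpha>_pos[of E] by (intro mult_right_mono) auto
    then show ?thesis using L[of E] unfolding mult.commute[of "\<alpha> E"] by linarith
  qed
  have "\<exists>n > k. \<forall>D :: ('e, nat) struct.
     D \<in> K_L ar \<and> card (universe D) = N \<longrightarrow> (\<exists>D'. minimal_extension n D D')"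
    if N: "N0 \<le> N" for N k
  proof -
    \<comment> \<open>More than \<open>k\<close> new points keep the drop invisible to
      \<open>k\<close>-strength; at least \<open>N\<close> extra edges suffice to cover all points
      of \<open>D\<close>.\<close>
    obtain l m where lm: "max k N \<le> l" "max k N \<le> (\<Sum>E\<in>UNIV. m E)"
      "of_nat l * (1 - \<alpha> E0) + 1 + 1 / c = (\<Sum>E\<in>UNIV. of_nat (m E) * \<alpha> E)"
      using load_combination[of "max k N" E0] by blast
    have "\<exists>D'. minimal_extension (l + 1) D D'"
      if D: "hypergraph ar D" "finite (universe D)" "card (universe D) = N"
      for D :: "('e, nat) struct"
    proof -
      let ?D = "universe D"
      obtain x where x: "x \<notin> ?D" using ex_new_if_finite[OF infinite_UNIV_nat D(2)] by blast
      \<comment> \<open>The path starts with one isolated point, hence with \<open>v = 1\<close>;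
        this is the summand \<open>1\<close> in \<open>load_combination\<close>.\<close>
      define D1 where "D1 = of_edges (insert x ?D) (edges D)"
      have ed1: "edges D1 E = edges D E" for E
        unfolding D1_def using hypergraph_edge(2)[OF D(1)] by (intro edges_of_edges)
      have hyp1: "hypergraph ar D1"
        unfolding D1_def using hypergraph_edge[OF D(1)] by (intro hypergraph_of_edges) blast
      have uni1: "universe D1 = insert x ?D" by (simp add: D1_def)
      have diff: "universe D1 - ?D = {x}" using x by (auto simp: uni1)
      have sub1: "substruct D D1"
        using hypergraph_edge(1)[OF D(1)]
        by (intro hypergraph_substructI[OF D(1) hyp1]) (auto simp: uni1 ed1 edges_in_def)
      have x_edge: "x \<notin> e" if "e \<in> edges D E" for E e
        using hypergraph_edge(1)[OF D(1) that] x by blast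
      have pd1: "predim D1 ?D = predim D ?D" using predim_substruct[OF sub1] by simp
      have "predim D1 (universe D1) = predim D1 ?D + 1"
        unfolding uni1 using D(2) x x_edge by (intro predim_insert_isolated) (auto simp: ed1)
      then have "path_state E0 D D1 x 1 l m"
        unfolding path_state_def
      proof (intro conjI allI impI)
        fix Z assume "Z \<subseteq> universe D1 - ?D" "x \<notin> Z"
        then have "Z = {}" using diff by auto
        then show "predim D ?D \<le> predim D1 (?D \<union> Z)" using pd1 by simp
      next
        fix Z assume "Z \<subset> universe D1 - ?D" "x \<in> Z"
        then show "predim D ?D + 1 + 1 / c \<le> predim D1 (?D \<union> Z)" using diff by auto
      next
        have "{e \<in> edges D1 E. x \<in> e} = {}" for E using x_edge by (auto simp: ed1)
        then have "(\<Sum>E\<in>UNIV. \<alpha> E * of_nat (card {e \<in> edges D1 E. x \<in> e})) = 0"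
          by (simp only: card.empty) simp
        then show "(\<Sum>E\<in>UNIV. \<alpha> E * of_nat (card {e \<in> edges D1 E. x \<in> e})) + 1 \<le> 2" by simp
      next
        have "card {d \<in> ?D. \<forall>E. \<forall>e \<in> edges D1 E. d \<in> e \<longrightarrow> e \<subseteq> ?D} \<le> card ?D"
          using D(2) by (intro card_mono) auto
        then show "card {d \<in> ?D. \<forall>E. \<forall>e \<in> edges D1 E. d \<in> e \<longrightarrow> e \<subseteq> ?D} \<le> (\<Sum>E\<in>UNIV. m E)"
          using D(3) lm(2) by simp
      qed (use hyp1 D sub1 x lm(3) pd1 in \<open>simp_all add: uni1 algebra_simps\<close>)
      then obtain D' where D': "hypergraph ar D'" "finite (universe D')" "substruct D D'"
        "card (universe D') = card (universe D1) + l"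
        "predim D' (universe D') = predim D ?D - 1 / c"
        and Z: "\<And>Z. Z \<subset> universe D' - ?D \<Longrightarrow> predim D ?D \<le> predim D' (?D \<union> Z)"
        and cover: "\<And>d. d \<in> ?D \<Longrightarrow> \<exists>E. \<exists>e \<in> edges D' E. d \<in> e \<and> \<not> e \<subseteq> ?D"
        using path_state_complete[OF _ max] large[OF N] D(3) by metis
      have sub: "?D \<subseteq> universe D'" using D'(3) by (simp add: substruct_iff)
      have pdD: "predim D' ?D = predim D ?D" using predim_substruct[OF D'(3)] by simp
      have "predim D (Y \<inter> ?D) \<le> predim D' Y" if Y: "Y \<subset> universe D'" for Y
      proof -
        have fY: "finite Y" using Y D'(2) finite_subset by blast
        have pdY: "predim D (Y \<inter> ?D) = predim D' (Y \<inter> ?D)"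
          using predim_substruct[OF D'(3)] by simp
        show ?thesis
        proof (cases "universe D' - ?D \<subseteq> Y")
          case False
          then have "Y - ?D \<subset> universe D' - ?D" using Y by blast
          then have "predim D ?D \<le> predim D' (?D \<union> (Y - ?D))" by (rule Z)
          moreover have "?D \<union> (Y - ?D) = Y \<union> ?D" by blast
          ultimately show ?thesis
            using predim_submodular[OF fY D(2), of D'] pdD pdY by simp
        next
          case True
          \<comment> \<open>\<open>Y\<close> contains the whole path but misses a point
            \<open>d\<close> of \<open>D\<close>. Some edge at \<open>d\<close> leaves
            \<open>D\<close>, so it lies neither in \<open>Y\<close> nor in \<open>D\<close>.
            Submodularity in \<open>D'\<close> without this edge gains its weight, at least
            \<open>1/c\<close>, which pays for the drop.\<close>
          then obtain d where d: "d \<in> ?D" "d \<notin> Y" using Y sub by blast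
          then obtain E e where e: "e \<in> edges D' E" "d \<in> e" "\<not> e \<subseteq> ?D" using cover[OF d(1)] by blast
          define F where "F = of_edges (universe D') ((edges D')(E := edges D' E - {e}))"
          have edF: "edges F E' = (if E' = E then edges D' E - {e} else edges D' E')" for E'
            unfolding F_def using hypergraph_edge(2)[OF D'(1)]
            by (subst edges_of_edges) (auto split: if_splits)
          have hypF: "hypergraph ar F"
            unfolding F_def
          proof (rule hypergraph_of_edges)
            fix E' e' assume "e' \<in> ((edges D')(E := edges D' E - {e})) E'"
            then have "e' \<in> edges D' E'" by (simp split: if_splits)
            then show "e' \<subseteq> universe D' \<and> finite e' \<and> card e' = ar E'"
              using hypergraph_edge[OF D'(1)] by blast
          qed
          have fe: "finite e" using hypergraph_edge(2)[OF D'(1) e(1)] .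
          have "e \<notin> edges F E" by (simp add: edF)
          note pF = predim_add_edge[OF hypF fe this, where U = "universe D'"]
          have "add_edge F (universe D') E e = D'"
          proof (rule hypergraph_eqI[OF _ D'(1)])
            show "hypergraph ar (add_edge F (universe D') E e)"
              using hypF hypergraph_edge[OF D'(1) e(1)]
              by (intro hypergraph_add_edge) (auto simp: F_def)
          qed (use e in \<open>auto simp: edges_add_edge[OF hypF fe] edF\<close>)
          then have p: "predim D' T = predim F T - (if e \<subseteq> T then \<alpha> E else 0)"
            if "finite T" for T using pF[OF that] by simp
          have "Y \<union> ?D = universe D'" using True Y sub by blast
          then have "predim F (Y \<union> ?D) = predim D' (universe D') + \<alpha> E"
            using p[OF D'(2)] hypergraph_edge(1)[OF D'(1) e(1)] by simp
          moreover have "predim F Y = predim D' Y" using p[OF fY] e d by auto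
          moreover have "predim F ?D = predim D' ?D" using p[OF D(2)] e by simp
          moreover have "predim F (Y \<inter> ?D) = predim D' (Y \<inter> ?D)"
            using p[of "Y \<inter> ?D"] e fY by auto
          ultimately show ?thesis
            using predim_submodular[OF fY D(2), of F] pdD pdY D'(5) \<alpha>_ge[of E] by linarith
        qed
      qed
      then show ?thesis using D' D(2,3) x by (intro exI[of _ D']) (simp add: uni1 minimal_extension_def)
    qed
    then show ?thesis using lm(1) by (intro exI[of _ "l + 1"]) (auto simp: K_L_iff)
  qed
  then show ?thesis by blast
qed

section \<open>Iterated minimal extensions\<close>

definition reduction :: "nat \<Rightarrow> nat \<Rightarrow> ('e, 'a) struct \<Rightarrow> ('e, 'a) struct \<Rightarrow> bool" where
  "reduction k j D D' \<longleftrightarrow>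
     hypergraph ar D' \<and> finite (universe D') \<and> substruct D D' \<and>
     predim D' (universe D') = predim D (universe D) - of_nat j / c \<and>
     (\<forall>Z. strong_in D Z \<and> predim D Z \<le> predim D (universe D) - of_nat j / c \<longrightarrow>
        strong_in D' Z) \<and>
     (\<forall>Z. strong_in D Z \<longrightarrow> k_strong k D' Z)"

text \<open>Iterate \<open>minimal_extension_exists\<close>. At each stage only the whole structure
  can fall below a strong set \<open>Z\<close> of \<open>D\<close>; this requires the level to have
  dropped below that of \<open>Z\<close>, and it happens only after adding more than
  \<open>k\<close> points. One bound serves all \<open>j \<le> J\<close>, because the excess of an
  amalgam depends on the structures amalgamated.\<close>

lemma reduction_exists:
  "\<exists>N0. \<forall>N \<ge> N0. \<forall>k J. \<exists>b. \<forall>j \<le> J. \<forall>D :: ('e, nat) struct.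
     D \<in> K_L ar \<and> card (universe D) = N \<longrightarrow>
     (\<exists>D'. reduction k j D D' \<and> card (universe D') \<le> b)"
proof -
  obtain N0 where N0: "\<forall>N \<ge> N0. \<forall>k. \<exists>n > k. \<forall>D :: ('e, nat) struct.
     D \<in> K_L ar \<and> card (universe D) = N \<longrightarrow> (\<exists>D'. minimal_extension n D D')"
    using minimal_extension_exists by (rule exE)
  have ex: "\<exists>N' \<ge> N. \<forall>D :: ('e, nat) struct.
     D \<in> K_L ar \<and> card (universe D) = N \<longrightarrow>
     (\<exists>D'. reduction k j D D' \<and> card (universe D') = N')" if N: "N0 \<le> N" for N j k
  proof (induction j)
    case 0
    have "reduction k 0 D D" if "D \<in> K_L ar" for D :: "('e, nat) struct"
      using that by (auto simp: reduction_def K_L_iff strong_in_k_strong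
          intro: substruct_refl[OF hypergraph_is_struct])
    then show ?case by blast
  next
    case (Suc j)
    then obtain N' where N': "N' \<ge> N" and IH: "\<forall>D :: ('e, nat) struct.
        D \<in> K_L ar \<and> card (universe D) = N \<longrightarrow>
        (\<exists>D'. reduction k j D D' \<and> card (universe D') = N')"
      by (elim exE conjE)
    obtain n where n: "n > k" and step: "\<forall>D :: ('e, nat) struct.
        D \<in> K_L ar \<and> card (universe D) = N' \<longrightarrow> (\<exists>D'. minimal_extension n D D')"
      using N0[THEN spec, THEN mp, OF order_trans[OF N N'], THEN spec, of k] by (elim exE conjE)
    have "\<exists>D'. reduction k (Suc j) D D' \<and> card (universe D') = N' + n"
      if D: "D \<in> K_L ar" "card (universe D) = N"
      for D :: "('e, nat) struct"
    proof -
      obtain D1 where D1: "reduction k j D D1" "card (universe D1) = N'" using IH D by blast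
      then have D1': "hypergraph ar D1" "finite (universe D1)" "substruct D D1"
        "predim D1 (universe D1) = predim D (universe D) - of_nat j / c"
        and str1: "\<And>Z. strong_in D Z \<Longrightarrow>
            predim D Z \<le> predim D (universe D) - of_nat j / c \<Longrightarrow> strong_in D1 Z"
        and kstr1: "\<And>Z. strong_in D Z \<Longrightarrow> k_strong k D1 Z"
        by (simp_all add: reduction_def)
      obtain D2 where D2: "hypergraph ar D2" "finite (universe D2)" "substruct D1 D2"
        "card (universe D2) = N' + n"
        "predim D2 (universe D2) = predim D1 (universe D1) - 1 / c"
        and Y: "\<And>Y. Y \<subset> universe D2 \<Longrightarrow> predim D1 (Y \<inter> universe D1) \<le> predim D2 Y"
        using step D1'(1,2) D1(2) unfolding K_L_iff minimal_extension_def by metis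
      have sub: "substruct D D2" using substruct_trans[OF D1'(3) D2(3)] .
      have subD: "universe D \<subseteq> universe D1" "universe D1 \<subseteq> universe D2"
        using D1'(3) D2(3) by (simp_all add: substruct_iff)
      have p2: "predim D2 Z = predim D Z" if "Z \<subseteq> universe D" for Z
        using predim_substruct[OF sub that] by simp
      have p1: "predim D1 Z = predim D Z" if "Z \<subseteq> universe D" for Z
        using predim_substruct[OF D1'(3) that] by simp
      have top: "predim D2 (universe D2) = predim D (universe D) - of_nat (Suc j) / c"
        using D2(5) D1'(4) by (simp add: add_divide_distrib)
      have le: "of_nat j / c \<le> of_nat (Suc j) / c"
        using c_pos by (intro divide_right_mono) auto
      have "strong_in D2 Z"
        if Z: "strong_in D Z" "predim D Z \<le> predim D (universe D) - of_nat (Suc j) / c" for Z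
      proof -
        have Zs: "finite Z" "Z \<subseteq> universe D" using Z(1) by (simp_all add: strong_in_def)
        have Z1: "strong_in D1 Z" using str1[OF Z(1)] Z(2) le by linarith
        have "predim D2 Z \<le> predim D2 T"
          if T: "finite T" "Z \<subseteq> T" "T \<subseteq> universe D2" for T
        proof (cases "T = universe D2")
          case True
          then show ?thesis using top Z(2) p2[OF Zs(2)] by simp
        next
          case False
          then have "predim D1 (T \<inter> universe D1) \<le> predim D2 T" using Y T by blast
          moreover have "predim D1 Z \<le> predim D1 (T \<inter> universe D1)"
            using strong_in_le[OF Z1] T Zs subD by auto
          ultimately show ?thesis using p1[OF Zs(2)] p2[OF Zs(2)] by simp
        qed
        then show ?thesis using Zs subD by (auto simp: strong_in_def)
      qed
      moreover have "k_strong k D2 Z" if Z: "strong_in D Z" for Z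
      proof -
        have Zs: "finite Z" "Z \<subseteq> universe D" using Z by (simp_all add: strong_in_def)
        have Z1: "k_strong k D1 Z" using kstr1[OF Z] .
        have "predim D2 Z \<le> predim D2 T"
          if T: "finite T" "Z \<subseteq> T" "T \<subseteq> universe D2" "card (T - Z) \<le> k" for T
        proof -
          \<comment> \<open>The last step alone adds \<open>n > k\<close> points, so
            \<open>T\<close> is too small to be everything.\<close>
          have "T \<noteq> universe D2"
          proof
            assume "T = universe D2"
            then have "card (universe D2 - universe D1) \<le> card (T - Z)"
              using T(1) Zs subD by (intro card_mono) auto
            moreover have "card (universe D2 - universe D1) = n"
              using D2(4) D1(2) D1'(2) subD by (simp add: card_Diff_subset)
            ultimately show False using T(4) n by simp
          qed
          then have "predim D1 (T \<inter> universe D1) \<le> predim D2 T" using Y T by blast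
          moreover have "card (T \<inter> universe D1 - Z) \<le> card (T - Z)"
            using T(1) by (intro card_mono) auto
          then have "predim D1 Z \<le> predim D1 (T \<inter> universe D1)"
            using k_strong_le[OF Z1] T Zs subD by auto
          ultimately show ?thesis using p1[OF Zs(2)] p2[OF Zs(2)] by simp
        qed
        then show ?thesis using Zs subD by (auto simp: k_strong_def)
      qed
      ultimately have "reduction k (Suc j) D D2" using D2 sub top by (simp add: reduction_def)
      then show ?thesis using D2(4) by blast
    qed
    then show ?case using N' by (intro exI[of _ "N' + n"]) auto
  qed
  have "\<exists>b. \<forall>j \<le> J. \<forall>D :: ('e, nat) struct. D \<in> K_L ar \<and> card (universe D) = N \<longrightarrow>
     (\<exists>D'. reduction k j D D' \<and> card (universe D') \<le> b)" if N: "N0 \<le> N" for N k J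
  proof -
    have "\<forall>j. \<exists>N'. \<forall>D :: ('e, nat) struct. D \<in> K_L ar \<and> card (universe D) = N \<longrightarrow>
        (\<exists>D'. reduction k j D D' \<and> card (universe D') = N')"
      using ex[OF N] by metis
    then obtain h where h: "\<forall>j. \<forall>D :: ('e, nat) struct. D \<in> K_L ar \<and> card (universe D) = N \<longrightarrow>
        (\<exists>D'. reduction k j D D' \<and> card (universe D') = h j)"
      by (rule choice[THEN exE])
    have "h j \<le> Max (h ` {..J})" if "j \<le> J" for j using that by (intro Max_ge) auto
    then show ?thesis using h by (intro exI[of _ "Max (h ` {..J})"]) metis
  qed
  then show ?thesis by blast
qed

end

section \<open>Amalgamation\<close>

lemma embeds_edge:
  assumes "embeds f A M" "e \<subseteq> universe A"
  shows "e \<in> edges A E \<longleftrightarrow> f ` e \<in> edges M E"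
proof -
  have b: "bij_betw ((`) f) (edges_in A e E) (edges_in M (f ` e) E)"
    using assms by (rule embeds_edges_in)
  have inj: "inj_on f (universe A)" using assms(1) by (simp add: embeds_def)
  show ?thesis
  proof
    assume "e \<in> edges A E"
    then have "e \<in> edges_in A e E" by (simp add: edges_in_def)
    then have "f ` e \<in> edges_in M (f ` e) E" using bij_betw_apply[OF b] by blast
    then show "f ` e \<in> edges M E" by (simp add: edges_in_def)
  next
    assume "f ` e \<in> edges M E"
    then have "f ` e \<in> edges_in M (f ` e) E" by (simp add: edges_in_def)
    then have "f ` e \<in> (`) f ` edges_in A e E" using bij_betw_imp_surj_on[OF b] by simp
    then obtain e' where e': "e' \<in> edges_in A e E" "f ` e = f ` e'" by (rule imageE)
    then have "e' \<subseteq> e" "e' \<in> edges A E" by (simp_all add: edges_in_def)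
    moreover from this(1) have "e' \<subseteq> universe A" using assms(2) by blast
    ultimately show "e \<in> edges A E"
      using e'(2) inj_on_image_eq_iff[OF inj assms(2), of e'] by simp
  qed
qed

lemma embeds_hypergraphI:
  assumes A: "hypergraph ar A" and M: "hypergraph ar M"
    and inj: "inj_on f (universe A)" and sub: "f ` universe A \<subseteq> universe M"
    and e: "\<And>E e. e \<subseteq> universe A \<Longrightarrow> e \<in> edges A E \<longleftrightarrow> f ` e \<in> edges M E"
  shows "embeds f A M"
proof -
  have "xs \<in> interp A E \<longleftrightarrow> map f xs \<in> interp M E" if xs: "set xs \<subseteq> universe A" for xs E
  proof -
    have "distinct (map f xs) \<longleftrightarrow> distinct xs"
      using inj_on_subset[OF inj xs] by (simp add: distinct_map)
    then show ?thesis
      using e[OF xs] by (simp add: hypergraph_interp[OF A] hypergraph_interp[OF M])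
  qed
  then show ?thesis using inj sub by (simp add: embeds_def)
qed

context rational_weights
begin

text \<open>No edge is split between \<open>P\<close> and \<open>Q\<close>, so submodularity becomes
  an equality; points of \<open>Y\<close> outside both lie on no edge and count \<open>1\<close>
  each.\<close>

lemma predim_free:
  assumes free: "\<And>E e. e \<in> edges D E \<Longrightarrow> e \<subseteq> P \<or> e \<subseteq> Q" and Y: "finite Y"
  shows "predim D (Y \<inter> P) + predim D (Y \<inter> Q) + of_nat (card (Y - (P \<union> Q))) =
    predim D Y + predim D (Y \<inter> P \<inter> Q)"
proof -
  have "of_nat (card (edges_in D (Y \<inter> P) E)) + of_nat (card (edges_in D (Y \<inter> Q) E)) =
     (of_nat (card (edges_in D Y E)) + of_nat (card (edges_in D (Y \<inter> P \<inter> Q) E)) :: rat)" for E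
  proof -
    have "edges_in D Y E = edges_in D (Y \<inter> P) E \<union> edges_in D (Y \<inter> Q) E"
      using free by (auto simp: edges_in_def)
    moreover have "edges_in D (Y \<inter> P \<inter> Q) E = edges_in D (Y \<inter> P) E \<inter> edges_in D (Y \<inter> Q) E"
      by (auto simp: edges_in_def)
    ultimately show ?thesis
      using card_Un_Int[of "edges_in D (Y \<inter> P) E" "edges_in D (Y \<inter> Q) E"]
        finite_edges_in[of "Y \<inter> P" D E] finite_edges_in[of "Y \<inter> Q" D E] Y
      by (simp flip: of_nat_add)
  qed
  then have "(\<Sum>E\<in>UNIV. \<alpha> E * of_nat (card (edges_in D (Y \<inter> P) E))) +
      (\<Sum>E\<in>UNIV. \<alpha> E * of_nat (card (edges_in D (Y \<inter> Q) E))) =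
      (\<Sum>E\<in>UNIV. \<alpha> E * of_nat (card (edges_in D Y E))) +
      (\<Sum>E\<in>UNIV. \<alpha> E * of_nat (card (edges_in D (Y \<inter> P \<inter> Q) E)))"
    by (simp only: sum.distrib[symmetric] distrib_left[symmetric])
  moreover have "of_nat (card (Y \<inter> P)) + of_nat (card (Y \<inter> Q)) + of_nat (card (Y - (P \<union> Q))) =
      (of_nat (card Y) + of_nat (card (Y \<inter> P \<inter> Q)) :: rat)"
  proof -
    have "(Y \<inter> P) \<inter> (Y \<inter> Q) = Y \<inter> P \<inter> Q" by blast
    then have "card (Y \<inter> P) + card (Y \<inter> Q) = card ((Y \<inter> P) \<union> (Y \<inter> Q)) + card (Y \<inter> P \<inter> Q)"
      using card_Un_Int[of "Y \<inter> P" "Y \<inter> Q"] Y by simp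
    moreover have "card Y = card ((Y \<inter> P) \<union> (Y \<inter> Q)) + card (Y - (P \<union> Q))"
      using Y by (subst card_Un_disjoint[symmetric]) (auto intro: arg_cong[of _ _ card])
    ultimately show ?thesis unfolding of_nat_add[symmetric] of_nat_eq_iff by linarith
  qed
  ultimately show ?thesis by (simp add: predim_def)
qed

text \<open>Submodularity for \<open>Y\<close> and \<open>C\<close>: the trace on \<open>C\<close>
  is nonnegative since \<open>C\<close> lies in the class, and the union is not below
  \<open>C\<close> by strength.\<close>

lemma K_\<alpha>_strong_extension:
  assumes "C \<in> K_\<alpha> ar \<alpha>" "hypergraph ar D" "finite (universe D)" "substruct C D"
    "strong_in D (universe C)"
  shows "D \<in> K_\<alpha> ar \<alpha>"
proof -
  have "0 \<le> predim D Y" if Y: "Y \<subseteq> universe D" for Y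
  proof -
    have fin: "finite Y" "finite (universe C)"
      using Y assms finite_subset by (auto simp: strong_in_def)
    have sub: "universe C \<subseteq> universe D" using assms(4) by (simp add: substruct_iff)
    have "predim D (universe C) \<le> predim D (Y \<union> universe C)"
      using strong_in_le[OF assms(5)] Y fin sub by auto
    moreover have "0 \<le> predim C (Y \<inter> universe C)"
      using assms(1) Int_lower2 unfolding K_\<alpha>_iff by blast
    then have "0 \<le> predim D (Y \<inter> universe C)"
      using predim_substruct[OF assms(4), of "Y \<inter> universe C"] by simp
    ultimately show ?thesis using predim_submodular[OF fin, of D] by linarith
  qed
  then show ?thesis using assms by (simp add: K_\<alpha>_iff)
qed

text \<open>Strength of \<open>X\<close> in \<open>B\<close> makes \<open>C\<close> strong in the
  amalgam; symmetrically \<open>B\<close> is strong if the image of \<open>X\<close> is strong in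
  \<open>C\<close>. Isolated points pad the amalgam to exactly \<open>S\<close> points: reductions
  are uniform only for a given cardinality, and the same padding can raise the predimension at
  will.\<close>

lemma free_amalgam:
  fixes C :: "('e, nat) struct" and B :: "('e, 'b) struct"
  assumes C: "hypergraph ar C" "finite (universe C)"
    and B: "hypergraph ar B" "finite (universe B)"
    and X: "strong_in B X" and f: "embeds f (induced B X) C"
    and S: "card (universe C) + card (universe B) \<le> S"
  shows "\<exists>D g. hypergraph ar D \<and> finite (universe D) \<and> card (universe D) = S \<and>
    substruct C D \<and> strong_in D (universe C) \<and>
    embeds g B D \<and> (\<forall>x \<in> X. g x = f x) \<and>
    predim C (universe C) + of_nat (S - (card (universe C) + card (universe B)))
      \<le> predim D (universe D) \<and>
    (strong_in C (f ` X) \<longrightarrow> strong_in D (g ` universe B))"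
proof -
  let ?C = "universe C" and ?B = "universe B"
  have Xs: "finite X" "X \<subseteq> ?B" using X by (simp_all add: strong_in_def)
  have f_inj: "inj_on f X" and fC: "f ` X \<subseteq> ?C" using f by (simp_all add: embeds_def)
  have "infinite (UNIV - ?C)" using C(2) by (simp add: Diff_infinite_finite)
  then obtain T where T: "finite T" "card T = card (?B - X)" "T \<subseteq> UNIV - ?C"
    by (metis infinite_arbitrarily_large)
  obtain h where h: "bij_betw h (?B - X) T"
    using finite_same_card_bij[of "?B - X" T] T B(2) by auto
  define g where "g x = (if x \<in> X then f x else h x)" for x
  have gX: "g x = f x" if "x \<in> X" for x using that by (simp add: g_def)
  have gXi: "g ` X = f ` X" using gX by (rule image_cong[OF refl])
  have gnX: "g x \<in> T" if "x \<in> ?B - X" for x using that h by (auto simp: g_def bij_betw_def)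
  have g_inj: "inj_on g ?B"
  proof (rule inj_onI)
    fix x y assume xy: "x \<in> ?B" "y \<in> ?B" "g x = g y"
    have h_inj: "inj_on h (?B - X)" using h by (simp add: bij_betw_def)
    have in_C: "g z \<in> ?C" if "z \<in> X" for z using that fC gX by auto
    have notin_C: "g z \<notin> ?C" if "z \<in> ?B - X" for z using gnX[OF that] T by auto
    consider "x \<in> X" "y \<in> X" | "x \<in> ?B - X" "y \<in> ?B - X"
      using xy in_C notin_C by (metis DiffI)
    then show "x = y"
      using xy f_inj h_inj by cases (auto simp: g_def inj_on_def)
  qed
  have gB_C: "g ` ?B \<inter> ?C = f ` X"
    using gnX T gXi fC Xs by (auto simp: g_def)
  have fingB: "finite (g ` ?B)" using B(2) by simp
  have card_le: "card (?C \<union> g ` ?B) \<le> S"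
    using S card_Un_le[of ?C "g ` ?B"] card_image[OF g_inj] by linarith
  have "infinite (UNIV - (?C \<union> g ` ?B))" using C(2) fingB by (simp add: Diff_infinite_finite)
  then obtain P where P: "finite P" "card P = S - card (?C \<union> g ` ?B)" "P \<subseteq> UNIV - (?C \<union> g ` ?B)"
    by (metis infinite_arbitrarily_large)
  define U where "U = ?C \<union> g ` ?B \<union> P"
  have fU: "finite U" using C(2) fingB P(1) by (simp add: U_def)
  have cU: "card U = S"
    unfolding U_def using C(2) fingB P card_le by (subst card_Un_disjoint) auto
  define D where "D = of_edges U (\<lambda>E. edges C E \<union> (`) g ` edges B E)"
  have eg: "g ` e \<subseteq> g ` ?B" "finite (g ` e)" "card (g ` e) = ar E" if "e \<in> edges B E" for e E
  proof -
    note hypergraph_edge[OF B(1) that]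
    then show "g ` e \<subseteq> g ` ?B" "finite (g ` e)" "card (g ` e) = ar E"
      using g_inj by (auto simp: card_image inj_on_subset)
  qed
  have ed: "edges D E = edges C E \<union> (`) g ` edges B E" for E
    unfolding D_def using hypergraph_edge(2)[OF C(1)] eg(2) by (subst edges_of_edges) auto
  have uni: "universe D = U" by (simp add: D_def)
  have hyp: "hypergraph ar D"
    unfolding D_def
  proof (rule hypergraph_of_edges)
    fix E e assume "e \<in> edges C E \<union> (`) g ` edges B E"
    then show "e \<subseteq> U \<and> finite e \<and> card e = ar E"
    proof
      assume "e \<in> edges C E"
      then show ?thesis using hypergraph_edge[OF C(1)] by (auto simp: U_def)
    next
      assume "e \<in> (`) g ` edges B E"
      then obtain e' where "e' \<in> edges B E" "e = g ` e'" by blast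
      then show ?thesis using eg[of e' E] by (auto simp: U_def)
    qed
  qed
  have gC: "g ` e \<in> edges C E" if e: "e \<in> edges B E" "g ` e \<subseteq> ?C" for e E
  proof -
    have eB: "e \<subseteq> ?B" using hypergraph_edge(1)[OF B(1) e(1)] .
    have "g ` e \<subseteq> g ` X" using e(2) eB gB_C gXi by blast
    then have eX: "e \<subseteq> X" using eB Xs inj_on_image_mem_iff[OF g_inj _ Xs(2)] by blast
    then have "e \<in> edges (induced B X) E" using e(1) by (simp add: edges_induced edges_in_def)
    then have "f ` e \<in> edges C E" using embeds_edge[OF f] eX by simp
    moreover have "g ` e = f ` e" using eX gX by (intro image_cong) auto
    ultimately show ?thesis by simp
  qed
  have subC: "substruct C D"
    using hypergraph_edge(1)[OF C(1)] gC
    by (intro hypergraph_substructI[OF C(1) hyp]) (auto simp: uni U_def ed edges_in_def)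
  have gemb: "embeds g B D"
  proof (rule embeds_hypergraphI[OF B(1) hyp g_inj])
    show "g ` ?B \<subseteq> universe D" unfolding uni U_def by blast
    fix E e assume e: "e \<subseteq> ?B"
    show "e \<in> edges B E \<longleftrightarrow> g ` e \<in> edges D E"
    proof
      assume "g ` e \<in> edges D E"
      then consider "g ` e \<in> edges C E" | e' where "e' \<in> edges B E" "g ` e = g ` e'"
        by (auto simp: ed)
      then show "e \<in> edges B E"
      proof cases
        case 1
        then have "g ` e \<subseteq> g ` X"
          using hypergraph_edge(1)[OF C(1) 1] e gB_C gXi by blast
        then have eX: "e \<subseteq> X" using e Xs inj_on_image_mem_iff[OF g_inj _ Xs(2)] by blast
        then have "g ` e = f ` e" using gX by (intro image_cong) auto
        then have "e \<in> edges (induced B X) E" using embeds_edge[OF f] eX 1 by simp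
        then show ?thesis by (simp add: edges_induced edges_in_def)
      next
        case 2
        then show ?thesis
          using inj_on_image_eq_iff[OF g_inj e] hypergraph_edge(1)[OF B(1) 2(1)] by auto
      qed
    qed (auto simp: ed)
  qed
  have pC: "predim D Z = predim C Z" if "Z \<subseteq> ?C" for Z
    using predim_substruct[OF subC that] by simp
  have pB: "predim D (g ` Z) = predim B Z" if "Z \<subseteq> ?B" for Z
    using predim_embeds[OF gemb that] .
  have pf: "predim D (f ` X) = predim B X" using pB[OF Xs(2)] gXi by simp
  have free: "e \<subseteq> ?C \<or> e \<subseteq> g ` ?B" if e: "e \<in> edges D E" for e E
  proof -
    consider "e \<in> edges C E" | e' where "e' \<in> edges B E" "e = g ` e'"
      using e by (auto simp: ed)
    then show ?thesis using hypergraph_edge(1)[OF C(1)] eg(1) by cases blast+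
  qed
  have pfree: "predim D (Y \<inter> ?C) + predim D (Y \<inter> g ` ?B) +
      of_nat (card (Y - (?C \<union> g ` ?B))) = predim D Y + predim D (Y \<inter> ?C \<inter> g ` ?B)"
    if "finite Y" for Y
    by (rule predim_free[OF free that])
  have int: "Y \<inter> ?C \<inter> g ` ?B = Y \<inter> f ` X" for Y using gB_C by blast
  have subU: "?C \<subseteq> U" "g ` ?B \<subseteq> U" by (auto simp: U_def)
  have strB: "predim D (f ` X) \<le> predim D (Y \<inter> g ` ?B)" if Y: "f ` X \<subseteq> Y" "finite Y" for Y
  proof -
    obtain Z where Z: "Y \<inter> g ` ?B = g ` Z" "Z \<subseteq> ?B" by (meson Int_lower2 subset_imageE)
    have "f ` X \<subseteq> g ` ?B" using gB_C by (metis Int_lower1)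
    then have "f ` X \<subseteq> Y \<inter> g ` ?B" using Y(1) by simp
    then have "g ` X \<subseteq> g ` Z" unfolding Z(1) gXi .
    then have "X \<subseteq> Z" using Xs inj_on_image_mem_iff[OF g_inj _ Z(2)] by blast
    then have "predim B X \<le> predim B Z"
      using strong_in_le[OF X] Z(2) B(2) finite_subset by blast
    then show ?thesis using pf pB[OF Z(2)] Z(1) by simp
  qed
  have lower: "predim D ?C + of_nat (card (Y - (?C \<union> g ` ?B))) \<le> predim D Y"
    if Y: "finite Y" "?C \<subseteq> Y" for Y
  proof -
    have "Y \<inter> ?C = ?C" "Y \<inter> f ` X = f ` X" using Y fC by auto
    moreover have "predim D (f ` X) \<le> predim D (Y \<inter> g ` ?B)" using strB Y fC by blast
    ultimately show ?thesis using pfree[OF Y(1)] unfolding int by simp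
  qed
  have C_strong: "strong_in D ?C"
    unfolding strong_in_def
  proof (intro conjI allI impI)
    fix Y assume Y: "finite Y \<and> ?C \<subseteq> Y \<and> Y \<subseteq> universe D"
    have "(0::rat) \<le> of_nat (card (Y - (?C \<union> g ` ?B)))" by simp
    then show "predim D ?C \<le> predim D Y" using lower[of Y] Y by linarith
  qed (use C(2) subU uni in auto)
  have B_strong: "strong_in D (g ` ?B)" if fX: "strong_in C (f ` X)"
    unfolding strong_in_def
  proof (intro conjI allI impI)
    fix Y assume Y: "finite Y \<and> g ` ?B \<subseteq> Y \<and> Y \<subseteq> universe D"
    have fXY: "f ` X \<subseteq> Y" using Y gXi Xs by blast
    have "predim C (f ` X) \<le> predim C (Y \<inter> ?C)"
      using strong_in_le[OF fX, of "Y \<inter> ?C"] Y fXY fC by auto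
    then have "predim D (f ` X) \<le> predim D (Y \<inter> ?C)" using pC fC by simp
    moreover have "Y \<inter> g ` ?B = g ` ?B" "Y \<inter> f ` X = f ` X" using Y fXY by auto
    moreover have "(0::rat) \<le> of_nat (card (Y - (?C \<union> g ` ?B)))" by simp
    ultimately show "predim D (g ` ?B) \<le> predim D Y"
      using pfree[of Y] Y unfolding int by simp
  qed (use fingB subU uni in auto)
  have "predim C ?C + of_nat (S - (card ?C + card ?B)) \<le> predim D (universe D)"
  proof -
    have "U - (?C \<union> g ` ?B) = P" using P by (auto simp: U_def)
    moreover have "S - (card ?C + card ?B) \<le> card P"
      using P(2) card_Un_le[of ?C "g ` ?B"] card_image[OF g_inj] by linarith
    then have "of_nat (S - (card ?C + card ?B)) \<le> (of_nat (card P) :: rat)" by (rule of_nat_mono)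
    ultimately show ?thesis using lower[OF fU subU(1)] pC[of ?C] by (simp add: uni)
  qed
  then show ?thesis
    using hyp fU cU subC C_strong gemb gX B_strong
    by (intro exI[of _ D] exI[of _ g]) (simp add: uni)
qed

text \<open>
  Once a reduction has brought the free amalgam down to the predimension of \<open>C\<close>, any copy of
  it over a strong copy of \<open>C\<close> is strong.
\<close>

definition level_amalgam ::
  "nat \<Rightarrow> ('e, nat) struct \<Rightarrow> ('e, 'b) struct \<Rightarrow> 'b set \<Rightarrow> ('b \<Rightarrow> nat) \<Rightarrow>
    ('e, nat) struct \<Rightarrow> ('b \<Rightarrow> nat) \<Rightarrow> bool" where
  "level_amalgam k C B X f D g \<longleftrightarrow>
     D \<in> K_\<alpha> ar \<alpha> \<and> substruct C D \<and> strong_in D (universe C) \<and>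
     predim D (universe D) = predim C (universe C) \<and>
     embeds g B D \<and> (\<forall>x \<in> X. g x = f x) \<and>
     (strong_in C (f ` X) \<longrightarrow> k_strong k D (g ` universe B)) \<and>
     (strong_in C (f ` X) \<and> predim B (universe B) \<le> predim C (universe C) \<longrightarrow>
        strong_in D (g ` universe B))"

text \<open>The free amalgam, padded to \<open>S\<close> points, is reduced by its excess over
  \<open>C\<close>, which is at most \<open>S\<close> because predimension never exceeds
  cardinality. \<open>C\<close> lies exactly at the final level and hence stays strong, which also
  keeps the result in the class. \<open>S\<close> and \<open>b\<close> depend on \<open>s\<close>
  and \<open>k\<close> only.\<close>

lemma level_amalgam_exists:
  "\<exists>b. \<forall>C (B :: ('e, 'b) struct) X f. C \<in> K_\<alpha> ar \<alpha> \<and> B \<in> K_L ar \<and>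
     card (universe C) \<le> s \<and> card (universe B) \<le> s \<and>
     strong_in B X \<and> embeds f (induced B X) C \<longrightarrow>
     (\<exists>D g. level_amalgam k C B X f D g \<and> card (universe D) \<le> b)"
proof -
  obtain N0 where N0: "\<forall>N \<ge> N0. \<forall>k J. \<exists>b. \<forall>j \<le> J. \<forall>D :: ('e, nat) struct.
     D \<in> K_L ar \<and> card (universe D) = N \<longrightarrow>
     (\<exists>D'. reduction k j D D' \<and> card (universe D') \<le> b)"
    using reduction_exists by (rule exE)
  define S where "S = 2 * s + N0"
  define J where "J = nat (common_denom \<alpha>) * S"
  have "S \<ge> N0" by (simp add: S_def)
  then obtain b where b: "\<forall>j \<le> J. \<forall>D :: ('e, nat) struct. D \<in> K_L ar \<and> card (universe D) = S \<longrightarrow>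
     (\<exists>D'. reduction k j D D' \<and> card (universe D') \<le> b)"
    using N0 by blast
  have "\<exists>D g. level_amalgam k C B X f D g \<and> card (universe D) \<le> b"
    if C: "C \<in> K_\<alpha> ar \<alpha>" and BL: "B \<in> K_L ar"
      and s: "card (universe C) \<le> s" "card (universe B) \<le> s"
      and X: "strong_in B X" and f: "embeds f (induced B X) C"
    for C :: "('e, nat) struct" and B :: "('e, 'b) struct" and X f
  proof -
    have B: "hypergraph ar B" "finite (universe B)" using BL by (simp_all add: K_L_iff)
    have C': "hypergraph ar C" "finite (universe C)" "0 \<le> predim C (universe C)"
      using C by (simp_all add: K_\<alpha>_iff)
    have "card (universe C) + card (universe B) \<le> S" using s by (simp add: S_def)
    then obtain D0 g where D0: "hypergraph ar D0" "finite (universe D0)" "card (universe D0) = S"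
      "substruct C D0" "strong_in D0 (universe C)"
      and g: "embeds g B D0" "\<forall>x \<in> X. g x = f x"
        "strong_in C (f ` X) \<longrightarrow> strong_in D0 (g ` universe B)"
      using free_amalgam[OF C'(1,2) B X f] by blast
    have pC: "predim D0 (universe C) = predim C (universe C)"
      using predim_substruct[OF D0(4)] by simp
    define x where "x = predim D0 (universe D0) - predim C (universe C)"
    have "0 \<le> x"
      using strong_in_le[OF D0(5) D0(2)] D0(4) pC by (simp add: x_def substruct_iff)
    have xc: "x * c \<in> \<int>" unfolding x_def left_diff_distrib by (intro Ints_diff predim_grid)
    define j where "j = nat \<lfloor>x * c\<rfloor>"
    have "of_nat j = x * c"
      using xc mult_nonneg_nonneg[OF \<open>0 \<le> x\<close> less_imp_le[OF c_pos]]
      by (auto simp: j_def elim!: Ints_cases)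
    then have j: "predim D0 (universe D0) - of_nat j / c = predim C (universe C)"
      using c_pos by (simp add: x_def)
    have "x \<le> of_nat S"
      using predim_le_card[of D0 "universe D0"] C'(3) D0(3) by (simp add: x_def)
    then have "x * c \<le> of_nat S * c" using c_pos by simp
    then have "of_nat j \<le> (of_nat J :: rat)"
      using \<open>of_nat j = x * c\<close> c_pos by (simp add: J_def mult.commute)
    then have "j \<le> J" by simp
    then obtain D where D: "hypergraph ar D" "finite (universe D)" "substruct D0 D"
      "card (universe D) \<le> b" "predim D (universe D) = predim C (universe C)"
      and str: "\<And>Z. strong_in D0 Z \<Longrightarrow> predim D0 Z \<le> predim C (universe C) \<Longrightarrow> strong_in D Z"
      and kstr: "\<And>Z. strong_in D0 Z \<Longrightarrow> k_strong k D Z"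
      using b D0(1-3) unfolding j[symmetric] K_L_iff reduction_def by metis
    have subC: "substruct C D" using substruct_trans[OF D0(4) D(3)] .
    have C_str: "strong_in D (universe C)" using str[OF D0(5)] pC by simp
    have "D \<in> K_\<alpha> ar \<alpha>" using K_\<alpha>_strong_extension[OF C D(1,2) subC C_str] .
    moreover have "embeds g B D" using embeds_into_super[OF g(1) D(3)] .
    moreover have "predim D0 (g ` universe B) = predim B (universe B)"
      using predim_embeds[OF g(1)] by simp
    then have "strong_in C (f ` X) \<and> predim B (universe B) \<le> predim C (universe C) \<longrightarrow>
        strong_in D (g ` universe B)" using g(3) str by simp
    moreover have "strong_in C (f ` X) \<longrightarrow> k_strong k D (g ` universe B)"
      using g(3) kstr by simp
    ultimately show ?thesis using D(4,5) subC C_str g(2) unfolding level_amalgam_def by blast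
  qed
  then show ?thesis by blast
qed


section \<open>Models\<close>

text \<open>The axioms of \<open>S\<^sub>\<alpha>\<close> given in the paper, stated semantically.\<close>

definition model :: "('e, 'a) struct \<Rightarrow> bool" where
  "model M \<longleftrightarrow> hypergraph ar M \<and>
     (\<forall>X. finite X \<and> X \<subseteq> universe M \<longrightarrow> 0 \<le> predim M X) \<and>
     (\<forall>B X f. B \<in> (K_\<alpha> ar \<alpha> :: ('e, nat) struct set) \<and> strong_in B X \<and>
        embeds f (induced B X) M \<longrightarrow> (\<exists>g. embeds g B M \<and> (\<forall>x \<in> X. g x = f x)))"

lemma model_hypergraph: "model M \<Longrightarrow> hypergraph ar M"
  and model_extension_nat: "model M \<Longrightarrow> B \<in> (K_\<alpha> ar \<alpha> :: ('e, nat) struct set) \<Longrightarrow>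
    strong_in B Y \<Longrightarrow> embeds f (induced B Y) M \<Longrightarrow> \<exists>g. embeds g B M \<and> (\<forall>x \<in> Y. g x = f x)"
  and model_nonneg: "model M \<Longrightarrow> finite X \<Longrightarrow> X \<subseteq> universe M \<Longrightarrow> 0 \<le> predim M X"
  by (simp_all add: model_def)

lemma finite_copy:
  assumes "hypergraph ar B" "finite (universe B)"
  shows "\<exists>(h :: 'b \<Rightarrow> nat) B' n. hypergraph ar B' \<and> universe B' = h ` universe B \<and>
    universe B' = {..<n} \<and> embeds h B B' \<and> embeds (inv_into (universe B) h) B' B"
proof -
  obtain h :: "'b \<Rightarrow> nat" and n where h: "h ` universe B = {i. i < n}" "inj_on h (universe B)"
    using finite_imp_inj_to_nat_seg[OF assms(2)] by blast
  have e: "embeds h B (image_struct h B)"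
    using embeds_image_struct[OF h(2) hypergraph_is_struct[OF assms(1)]] .
  have hyp: "hypergraph ar (image_struct h B)"
    using hypergraph_image_struct[OF h(2) assms(1)] .
  have "induced (image_struct h B) (h ` universe B) = image_struct h B"
    using induced_universe[OF hypergraph_is_struct[OF hyp]] by simp
  then have "embeds (inv_into (universe B) h) (image_struct h B) B"
    using embeds_inverse[OF e] by simp
  then show ?thesis
    using e hyp h by (intro exI[of _ h] exI[of _ "image_struct h B"] exI[of _ n]) auto
qed

lemma K_\<alpha>_embeds:
  assumes "embeds f A M" "is_struct ar A" "finite (universe A)" "hypergraph ar M"
    "\<And>X. finite X \<Longrightarrow> X \<subseteq> universe M \<Longrightarrow> 0 \<le> predim M X"
  shows "A \<in> K_\<alpha> ar \<alpha>"
proof -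
  have "0 \<le> predim A X" if X: "X \<subseteq> universe A" for X
  proof -
    have "finite (f ` X)" using X assms(3) by (simp add: finite_subset)
    moreover have "f ` X \<subseteq> f ` universe A" using X by (rule image_mono)
    then have "f ` X \<subseteq> universe M" using assms(1) unfolding embeds_def by blast
    ultimately show ?thesis using assms(5) predim_embeds[OF assms(1) X] by metis
  qed
  then show ?thesis
    using embeds_is_struct_hypergraph[OF assms(1,2,4)] assms(3) by (simp add: K_\<alpha>_iff)
qed

lemma K_\<alpha>_embeds_K_\<alpha>:
  assumes "embeds f A M" "is_struct ar A" "M \<in> K_\<alpha> ar \<alpha>"
  shows "A \<in> K_\<alpha> ar \<alpha>"
proof (rule K_\<alpha>_embeds[OF assms(1,2)])
  have "finite (f ` universe A)" "inj_on f (universe A)"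
    using assms by (auto simp: K_\<alpha>_iff embeds_def intro: finite_subset)
  then show "finite (universe A)" by (rule finite_imageD)
qed (use assms(3) in \<open>simp_all add: K_\<alpha>_iff\<close>)

lemma model_induced_K_\<alpha>:
  assumes "model M" "finite X" "X \<subseteq> universe M"
  shows "induced M X \<in> K_\<alpha> ar \<alpha>"
  using assms hypergraph_is_struct[OF hypergraph_induced[OF model_hypergraph]]
  by (intro K_\<alpha>_embeds[OF embeds_id[OF substruct_induced[OF assms(3)]]])
     (auto intro: model_hypergraph model_nonneg)

lemma strong_in_universe: "finite (universe C) \<Longrightarrow> strong_in C (universe C)"
  unfolding strong_in_def by (metis order_refl subset_antisym)

lemma strong_in_surj:
  assumes "embeds h B B'" "universe B' = h ` universe B" "hypergraph ar B'" "strong_in B X"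
  shows "strong_in B' (h ` X)"
  using embeds_strong_in[OF assms(1,4)] induced_universe[OF hypergraph_is_struct[OF assms(3)]]
    assms(2) by simp

text \<open>\<open>model\<close> speaks of structures on \<open>nat\<close>, since a definition
  cannot range over all carrier types. A finite \<open>B\<close> on another carrier is moved there
  by \<open>finite_copy\<close> and the embedding is moved back.\<close>

lemma model_extension:
  fixes B :: "('e, 'b) struct"
  assumes M: "model M" and B: "B \<in> K_\<alpha> ar \<alpha>" and X: "strong_in B X"
    and f: "embeds f (induced B X) M"
  shows "\<exists>g. embeds g B M \<and> (\<forall>x \<in> X. g x = f x)"
proof -
  have B': "hypergraph ar B" "finite (universe B)" using B by (simp_all add: K_\<alpha>_iff)
  have Xs: "X \<subseteq> universe B" using X by (simp add: strong_in_def)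
  obtain h :: "'b \<Rightarrow> nat" and A where A: "hypergraph ar A" "universe A = h ` universe B"
    "embeds h B A" "embeds (inv_into (universe B) h) A B"
    using finite_copy[OF B'] by blast
  let ?k = "inv_into (universe B) h"
  have kh: "?k (h x) = x" if "x \<in> universe B" for x
    using that A(3) by (simp add: embeds_def)
  have "A \<in> K_\<alpha> ar \<alpha>"
    using K_\<alpha>_embeds_K_\<alpha>[OF A(4) hypergraph_is_struct[OF A(1)] B] .
  moreover have "strong_in A (h ` X)" using strong_in_surj[OF A(3,2,1) X] .
  moreover have "embeds (f \<circ> ?k) (induced A (h ` X)) M"
  proof (rule embeds_comp[OF _ f])
    have "embeds ?k (induced A (h ` X)) B"
      using A(2) Xs by (intro embeds_subset[OF A(4)]) auto
    then show "embeds ?k (induced A (h ` X)) (induced B X)"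
      using kh Xs by (intro embeds_into_induced) auto
  qed
  ultimately obtain g where g: "embeds g A M" "\<forall>y \<in> h ` X. g y = (f \<circ> ?k) y"
    using model_extension_nat[OF M] by blast
  then have "embeds (g \<circ> h) B M" using embeds_comp[OF A(3)] by blast
  moreover have "(g \<circ> h) x = f x" if "x \<in> X" for x using that g(2) kh Xs by auto
  ultimately show ?thesis by blast
qed

section \<open>Strong images of embeddings into models\<close>

lemma embeds_k_strong_image:
  assumes "embeds f D M" "k_strong k M (f ` universe D)" "k_strong k D X"
  shows "k_strong k M (f ` X)"
  using k_strong_trans[of k M "induced M (f ` universe D)"] assms
    embeds_k_strong[OF assms(1,3)] k_strong_subset[OF assms(2)]
  by (simp add: substruct_induced)

lemma embeds_strong_image:
  "embeds f D M \<Longrightarrow> strong_in M (f ` universe D) \<Longrightarrow> strong_in D X \<Longrightarrow> strong_in M (f ` X)"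
  using embeds_k_strong_image unfolding strong_in_iff_k_strong by blast

text \<open>The upgrade of the extension axiom to strong images. \<open>C0\<close> provides the
  room: the amalgam of \<open>B\<close> with a strong set containing \<open>C0\<close> can be
  lowered to the level of that set without passing below \<open>B\<close>. Its copy in
  \<open>N\<close> is strong because it has the predimension of a strong set that it
  contains.\<close>

lemma strong_extension:
  fixes B :: "('e, 'b) struct" and N :: "('e, 'a) struct"
  assumes N: "model N" and B: "B \<in> K_\<alpha> ar \<alpha>" and X: "strong_in B X"
    and f: "embeds f (induced B X) N" and fX: "strong_in N (f ` X)"
    and C0: "strong_in N C0" "predim B (universe B) \<le> predim N C0"
  shows "\<exists>g. embeds g B N \<and> (\<forall>x \<in> X. g x = f x) \<and> strong_in N (g ` universe B)"
proof -
  have B': "hypergraph ar B" "finite (universe B)" using B by (simp_all add: K_\<alpha>_iff)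
  have "finite (f ` X \<union> C0)" "f ` X \<union> C0 \<subseteq> universe N"
    using fX C0(1) by (simp_all add: strong_in_def)
  \<comment> \<open>As \<open>C\<close> contains the strong set \<open>C0\<close>, its predimension
    is at least that of \<open>C0\<close>, hence at least that of \<open>B\<close>.\<close>
  then obtain C where C: "f ` X \<union> C0 \<subseteq> C" "strong_in N C"
    using closure_exists[OF model_nonneg[OF N], of "f ` X \<union> C0"] by auto
  have Cs: "finite C" "C \<subseteq> universe N" using C(2) by (simp_all add: strong_in_def)
  have BC: "predim B (universe B) \<le> predim N C"
    using strong_in_le[OF C0(1) Cs(1) _ Cs(2)] C(1) C0(2) by simp
  have ind: "induced N C \<in> K_\<alpha> ar \<alpha>" using model_induced_K_\<alpha>[OF N Cs] .
  then have hind: "hypergraph ar (induced N C)" by (simp add: K_\<alpha>_iff)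
  obtain h :: "'a \<Rightarrow> nat" and C' where C': "hypergraph ar C'" "universe C' = h ` C"
    "embeds h (induced N C) C'" "embeds (inv_into C h) C' (induced N C)"
    using finite_copy[OF hind] Cs(1) by auto
  let ?k = "inv_into C h"
  have kh: "?k (h x) = x" if "x \<in> C" for x using that C'(3) by (simp add: embeds_def)
  have C'K: "C' \<in> K_\<alpha> ar \<alpha>"
    using K_\<alpha>_embeds_K_\<alpha>[OF C'(4) hypergraph_is_struct[OF C'(1)] ind] .
  have f1: "embeds (h \<circ> f) (induced B X) C'"
    using C(1) by (intro embeds_comp[OF embeds_into_induced[OF f] C'(3)]) auto
  have "strong_in (induced N C) (f ` X)"
    using C(1) Cs by (intro strong_in_substruct[OF fX substruct_induced]) auto
  then have str1: "strong_in C' ((h \<circ> f) ` X)"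
    using strong_in_surj[OF C'(3) _ C'(1), of "f ` X"] C'(2) by (simp add: image_image)
  have pC': "predim C' (universe C') = predim N C"
    using predim_embeds[OF C'(3), of C] C'(2) by (simp add: predim_induced)
  let ?s = "max (card (universe C')) (card (universe B))"
  have "B \<in> K_L ar" "card (universe C') \<le> ?s" "card (universe B) \<le> ?s" using B' by (simp_all add: K_L_iff)
  then obtain D g1 where Dg: "level_amalgam 0 C' B X (h \<circ> f) D g1"
    using level_amalgam_exists[of ?s 0] C'K X f1 by meson
  from Dg have D: "D \<in> K_\<alpha> ar \<alpha>" "substruct C' D" "strong_in D (universe C')"
    "predim D (universe D) = predim C' (universe C')"
    and g1: "embeds g1 B D" "\<forall>x \<in> X. g1 x = (h \<circ> f) x" "strong_in D (g1 ` universe B)"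
    using str1 BC pC' by (simp_all add: level_amalgam_def)
  have subC': "universe C' \<subseteq> universe D" and ind': "induced D (universe C') = C'"
    using D(2) by (auto simp: substruct_iff)
  have "embeds ?k (induced D (universe C')) N"
    unfolding ind' using embeds_from_induced[OF C'(4) Cs(2)] .
  then obtain e where e: "embeds e D N" "\<forall>y \<in> universe C'. e y = ?k y"
    using model_extension[OF N D(1,3)] by blast
  have fD: "finite (universe D)" using D(1) by (simp add: K_\<alpha>_iff)
  have eC: "e ` universe C' = C"
    using e(2) kh unfolding C'(2) by (auto simp: image_iff)
  have pe: "predim N (e ` universe D) = predim N C"
    using predim_embeds[OF e(1)] D(4) pC' by simp
  have "C \<subseteq> e ` universe D" using image_mono[OF subC', of e] eC by simp
  then have "strong_in N (e ` universe D)"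
    unfolding strong_in_def pe
    using fD e(1) strong_in_le[OF C(2)] by (auto simp: embeds_def dest: order_trans)
  then have "strong_in N (e ` g1 ` universe B)"
    using embeds_strong_image[OF e(1) _ g1(3)] by blast
  moreover have "embeds (e \<circ> g1) B N" using embeds_comp[OF g1(1) e(1)] .
  moreover have "(e \<circ> g1) x = f x" if "x \<in> X" for x
    using that g1(2) e(2) C(1) C'(2) kh by auto
  ultimately show ?thesis by (intro exI[of _ "e \<circ> g1"]) (simp add: image_comp)
qed

section \<open>Elementary equivalence of models\<close>

definition approx_iso ::
  "nat \<Rightarrow> ('e, 'a) struct \<Rightarrow> ('e, 'b) struct \<Rightarrow> 'a set \<Rightarrow> ('a \<Rightarrow> 'b) \<Rightarrow> bool" where
  "approx_iso m M N X f \<longleftrightarrow>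
     k_strong m M X \<and> embeds f (induced M X) N \<and> k_strong m N (f ` X)"

lemma approx_iso_mono: "approx_iso m M N X f \<Longrightarrow> k \<le> m \<Longrightarrow> approx_iso k M N X f"
  by (auto simp: approx_iso_def intro: k_strong_mono)

lemma approx_iso_inverse:
  assumes "approx_iso m M N X f"
  shows "approx_iso m N M (f ` X) (inv_into X f)" "inv_into X f ` f ` X = X"
    "\<And>x. x \<in> X \<Longrightarrow> inv_into X f (f x) = x" "card (f ` X) = card X"
proof -
  have X: "k_strong m M X" "embeds f (induced M X) N" "k_strong m N (f ` X)"
    using assms by (simp_all add: approx_iso_def)
  have inj: "inj_on f X" using X(2) by (simp add: embeds_def)
  show k: "inv_into X f ` f ` X = X" using inj by (simp add: inv_into_image_cancel)
  show "\<And>x. x \<in> X \<Longrightarrow> inv_into X f (f x) = x" "card (f ` X) = card X"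
    using inj by (simp_all add: card_image)
  have "embeds (inv_into X f) (induced N (f ` X)) (induced M X)" using embeds_inverse[OF X(2)] by simp
  then have "embeds (inv_into X f) (induced N (f ` X)) M"
    using embeds_from_induced k_strong_subset[OF X(1)] by blast
  then show "approx_iso m N M (f ` X) (inv_into X f)" using X k by (simp add: approx_iso_def)
qed

text \<open>
  The quality demanded of the extended map depends, through \<open>g\<close>, on the size of its domain:
  the closure supplying the domain is itself taken with respect to this demand.
\<close>

lemma approx_iso_extension:
  fixes M :: "('e, 'a) struct" and N :: "('e, 'b) struct" and g :: "nat \<Rightarrow> nat"
  assumes M: "model M" and N: "model N"
  shows "\<exists>m. \<forall>X f x. card X \<le> s \<and> approx_iso m M N X f \<and> x \<in> universe M \<longrightarrow>
    (\<exists>Y f'. X \<subseteq> Y \<and> x \<in> Y \<and> approx_iso (g (card Y)) M N Y f' \<and> (\<forall>z \<in> X. f' z = f z))"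
proof -
  obtain b0 where b0: "\<forall>F. finite F \<and> F \<subseteq> universe M \<and> card F \<le> s + 1 \<longrightarrow>
    (\<exists>X. F \<subseteq> X \<and> card X \<le> b0 \<and> k_strong (g (card X)) M X)"
    using bounded_closure_exists[OF model_nonneg[OF M], of "s + 1" g] by (rule exE)
  \<comment> \<open>One demand that covers \<open>g (card Y)\<close> for every closure
    \<open>Y\<close> of size at most \<open>b0\<close>; it must be fixed before the amalgam is
    built.\<close>
  define K where "K = Max (g ` {..b0})"
  have K: "g i \<le> K" if "i \<le> b0" for i unfolding K_def using that by (intro Max_ge) auto
  obtain b1 where b1: "\<forall>C (B :: ('e, 'a) struct) X f. C \<in> K_\<alpha> ar \<alpha> \<and> B \<in> K_L ar \<and>
     card (universe C) \<le> b0 \<and> card (universe B) \<le> b0 \<and>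
     strong_in B X \<and> embeds f (induced B X) C \<longrightarrow>
     (\<exists>D g. level_amalgam K C B X f D g \<and> card (universe D) \<le> b1)"
    using level_amalgam_exists[of b0 K] by (rule exE)
  \<comment> \<open>\<open>b0\<close> makes \<open>X\<close> strong inside the closure
    \<open>Y\<close>; \<open>b1 + K\<close> makes the copy of the amalgam \<open>K\<close>-strong in
    \<open>N\<close>.\<close>
  define m where "m = b0 + b1 + K"
  have "\<exists>Y f'. X \<subseteq> Y \<and> x \<in> Y \<and> approx_iso (g (card Y)) M N Y f' \<and> (\<forall>z \<in> X. f' z = f z)"
    if sX: "card X \<le> s" and Xf: "approx_iso m M N X f" and x: "x \<in> universe M" for X f x
  proof -
    have X: "card X \<le> s" "k_strong m M X" and f: "embeds f (induced M X) N"
      and fX: "k_strong m N (f ` X)" using sX Xf by (simp_all add: approx_iso_def)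
    have Xs: "finite X" "X \<subseteq> universe M" using X(2) by (simp_all add: k_strong_def)
    have "card (insert x X) \<le> s + 1" using X(1) Xs(1) by (simp add: card_insert_if)
    then obtain Y where Y: "insert x X \<subseteq> Y" "card Y \<le> b0" "k_strong (g (card Y)) M Y"
      using b0[rule_format, of "insert x X"] Xs x by auto
    have Ys: "finite Y" "Y \<subseteq> universe M" using Y(3) by (simp_all add: k_strong_def)
    have XY: "X \<subseteq> Y" using Y(1) by simp
    have strX: "strong_in (induced M Y) X"
      unfolding strong_in_def
    proof (intro conjI allI impI)
      fix Z assume Z: "finite Z \<and> X \<subseteq> Z \<and> Z \<subseteq> universe (induced M Y)"
      then have "card (Z - X) \<le> card Y" using Ys(1) by (intro card_mono) auto
      then have "predim M X \<le> predim M Z"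
        using Z Ys Y(2) by (intro k_strong_le[OF X(2)]) (auto simp: m_def)
      then show "predim (induced M Y) X \<le> predim (induced M Y) Z"
        using Z XY by (simp add: predim_induced)
    qed (use Xs XY in auto)
    \<comment> \<open>The base of the amalgam is a copy of \<open>X\<close> itself, so the amalgam
      ends at the level of \<open>X\<close>. The closure \<open>Y\<close> may lie higher, and then
      only its \<open>K\<close>-strength survives.\<close>
    have indX: "induced M X \<in> K_\<alpha> ar \<alpha>" using model_induced_K_\<alpha>[OF M Xs] .
    then have hindX: "hypergraph ar (induced M X)" by (simp add: K_\<alpha>_iff)
    obtain h :: "'a \<Rightarrow> nat" and C where C: "hypergraph ar C" "universe C = h ` X"
      "embeds h (induced M X) C" "embeds (inv_into X h) C (induced M X)"
      using finite_copy[OF hindX] Xs(1) by auto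
    let ?k = "inv_into X h"
    have kh: "?k (h x) = x" if "x \<in> X" for x using that C(3) by (simp add: embeds_def)
    have CK: "C \<in> K_\<alpha> ar \<alpha>"
      using K_\<alpha>_embeds_K_\<alpha>[OF C(4) hypergraph_is_struct[OF C(1)] indX] .
    have hX: "h ` X = universe C" using C(2) by simp
    have strC: "strong_in C (h ` X)"
      unfolding hX using CK by (simp add: K_\<alpha>_iff strong_in_universe)
    have cC: "card (universe C) \<le> b0"
      using C(2) card_image_le[OF Xs(1), of h] card_mono[OF Ys(1) XY] Y(2) by simp
    have hyp: "induced M Y \<in> K_L ar"
      using hypergraph_induced[OF model_hypergraph[OF M]] Ys(1) by (simp add: K_L_iff)
    have emb: "embeds h (induced (induced M Y) X) C"
      using C(3) by (simp add: induced_induced XY)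
    obtain D g1 where Dg: "level_amalgam K C (induced M Y) X h D g1" "card (universe D) \<le> b1"
      using b1[rule_format, of C "induced M Y" X h] CK hyp cC Y(2) strX emb by auto
    then have D: "D \<in> K_\<alpha> ar \<alpha>" "card (universe D) \<le> b1"
      "substruct C D" "strong_in D (universe C)"
      "predim D (universe D) = predim C (universe C)"
      and g1: "embeds g1 (induced M Y) D" "\<forall>z \<in> X. g1 z = h z" "k_strong K D (g1 ` Y)"
      using strC by (simp_all add: level_amalgam_def)
    have subC: "universe C \<subseteq> universe D" and indC: "induced D (universe C) = C"
      using D(3) by (auto simp: substruct_iff)
    have "embeds (f \<circ> ?k) (induced D (universe C)) N"
      unfolding indC using embeds_comp[OF C(4) f] .
    then obtain e where e: "embeds e D N" "\<forall>y \<in> universe C. e y = (f \<circ> ?k) y"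
      using model_extension[OF N D(1,4)] by blast
    have fD: "finite (universe D)" using D(1) by (simp add: K_\<alpha>_iff)
    have eC: "e ` universe C = f ` X"
      using e(2) kh unfolding C(2) by (auto simp: image_iff)
    have pe: "predim N (e ` universe D) = predim N (f ` X)"
    proof -
      have "predim N (e ` universe D) = predim C (universe C)"
        using predim_embeds[OF e(1), of "universe D"] D(5) by simp
      also have "\<dots> = predim D (universe C)" using predim_substruct[OF D(3)] by simp
      also have "\<dots> = predim N (f ` X)" using predim_embeds[OF e(1) subC] eC by simp
      finally show ?thesis .
    qed
    have eD: "f ` X \<subseteq> e ` universe D" "e ` universe D \<subseteq> universe N"
      using image_mono[OF subC, of e] eC e(1) by (simp_all add: embeds_def)
    have "k_strong K N (e ` universe D)"
      unfolding k_strong_def pe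
    proof (intro conjI allI impI)
      fix T assume T: "finite T \<and> e ` universe D \<subseteq> T \<and> T \<subseteq> universe N \<and>
        card (T - e ` universe D) \<le> K"
      have "T - f ` X \<subseteq> (T - e ` universe D) \<union> e ` universe D" by blast
      then have "card (T - f ` X) \<le> card ((T - e ` universe D) \<union> e ` universe D)"
        using T fD by (intro card_mono) auto
      also have "\<dots> \<le> card (T - e ` universe D) + card (e ` universe D)" by (rule card_Un_le)
      also have "\<dots> \<le> K + b1"
        using T card_image_le[OF fD, of e] D(2) by linarith
      finally show "predim N (f ` X) \<le> predim N T"
        using T eD by (intro k_strong_le[OF fX]) (auto simp: m_def)
    qed (use fD eD in auto)
    then have "k_strong K N (e ` g1 ` Y)"
      using embeds_k_strong_image[OF e(1) _ g1(3)] by blast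
    then have "k_strong (g (card Y)) N ((e \<circ> g1) ` Y)"
      using k_strong_mono[OF _ K[OF Y(2)]] by (simp add: image_comp)
    moreover have "embeds (e \<circ> g1) (induced M Y) N" using embeds_comp[OF g1(1) e(1)] .
    moreover have "(e \<circ> g1) z = f z" if "z \<in> X" for z
      using that g1(2) e(2) C(2) kh by auto
    ultimately show ?thesis using Y(1,3)
      by (intro exI[of _ Y] exI[of _ "e \<circ> g1"]) (auto simp: approx_iso_def)
  qed
  then show ?thesis by blast
qed

text \<open>Induction on the formula. In the quantifier case the enlarged domain has a size known
  only after the extension, so the induction hypothesis is first turned into a function
  \<open>g\<close> from sizes to qualities and handed to \<open>approx_iso_extension\<close>, once
  in each direction.\<close>

lemma approx_iso_sat:
  fixes M :: "('e, 'a) struct" and N :: "('e, 'b) struct"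
  assumes M: "model M" and N: "model N"
  shows "\<exists>m. \<forall>X f v w. card X \<le> s \<and> approx_iso m M N X f \<and>
      (\<forall>i \<in> free_vars \<phi>. v i \<in> X \<and> w i = f (v i)) \<longrightarrow> (sat M v \<phi> \<longleftrightarrow> sat N w \<phi>)"
proof -
  define P where "P \<phi> s m \<longleftrightarrow> (\<forall>X f v w. card X \<le> s \<and> approx_iso m M N X f \<and>
      (\<forall>i \<in> free_vars \<phi>. v i \<in> X \<and> w i = f (v i)) \<longrightarrow> (sat M v \<phi> \<longleftrightarrow> sat N w \<phi>))" for \<phi> s m
  have PD: "sat M v \<phi> \<longleftrightarrow> sat N w \<phi>"
    if "P \<phi> s m" "card X \<le> s" "approx_iso m M N X f" "\<forall>i \<in> free_vars \<phi>. v i \<in> X \<and> w i = f (v i)"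
    for \<phi> s m X f v w using that unfolding P_def by blast
  have "\<exists>m. P \<phi> s m"
  proof (induction \<phi> arbitrary: s)
    case (Eq i j)
    show ?case unfolding P_def approx_iso_def
      by (intro exI[of _ 0]) (auto simp: embeds_def inj_on_def)
  next
    case (Rel E js)
    have "sat M v (Rel E js) \<longleftrightarrow> sat N w (Rel E js)"
      if f: "embeds f (induced M X) N" and vw: "\<forall>i \<in> set js. v i \<in> X \<and> w i = f (v i)" for X f v w
    proof -
      have "map w js = map f (map v js)" using vw by simp
      moreover have "set (map v js) \<subseteq> X" using vw by auto
      ultimately show ?thesis using f unfolding embeds_induced_iff sat.simps by metis
    qed
    then show ?case unfolding P_def approx_iso_def free_vars.simps by blast
  next
    case (Neg \<phi>)
    then show ?case by (simp add: P_def)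
  next
    case (Conj \<phi> \<psi>)
    obtain m1 m2 where m: "P \<phi> s m1" "P \<psi> s m2" using Conj.IH[of s] by blast
    show ?case
      unfolding P_def
    proof (intro exI[of _ "max m1 m2"] allI impI, elim conjE)
      fix X f v w
      assume a: "card X \<le> s" "approx_iso (max m1 m2) M N X f"
        "\<forall>i \<in> free_vars (Conj \<phi> \<psi>). v i \<in> X \<and> w i = f (v i)"
      have "approx_iso m1 M N X f" "approx_iso m2 M N X f" using approx_iso_mono[OF a(2)] by simp_all
      then show "sat M v (Conj \<phi> \<psi>) \<longleftrightarrow> sat N w (Conj \<phi> \<psi>)"
        using PD[OF m(1) a(1), of f v w] PD[OF m(2) a(1), of f v w] a(3) by simp
    qed
  next
    case (Ex i \<phi>)
    then have "\<forall>s. \<exists>m. P \<phi> s m" by blast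
    then obtain g where g: "\<And>s. P \<phi> s (g s)" by metis
    obtain m1 where m1: "\<forall>X f x. card X \<le> s \<and> approx_iso m1 M N X f \<and> x \<in> universe M \<longrightarrow>
        (\<exists>Y f'. X \<subseteq> Y \<and> x \<in> Y \<and> approx_iso (g (card Y)) M N Y f' \<and> (\<forall>z \<in> X. f' z = f z))"
      using approx_iso_extension[OF M N] by (rule exE)
    obtain m2 where m2: "\<forall>X f x. card X \<le> s \<and> approx_iso m2 N M X f \<and> x \<in> universe N \<longrightarrow>
        (\<exists>Y f'. X \<subseteq> Y \<and> x \<in> Y \<and> approx_iso (g (card Y)) N M Y f' \<and> (\<forall>z \<in> X. f' z = f z))"
      using approx_iso_extension[OF N M] by (rule exE)
    show ?case
      unfolding P_def
    proof (intro exI[of _ "max m1 m2"] allI impI, elim conjE)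
      fix X f v w
      assume a: "card X \<le> s" "approx_iso (max m1 m2) M N X f"
        "\<forall>j \<in> free_vars (Ex i \<phi>). v j \<in> X \<and> w j = f (v j)"
      have a1: "approx_iso m1 M N X f" and a2: "approx_iso m2 M N X f"
        using approx_iso_mono[OF a(2)] by simp_all
      note k = approx_iso_inverse[OF a2]
      have fv: "v j \<in> X \<and> w j = f (v j)" if "j \<in> free_vars \<phi>" "j \<noteq> i" for j
        using a(3) that by simp
      show "sat M v (Ex i \<phi>) \<longleftrightarrow> sat N w (Ex i \<phi>)"
      proof
        assume "sat M v (Ex i \<phi>)"
        then obtain x where x: "x \<in> universe M" "sat M (v(i := x)) \<phi>" by auto
        then obtain Y f' where Y: "X \<subseteq> Y" "x \<in> Y" "approx_iso (g (card Y)) M N Y f'"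
          "\<forall>z \<in> X. f' z = f z"
          using m1[THEN spec, THEN spec, THEN spec, THEN mp, OF conjI[OF a(1) conjI[OF a1 x(1)]]]
          by (elim exE conjE)
        have "\<forall>j \<in> free_vars \<phi>. (v(i := x)) j \<in> Y \<and> (w(i := f' x)) j = f' ((v(i := x)) j)"
          using fv Y(1,2,4) by auto
        then have "sat N (w(i := f' x)) \<phi>" using PD[OF g order_refl Y(3)] x(2) by blast
        moreover have "f' x \<in> universe N" using Y(2,3) by (auto simp: approx_iso_def embeds_def)
        ultimately show "sat N w (Ex i \<phi>)" by auto
      next
        assume "sat N w (Ex i \<phi>)"
        then obtain y where y: "y \<in> universe N" "sat N (w(i := y)) \<phi>" by auto
        have sX: "card (f ` X) \<le> s" using k(4) a(1) by simp
        obtain Y f' where Y: "f ` X \<subseteq> Y" "y \<in> Y" "approx_iso (g (card Y)) N M Y f'"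
          "\<forall>z \<in> f ` X. f' z = inv_into X f z" 
          using m2[THEN spec, THEN spec, THEN spec, THEN mp, OF conjI[OF sX conjI[OF k(1) y(1)]]]
          by (elim exE conjE)
        \<comment> \<open>The extension was made from \<open>N\<close> to \<open>M\<close>; the
          induction hypothesis concerns maps from \<open>M\<close> to \<open>N\<close>, so it is
          inverted again.\<close>
        note l = approx_iso_inverse[OF Y(3)]
        let ?l = "inv_into Y f'"
        have z: "z \<in> f' ` Y \<and> ?l z = f z" if "z \<in> X" for z
        proof -
          have "f z \<in> Y" "f' (f z) = z" using that Y(1,4) k(3) by auto
          then show ?thesis using l(3) by (metis imageI)
        qed
        have "\<forall>j \<in> free_vars \<phi>. (v(i := f' y)) j \<in> f' ` Y \<and> (w(i := y)) j = ?l ((v(i := f' y)) j)"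
          using fv z l(3)[OF Y(2)] Y(2) by auto
        then have "sat M (v(i := f' y)) \<phi>" using PD[OF g eq_refl[OF l(4)] l(1)] y(2) by blast
        moreover have "f' y \<in> universe M" using Y(2,3) by (auto simp: approx_iso_def embeds_def)
        ultimately show "sat M v (Ex i \<phi>)" by auto
      qed
    qed
  qed
  then show ?thesis unfolding P_def .
qed

lemma model_empty_strong: "model M \<Longrightarrow> strong_in M {}"
  using model_nonneg predim_empty[OF model_hypergraph] by (fastforce simp: strong_in_def)

lemma embeds_empty:
  assumes "hypergraph ar M" "hypergraph ar N"
  shows "embeds f (induced M {}) N"
proof -
  have "[] \<notin> interp M E" "[] \<notin> interp N E" for E
    using hypergraphD(2)[OF assms(1)] hypergraphD(2)[OF assms(2)] ar_ge_2[of E] by fastforce+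
  then show ?thesis by (simp add: embeds_def)
qed

text \<open>Predimension is nonnegative, so the empty set is strong and the empty map is an
  approximate isomorphism of every quality.\<close>

lemma models_elementarily_equivalent:
  assumes "model M" "model N" "free_vars \<phi> = {}"
  shows "holds_in M \<phi> \<longleftrightarrow> holds_in N \<phi>"
proof -
  obtain m where m: "\<forall>X f v w. card X \<le> 0 \<and> approx_iso m M N X f \<and>
      (\<forall>i \<in> free_vars \<phi>. v i \<in> X \<and> w i = f (v i)) \<longrightarrow> (sat M v \<phi> \<longleftrightarrow> sat N w \<phi>)"
    using approx_iso_sat[OF assms(1,2)] by (rule exE)
  have "approx_iso m M N {} undefined"
    using strong_in_k_strong[OF model_empty_strong[OF assms(1)]]
      strong_in_k_strong[OF model_empty_strong[OF assms(2)]]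
      embeds_empty[OF assms(1,2)[THEN model_hypergraph]] by (simp add: approx_iso_def)
  then have "sat M v \<phi> \<longleftrightarrow> sat N w \<phi>" for v w
    using m[rule_format, of "{}" undefined v w] assms(3) by simp
  then show ?thesis unfolding holds_in_def by blast
qed

end

section \<open>Diagrams\<close>

text \<open>The empty conjunction is a true sentence with no free variable, which a plain
  \<open>Eq 0 0\<close> would have.\<close>

definition conj_list :: "'e formula list \<Rightarrow> 'e formula" where
  "conj_list l = foldr Conj l (Neg (Ex 0 (Neg (Eq 0 0))))"

definition ex_list :: "nat list \<Rightarrow> 'e formula \<Rightarrow> 'e formula" where
  "ex_list l \<phi> = foldr Ex l \<phi>"

text \<open>Elements of a structure on \<open>nat\<close> serve as their own variables. Restricting
  to tuples of length \<open>ar E\<close> keeps the set finite and the formulas well-formed.\<close>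

definition diagram_set :: "('e \<Rightarrow> nat) \<Rightarrow> ('e, nat) struct \<Rightarrow> 'e formula set" where
  "diagram_set ar A =
     (\<lambda>(i, j). Neg (Eq i j)) ` {(i, j). i \<in> universe A \<and> j \<in> universe A \<and> i \<noteq> j} \<union>
     (\<Union>E. (\<lambda>xs. if xs \<in> interp A E then Rel E xs else Neg (Rel E xs)) `
       {xs. set xs \<subseteq> universe A \<and> length xs = ar E})"

definition diagram :: "('e \<Rightarrow> nat) \<Rightarrow> ('e, nat) struct \<Rightarrow> 'e formula" where
  "diagram ar A = conj_list (SOME l. set l = diagram_set ar A)"

lemma sat_conj_list: "sat M v (conj_list l) \<longleftrightarrow> (\<forall>\<phi> \<in> set l. sat M v \<phi>)"
  by (induction l) (simp_all add: conj_list_def)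

lemma free_vars_conj_list: "free_vars (conj_list l) = (\<Union>\<phi> \<in> set l. free_vars \<phi>)"
  by (induction l) (simp_all add: conj_list_def)

lemma wf_conj_list: "wf_formula ar (conj_list l) \<longleftrightarrow> (\<forall>\<phi> \<in> set l. wf_formula ar \<phi>)"
  by (induction l) (simp_all add: conj_list_def)

lemma free_vars_ex_list: "free_vars (ex_list l \<phi>) = free_vars \<phi> - set l"
  by (induction l) (auto simp: ex_list_def)

lemma wf_ex_list: "wf_formula ar (ex_list l \<phi>) \<longleftrightarrow> wf_formula ar \<phi>"
  by (induction l) (simp_all add: ex_list_def)

lemma sat_ex_list:
  "sat M v (ex_list l \<phi>) \<longleftrightarrow>
     (\<exists>w. (\<forall>i. i \<notin> set l \<longrightarrow> w i = v i) \<and> (\<forall>i \<in> set l. w i \<in> universe M) \<and> sat M w \<phi>)"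
proof (induction l arbitrary: v)
  case Nil
  have "(\<forall>i. w i = v i) \<longleftrightarrow> w = v" for w by auto
  then show ?case by (simp add: ex_list_def)
next
  case (Cons i l)
  have "sat M v (ex_list (i # l) \<phi>) \<longleftrightarrow> (\<exists>x \<in> universe M. sat M (v(i := x)) (ex_list l \<phi>))"
    by (simp add: ex_list_def)
  also have "\<dots> \<longleftrightarrow> (\<exists>w. (\<forall>j. j \<notin> set (i # l) \<longrightarrow> w j = v j) \<and>
      (\<forall>j \<in> set (i # l). w j \<in> universe M) \<and> sat M w \<phi>)"
  proof
    assume "\<exists>x \<in> universe M. sat M (v(i := x)) (ex_list l \<phi>)"
    then obtain x w where w: "x \<in> universe M" "\<forall>j. j \<notin> set l \<longrightarrow> w j = (v(i := x)) j"
      "\<forall>j \<in> set l. w j \<in> universe M" "sat M w \<phi>" unfolding Cons.IH by blast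
    have "w i \<in> universe M" using w by (cases "i \<in> set l") auto
    with w show "\<exists>w. (\<forall>j. j \<notin> set (i # l) \<longrightarrow> w j = v j) \<and>
      (\<forall>j \<in> set (i # l). w j \<in> universe M) \<and> sat M w \<phi>"
      by (intro exI[of _ w]) auto
  next
    assume "\<exists>w. (\<forall>j. j \<notin> set (i # l) \<longrightarrow> w j = v j) \<and>
      (\<forall>j \<in> set (i # l). w j \<in> universe M) \<and> sat M w \<phi>"
    then obtain w where "\<forall>j. j \<notin> set (i # l) \<longrightarrow> w j = v j"
      "\<forall>j \<in> set (i # l). w j \<in> universe M" "sat M w \<phi>" by blast
    then show "\<exists>x \<in> universe M. sat M (v(i := x)) (ex_list l \<phi>)"
      unfolding Cons.IH by (intro bexI[of _ "w i"] exI[of _ w]) auto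
  qed
  finally show ?case .
qed

lemma set_diagram:
  fixes A :: "('e::finite, nat) struct"
  assumes "finite (universe A)"
  shows "set (SOME l. set l = diagram_set ar A) = diagram_set ar A"
proof (rule someI_ex, rule finite_list)
  have "finite {(i, j). i \<in> universe A \<and> j \<in> universe A \<and> i \<noteq> j}"
    using assms by (auto intro: finite_subset[of _ "universe A \<times> universe A"])
  moreover have "finite {xs. set xs \<subseteq> universe A \<and> length xs = ar E}" for E
    using assms by (rule finite_lists_length_eq)
  ultimately show "finite (diagram_set ar A)" by (simp add: diagram_set_def)
qed

lemma diagram_props:
  fixes A :: "('e::finite, nat) struct"
  assumes "finite (universe A)"
  shows "free_vars (diagram ar A) \<subseteq> universe A" "wf_formula ar (diagram ar A)"
  using set_diagram[OF assms, of ar]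
  by (auto simp: diagram_def free_vars_conj_list wf_conj_list diagram_set_def split: if_splits)

lemma sat_diagram:
  fixes A :: "('e::finite, nat) struct"
  assumes A: "finite (universe A)" "is_struct ar A" and M: "is_struct ar M"
    and v: "v ` universe A \<subseteq> universe M"
  shows "sat M v (diagram ar A) \<longleftrightarrow> embeds v A M"
proof -
  have "sat M v (diagram ar A) \<longleftrightarrow> (\<forall>\<phi> \<in> diagram_set ar A. sat M v \<phi>)"
    unfolding diagram_def sat_conj_list set_diagram[OF A(1)] ..
  also have "\<dots> \<longleftrightarrow> inj_on v (universe A) \<and>
      (\<forall>E xs. set xs \<subseteq> universe A \<and> length xs = ar E \<longrightarrow> (xs \<in> interp A E \<longleftrightarrow> map v xs \<in> interp M E))"
    unfolding diagram_set_def ball_Un ball_UN ball_simps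
    by (auto simp: inj_on_def split: if_splits)
  also have "\<dots> \<longleftrightarrow> embeds v A M"
  proof -
    have "length xs = ar E" if "xs \<in> interp A E \<or> map v xs \<in> interp M E" for xs E
      using that A(2) M by (metis is_struct_def length_map)
    then show ?thesis using v unfolding embeds_def by blast
  qed
  finally show ?thesis .
qed

lemma hypergraph_locally:
  assumes "is_struct ar M"
    and loc: "\<And>X. finite X \<Longrightarrow> X \<subseteq> universe M \<Longrightarrow> hypergraph ar (induced M X)"
  shows "hypergraph ar M"
proof -
  have "distinct xs \<and> (\<forall>ys. distinct ys \<and> set ys = set xs \<longrightarrow> ys \<in> interp M E)"
    if xs: "xs \<in> interp M E" for xs E
  proof -
    have "set xs \<subseteq> universe M" using assms(1) xs by (auto simp: is_struct_def)
    then have h: "hypergraph ar (induced M (set xs))" by (intro loc) auto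
    have xs': "xs \<in> interp (induced M (set xs)) E" using xs by simp
    have "ys \<in> interp M E" if "distinct ys" "set ys = set xs" for ys
      using hypergraphD(4)[OF h xs' that] by simp
    then show ?thesis using hypergraphD(1)[OF h xs'] by blast
  qed
  then show ?thesis using assms(1) unfolding hypergraph_def by blast
qed

text \<open>A finite hypergraph on \<open>nat\<close> is given by its universe and edge sets inside
  some \<open>{..<n}\<close>, so there are finitely many for each \<open>n\<close>.\<close>

lemma countable_hypergraphs:
  "countable {A :: ('e::finite, nat) struct. hypergraph ar A \<and> finite (universe A)}"
proof -
  have fin: "finite {A :: ('e, nat) struct. hypergraph ar A \<and> universe A \<subseteq> {..<n}}" for n
  proof (rule finite_subset)
    let ?F = "Pi\<^sub>E (UNIV :: 'e set) (\<lambda>_. Pow (Pow {..<n}))"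
    show "finite ((\<lambda>(U, ed). of_edges U ed) ` (Pow {..<n} \<times> ?F))"
      by (intro finite_imageI finite_cartesian_product finite_PiE) auto
    show "{A :: ('e, nat) struct. hypergraph ar A \<and> universe A \<subseteq> {..<n}} \<subseteq>
        (\<lambda>(U, ed). of_edges U ed) ` (Pow {..<n} \<times> ?F)"
    proof
      fix A :: "('e, nat) struct"
      assume "A \<in> {A. hypergraph ar A \<and> universe A \<subseteq> {..<n}}"
      then have A: "hypergraph ar A" "universe A \<subseteq> {..<n}" by auto
      have "of_edges (universe A) (edges A) = A"
        using hypergraph_edge[OF A(1)]
        by (intro hypergraph_eqI[OF hypergraph_of_edges A(1)] edges_of_edges) auto
      moreover have "edges A \<in> ?F"
        unfolding PiE_UNIV_domain using A(2) hypergraph_edge(1)[OF A(1)] by blast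
      ultimately show "A \<in> (\<lambda>(U, ed). of_edges U ed) ` (Pow {..<n} \<times> ?F)"
        using A(2) by (intro image_eqI[of _ _ "(universe A, edges A)"]) auto
    qed
  qed
  have "{A :: ('e, nat) struct. hypergraph ar A \<and> finite (universe A)} \<subseteq>
      (\<Union>n. {A. hypergraph ar A \<and> universe A \<subseteq> {..<n}})"
    using finite_nat_bounded by blast
  then show ?thesis
    by (rule countable_subset) (rule countable_UN[OF countableI_type countable_finite[OF fin]])
qed

section \<open>The theory of the generic and the extension axioms\<close>

context rational_weights
begin

text \<open>Each semantic axiom is a family of sentences built from diagrams. That a finite
  structure does not occur is a negated existential diagram; an extension axiom says that no
  realisation of the diagram of \<open>X\<close> lacks an extension to one of the diagram of
  \<open>B\<close>.\<close>

lemma model_of_theory: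
  fixes M :: "('e, 'a) struct" and G :: "('e, 'b) struct"
  assumes G: "model G" and M: "is_struct ar M"
    and th: "\<And>\<phi>. \<phi> \<in> sentences ar \<Longrightarrow> holds_in G \<phi> \<Longrightarrow> holds_in M \<phi>"
  shows "model M"
proof -
  have Gs: "is_struct ar G" using hypergraph_is_struct[OF model_hypergraph[OF G]] .
  \<comment> \<open>If \<open>A\<close> had no copy in \<open>G\<close>, the sentence denying its
    diagram would hold in \<open>G\<close> and hence in \<open>M\<close>.\<close>
  have pull: "\<exists>w. embeds w A G"
    if A: "finite (universe A)" "is_struct ar A" and v: "embeds v A M"
    for A :: "('e, nat) struct" and v
  proof (rule ccontr)
    assume none: "\<not> ?thesis"
    obtain l where l: "set l = universe A" using finite_list[OF A(1)] by blast
    let ?\<phi> = "Neg (ex_list l (diagram ar A))"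
    have "?\<phi> \<in> sentences ar"
      using diagram_props[OF A(1), of ar]
      by (auto simp: sentences_def free_vars_ex_list wf_ex_list l)
    moreover have "holds_in G ?\<phi>"
      unfolding holds_in_def sat.simps sat_ex_list l
      using none sat_diagram[OF A Gs] by (metis image_subsetI)
    ultimately have "holds_in M ?\<phi>" by (rule th)
    then have "\<not> sat M v (ex_list l (diagram ar A))" by (simp add: holds_in_def)
    moreover have "v ` universe A \<subseteq> universe M" using v by (simp add: embeds_def)
    then have "sat M v (ex_list l (diagram ar A))"
      unfolding sat_ex_list l using sat_diagram[OF A M] v by (intro exI[of _ v]) auto
    ultimately show False by simp
  qed
  have loc: "hypergraph ar (induced M X) \<and> 0 \<le> predim M X"
    if X: "finite X" "X \<subseteq> universe M" for X
  proof -
    obtain h :: "'a \<Rightarrow> nat" where h: "inj_on h X" using finite_imp_inj_to_nat_seg[OF X(1)] by blast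
    let ?A = "image_struct h (induced M X)"
    have s: "is_struct ar (induced M X)" using is_struct_induced[OF M] .
    have e: "embeds h (induced M X) ?A" using embeds_image_struct[OF _ s] h by simp
    have sA: "is_struct ar ?A" using is_struct_image_struct[OF s] .
    have "induced ?A (h ` X) = ?A" using induced_universe[OF sA] by simp
    then have "embeds (inv_into X h) ?A (induced M X)" using embeds_inverse[OF e] by simp
    then have "embeds (inv_into X h) ?A M" using embeds_from_induced X(2) by blast
    then obtain w where w: "embeds w ?A G" using pull[OF _ sA] X(1) by auto
    have hA: "hypergraph ar ?A"
      using embeds_is_struct_hypergraph[OF w sA model_hypergraph[OF G]] .
    have p: "predim G (w ` h ` X) = predim M X"
      using predim_embeds[OF w, of "h ` X"] predim_embeds[OF e, of X]
      by (simp add: predim_induced)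
    have "w ` h ` X \<subseteq> universe G" using w by (simp add: embeds_def)
    then have "0 \<le> predim G (w ` h ` X)" using X(1) by (intro model_nonneg[OF G]) auto
    then show ?thesis using embeds_is_struct_hypergraph[OF e s hA] p by simp
  qed
  have hyp: "hypergraph ar M" using hypergraph_locally[OF M] loc by blast
  have "\<exists>g. embeds g B M \<and> (\<forall>x \<in> X. g x = f x)"
    if B: "B \<in> K_\<alpha> ar \<alpha>" and X: "strong_in B X" and f: "embeds f (induced B X) M"
    for B :: "('e, nat) struct" and X f
  proof -
    have Bs: "finite (universe B)" "is_struct ar B"
      using B hypergraph_is_struct by (auto simp: K_\<alpha>_iff)
    have Xs: "finite X" "X \<subseteq> universe B" using X by (simp_all add: strong_in_def)
    have As: "finite (universe (induced B X))" "is_struct ar (induced B X)"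
      using Xs is_struct_induced[OF Bs(2)] by simp_all
    obtain l where l: "set l = X" using finite_list[OF Xs(1)] by blast
    obtain r where r: "set r = universe B - X" using finite_list[of "universe B - X"] Bs(1) by auto
    let ?d = "diagram ar (induced B X)" and ?e = "ex_list r (diagram ar B)"
    let ?\<phi> = "Neg (ex_list l (Conj ?d (Neg ?e)))"
    have ext: "sat N v ?e \<longleftrightarrow> (\<exists>g. embeds g B N \<and> (\<forall>x. x \<notin> universe B - X \<longrightarrow> g x = v x))"
      if N: "is_struct ar N" and v: "v ` X \<subseteq> universe N" for N :: "('e, 'c) struct" and v
    proof -
      have into: "w ` universe B \<subseteq> universe N"
        if "\<forall>i. i \<notin> universe B - X \<longrightarrow> w i = v i" "\<forall>i \<in> universe B - X. w i \<in> universe N" for w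
      proof
        fix y assume "y \<in> w ` universe B"
        then obtain x where "x \<in> universe B" "y = w x" by blast
        then show "y \<in> universe N" using that v by (cases "x \<in> X") auto
      qed
      show ?thesis
      proof
        assume "sat N v ?e"
        then obtain w where w: "\<forall>i. i \<notin> universe B - X \<longrightarrow> w i = v i"
          "\<forall>i \<in> universe B - X. w i \<in> universe N" "sat N w (diagram ar B)"
          unfolding sat_ex_list r by blast
        then have "embeds w B N" using sat_diagram[OF Bs N into[OF w(1,2)]] by simp
        then show "\<exists>g. embeds g B N \<and> (\<forall>x. x \<notin> universe B - X \<longrightarrow> g x = v x)" using w(1) by blast
      next
        assume "\<exists>g. embeds g B N \<and> (\<forall>x. x \<notin> universe B - X \<longrightarrow> g x = v x)"
        then obtain g where g: "embeds g B N" "\<forall>x. x \<notin> universe B - X \<longrightarrow> g x = v x" by blast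
        then have sub: "g ` universe B \<subseteq> universe N" by (simp add: embeds_def)
        then have "sat N g (diagram ar B)" using sat_diagram[OF Bs N] g(1) by simp
        moreover have "\<forall>i \<in> universe B - X. g i \<in> universe N" using sub by blast
        ultimately show "sat N v ?e" unfolding sat_ex_list r using g(2) by blast
      qed
    qed
    have "?\<phi> \<in> sentences ar"
      using diagram_props[OF As(1), of ar] diagram_props[OF Bs(1), of ar]
      by (auto simp: sentences_def free_vars_ex_list wf_ex_list l r)
    moreover have "holds_in G ?\<phi>"
      unfolding holds_in_def
    proof
      fix v
      have "sat G w ?e" if w: "\<forall>i \<in> X. w i \<in> universe G" "sat G w ?d" for w
      proof -
        have wX: "w ` X \<subseteq> universe G" using w(1) by auto
        then have "embeds w (induced B X) G" using sat_diagram[OF As Gs] w(2) by simp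
        then obtain g where g: "embeds g B G" "\<forall>x \<in> X. g x = w x"
          using model_extension[OF G B X] by blast
        \<comment> \<open>The quantifier block \<open>r\<close> leaves the valuation unchanged
          outside \<open>universe B - X\<close>, so \<open>g\<close> is corrected to agree with
          \<open>w\<close> off \<open>B\<close>.\<close>
        let ?g = "\<lambda>x. if x \<in> universe B then g x else w x"
        have "embeds ?g B G" by (rule embeds_cong[OF g(1)]) simp
        moreover have "?g x = w x" if "x \<notin> universe B - X" for x using that g(2) by simp
        ultimately show ?thesis using ext[OF Gs wX] by blast
      qed
      then show "sat G v ?\<phi>" unfolding sat.simps sat_ex_list[of G _ l] l by blast
    qed
    ultimately have "holds_in M ?\<phi>" by (rule th)
    then have nf: "\<not> sat M f (ex_list l (Conj ?d (Neg ?e)))" by (simp add: holds_in_def)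
    have fX: "f ` X \<subseteq> universe M" using f by (simp add: embeds_def)
    then have "sat M f ?d" using sat_diagram[OF As M] f by simp
    then have "sat M f ?e" using nf fX unfolding sat_ex_list[of M f l] sat.simps l by blast
    then obtain g where g: "embeds g B M" "\<forall>x. x \<notin> universe B - X \<longrightarrow> g x = f x"
      using ext[OF M fX] by blast
    then show ?thesis by blast
  qed
  then show ?thesis using hyp loc unfolding model_def by blast
qed

text \<open>Genericity concerns strong substructures of \<open>G\<close>, whereas the image of
  \<open>f\<close> may be far from strong. It is therefore closed off to a strong \<open>C\<close>,
  the structure \<open>B\<close> is freely amalgamated with \<open>C\<close>, and the amalgam is
  realised over \<open>C\<close>.\<close>

lemma generic_model:
  fixes G :: "('e, nat) struct"
  assumes "is_generic ar \<alpha> G"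
  shows "model G"
proof -
  from assms have Gs: "is_struct ar G"
    and age: "\<And>A. finite (universe A) \<Longrightarrow> substruct A G \<Longrightarrow> A \<in> K_\<alpha> ar \<alpha>"
    and ext: "\<And>A B. A \<in> K_\<alpha> ar \<alpha> \<Longrightarrow> B \<in> K_\<alpha> ar \<alpha> \<Longrightarrow> strong_fin \<alpha> A B \<Longrightarrow> strong \<alpha> A G \<Longrightarrow>
        \<exists>B'. strong \<alpha> B' G \<and> isomorphic_over A B B'"
    unfolding is_generic_def generic_wrt_def by blast+
  have loc: "induced G X \<in> K_\<alpha> ar \<alpha>" if "finite X" "X \<subseteq> universe G" for X
    using that by (intro age) (auto intro: substruct_induced)
  have hyp: "hypergraph ar G"
    using hypergraph_locally[OF Gs] loc by (auto simp: K_\<alpha>_iff)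
  have nonneg: "0 \<le> predim G X" if "finite X" "X \<subseteq> universe G" for X
    using loc[OF that] predim_induced[of X X G] by (auto simp: K_\<alpha>_iff)
  have "\<exists>g. embeds g B G \<and> (\<forall>x \<in> X. g x = f x)"
    if B: "B \<in> K_\<alpha> ar \<alpha>" and X: "strong_in B X" and f: "embeds f (induced B X) G"
    for B :: "('e, nat) struct" and X f
  proof -
    have Bs: "hypergraph ar B" "finite (universe B)" using B by (auto simp: K_\<alpha>_iff)
    have "finite (f ` X)" "f ` X \<subseteq> universe G"
      using X f by (auto simp: strong_in_def embeds_def)
    then obtain C where C: "f ` X \<subseteq> C" "strong_in G C"
      using closure_exists[OF nonneg, of "f ` X"] by auto
    have Cs: "finite C" "C \<subseteq> universe G" using C(2) by (simp_all add: strong_in_def)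
    have CK: "induced G C \<in> K_\<alpha> ar \<alpha>" using loc[OF Cs] .
    then have Ch: "hypergraph ar (induced G C)" "finite (universe (induced G C))"
      by (auto simp: K_\<alpha>_iff)
    have "embeds f (induced B X) (induced G C)" using embeds_into_induced[OF f] C(1) by simp
    then obtain D g where D: "hypergraph ar D" "finite (universe D)" "substruct (induced G C) D"
      "strong_in D (universe (induced G C))" and g: "embeds g B D" "\<forall>x \<in> X. g x = f x"
      using free_amalgam[OF Ch Bs X _ order_refl] by blast
    have DK: "D \<in> K_\<alpha> ar \<alpha>" using K_\<alpha>_strong_extension[OF CK D] .
    have "strong_fin \<alpha> (induced G C) D" using D by (simp add: strong_fin_iff)
    moreover have "strong \<alpha> (induced G C) G"
      using C(2) Cs by (simp add: strong_iff substruct_induced)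
    ultimately obtain D' k where D': "strong \<alpha> D' G" "iso_via k D D'" "\<forall>x \<in> C. k x = x"
      using ext[OF CK DK] unfolding isomorphic_over_def by auto
    have "embeds k D D'" using D'(2) by (simp add: iso_via_iff_embeds)
    then have "embeds k D G" using embeds_into_super D'(1) unfolding strong_iff by blast
    then have "embeds (k \<circ> g) B G" using embeds_comp[OF g(1)] by blast
    moreover have "(k \<circ> g) x = f x" if "x \<in> X" for x using that g(2) D'(3) C(1) by auto
    ultimately show ?thesis by blast
  qed
  then show ?thesis using hyp nonneg unfolding model_def by blast
qed

section \<open>Models as unions of strong chains\<close>

lemma edgeless:
  assumes "finite U"
  shows "of_edges U (\<lambda>_. {}) \<in> K_\<alpha> ar \<alpha>" "predim (of_edges U (\<lambda>_. {})) X = of_nat (card X)"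
proof -
  have "edges (of_edges U (\<lambda>_. {})) E = {}" for E :: 'e by (subst edges_of_edges) auto
  then show p: "predim (of_edges U (\<lambda>_. {})) X = of_nat (card X)" for X :: "'a set"
    by (simp add: predim_def edges_in_def)
  have "hypergraph ar (of_edges U (\<lambda>_. {}))" by (rule hypergraph_of_edges) simp
  then show "of_edges U (\<lambda>_. {}) \<in> K_\<alpha> ar \<alpha>" using assms by (simp add: K_\<alpha>_iff p)
qed

lemma finite_subset_UN_mono:
  fixes X :: "nat \<Rightarrow> 'a set"
  assumes "finite Z" "Z \<subseteq> (\<Union>i. X i)" and mono: "\<And>i j. i \<le> j \<Longrightarrow> X i \<subseteq> X j"
  shows "\<exists>i. Z \<subseteq> X i"
  using assms(1,2)
proof (induction Z)
  case (insert z Z)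
  then obtain i j where "Z \<subseteq> X i" "z \<in> X j" by auto
  then show ?case using mono[of i "max i j"] mono[of j "max i j"]
    by (intro exI[of _ "max i j"]) auto
qed simp

text \<open>A chain that meets every extension task. \<open>P i\<close> is what stage
  \<open>i\<close> has to satisfy; different choices of it produce models of different
  dimension.\<close>

lemma chain_model_exists:
  fixes P :: "nat \<Rightarrow> ('e, nat) struct \<Rightarrow> bool"
  assumes base: "\<exists>A. P 0 A" and K: "\<And>i A. P i A \<Longrightarrow> A \<in> K_\<alpha> ar \<alpha>"
    and step: "\<And>i C (B :: ('e, nat) struct) X f. P i C \<Longrightarrow> B \<in> K_\<alpha> ar \<alpha> \<Longrightarrow> strong_in B X \<Longrightarrow>
      embeds f (induced B X) C \<Longrightarrow>
      \<exists>D g. P (Suc i) D \<and> substruct C D \<and> strong_in D (universe C) \<and>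
        embeds g B D \<and> (\<forall>x \<in> X. g x = f x)"
  shows "\<exists>M A. model M \<and> universe M = (\<Union>i. universe (A i)) \<and>
    (\<forall>i. P i (A i) \<and> substruct (A i) M \<and> strong_in M (universe (A i)) \<and>
       universe (A i) \<subseteq> universe (A (Suc i)))"
proof -
  \<comment> \<open>A task is a strong pair together with a map into \<open>nat\<close>. Only the
    values on the finite set \<open>X\<close> matter, so a list codes the map, and the tasks are
    countable.\<close>
  define T where "T = {(B, X, fs) |B X (fs :: nat list). B \<in> (K_\<alpha> ar \<alpha> :: ('e, nat) struct set) \<and>
      strong_in B X}"
  have "countable (({A :: ('e, nat) struct. hypergraph ar A \<and> finite (universe A)}) \<times>
      ({X :: nat set. finite X} \<times> (UNIV :: nat list set)))"
    by (intro countable_SIGMA countable_hypergraphs countable_Collect_finite countableI_type)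
  then have T_countable: "countable T"
    by (rule countable_subset[rotated]) (auto simp: T_def K_\<alpha>_iff strong_in_def)
  define E0 :: "('e, nat) struct" where "E0 = of_edges {} (\<lambda>_. {})"
  have E0: "E0 \<in> K_\<alpha> ar \<alpha>" "strong_in E0 {}"
    using edgeless(1)[of "{}"] by (simp_all add: E0_def strong_in_def)
  then have T_ne: "T \<noteq> {}" unfolding T_def by blast
  \<comment> \<open>Only the first component of the decoded \<open>n\<close> names a task, so every
    task recurs at arbitrarily late stages.\<close>
  define Q where "Q n C D \<longleftrightarrow> substruct C D \<and> strong_in D (universe C) \<and>
      (\<forall>B X fs. from_nat_into T (fst (prod_decode n)) = (B, X, fs) \<longrightarrow>
        embeds (\<lambda>x. fs ! x) (induced B X) C \<longrightarrow>
        (\<exists>g. embeds g B D \<and> (\<forall>x \<in> X. g x = fs ! x)))" for n and C D :: "('e, nat) struct"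
  have "\<exists>D. P (Suc n) D \<and> Q n C D" if C: "P n C" for n C
  proof -
    obtain B X fs where t: "from_nat_into T (fst (prod_decode n)) = (B, X, fs)"
      by (metis prod_cases3)
    then have BX: "B \<in> K_\<alpha> ar \<alpha>" "strong_in B X"
      using from_nat_into[OF T_ne, of "fst (prod_decode n)"] by (auto simp: T_def)
    show ?thesis
    proof (cases "embeds (\<lambda>x. fs ! x) (induced B X) C")
      case True
      then show ?thesis using step[OF C BX True] t unfolding Q_def by auto
    next
      case False
      \<comment> \<open>A task that does not apply at this stage is replaced by the empty one, so
        that the chain still reaches \<open>P (Suc n)\<close>.\<close>
      have "embeds (\<lambda>x. x) (induced E0 {}) C"
        using E0(1) K[OF C] by (intro embeds_empty) (simp_all add: K_\<alpha>_iff)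
      then show ?thesis using step[OF C E0] t False unfolding Q_def by fastforce
    qed
  qed
  then obtain A where A: "\<And>n. P n (A n)" and AQ: "\<And>n. Q n (A n) (A (Suc n))"
    using dependent_nat_choice[of P Q] base by blast
  let ?U = "\<lambda>i. universe (A i)"
  have AK: "A n \<in> K_\<alpha> ar \<alpha>" for n using K[OF A] .
  then have fin: "finite (?U n)" and Ah: "hypergraph ar (A n)" for n by (simp_all add: K_\<alpha>_iff)
  have sub_le: "substruct (A i) (A j) \<and> strong_in (A j) (?U i)" if "i \<le> j" for i j
    using that
  proof (induction rule: dec_induct)
    case base
    then show ?case using substruct_refl[OF hypergraph_is_struct[OF Ah]] strong_in_universe[OF fin] by blast
  next
    case (step j)
    have "substruct (A j) (A (Suc j))" "strong_in (A (Suc j)) (?U j)"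
      using AQ[of j] by (simp_all add: Q_def)
    then show ?case using step.IH strong_in_trans[of "A (Suc j)" "A j"] substruct_trans by blast
  qed
  have U_mono: "?U i \<subseteq> ?U j" if "i \<le> j" for i j using sub_le[OF that] by (simp add: substruct_iff)
  define M where "M = chain_union A"
  have UM: "universe M = (\<Union>i. ?U i)" and IM: "interp M E = (\<Union>i. interp (A i) E)" for E
    by (simp_all add: M_def chain_union_def)
  have subM: "substruct (A i) M" for i
  proof -
    have "xs \<in> interp (A i) E" if xs: "xs \<in> interp (A j) E" "set xs \<subseteq> ?U i" for xs E j
    proof -
      have "xs \<in> interp (A (max i j)) E"
        using sub_le[of j "max i j"] xs(1) unfolding substruct_def by auto
      then show ?thesis using sub_le[of i "max i j"] xs(2) unfolding substruct_def by auto
    qed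
    moreover have "set xs \<subseteq> ?U i" if "xs \<in> interp (A i) E" for xs E
      using hypergraphD(3)[OF Ah that] .
    ultimately show ?thesis unfolding substruct_def UM IM by blast
  qed
  have cover: "\<exists>i \<ge> n. X \<subseteq> ?U i" if Xf: "finite X" "X \<subseteq> universe M" for X n
  proof -
    obtain i where "X \<subseteq> ?U i"
      using finite_subset_UN_mono[OF Xf(1), of ?U] Xf(2) UM U_mono by blast
    then show ?thesis using U_mono[of i "max i n"] by (intro exI[of _ "max i n"]) auto
  qed
  have strM: "strong_in M (?U i)" for i
    unfolding strong_in_def
  proof (intro conjI allI impI)
    fix Y assume Y: "finite Y \<and> ?U i \<subseteq> Y \<and> Y \<subseteq> universe M"
    then obtain j where j: "j \<ge> i" "Y \<subseteq> ?U j" using cover[of Y i] by auto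
    have "predim (A j) (?U i) \<le> predim (A j) Y"
      using sub_le[OF j(1)] strong_in_le Y j(2) by blast
    then show "predim M (?U i) \<le> predim M Y"
      using predim_substruct[OF subM[of j]] U_mono[OF j(1)] j(2) by metis
  qed (use fin UM in auto)
  have loc: "\<exists>i. X \<subseteq> ?U i \<and> induced M X = induced (A i) X" if "finite X" "X \<subseteq> universe M" for X
    using cover[OF that, of 0] induced_substruct[OF subM] by metis
  have "is_struct ar M"
    unfolding is_struct_def
  proof (intro allI ballI)
    fix E xs assume "xs \<in> interp M E"
    then obtain i where "xs \<in> interp (A i) E" unfolding IM by blast
    from hypergraphD(2,3)[OF Ah this]
    show "length xs = ar E \<and> set xs \<subseteq> universe M" unfolding UM by blast
  qed
  then have hyp: "hypergraph ar M"
  proof (rule hypergraph_locally)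
    fix X assume "finite X" "X \<subseteq> universe M"
    then obtain i where "induced M X = induced (A i) X" using loc by blast
    then show "hypergraph ar (induced M X)" using hypergraph_induced[OF Ah] by simp
  qed
  have nonneg: "0 \<le> predim M X" if X: "finite X" "X \<subseteq> universe M" for X
  proof -
    obtain i where i: "X \<subseteq> ?U i" using cover[OF X, of 0] by blast
    then have "0 \<le> predim (A i) X" using AK[of i] unfolding K_\<alpha>_iff by blast
    then show ?thesis using predim_substruct[OF subM i] by simp
  qed
  have "\<exists>g. embeds g B M \<and> (\<forall>x \<in> X. g x = f x)"
    if B: "B \<in> K_\<alpha> ar \<alpha>" and X: "strong_in B X" and f: "embeds f (induced B X) M"
    for B :: "('e, nat) struct" and X f
  proof -
    have Xf: "finite X" using X by (simp add: strong_in_def)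
    then obtain b where b: "X \<subseteq> {..<b}" using finite_nat_bounded by blast
    define fs where "fs = map f [0..<b]"
    have fs: "fs ! x = f x" if "x \<in> X" for x using that b by (auto simp: fs_def)
    have fX: "finite (f ` X)" "f ` X \<subseteq> universe M" using Xf f by (auto simp: embeds_def)
    obtain i where i: "f ` X \<subseteq> ?U i" using cover[OF fX, of 0] by blast
    have "(B, X, fs) \<in> T" using B X by (simp add: T_def)
    then obtain t where t: "from_nat_into T t = (B, X, fs)"
      using from_nat_into_surj[OF T_countable] by metis
    \<comment> \<open>The task is handled at a stage not before \<open>i\<close>, when the image of
      \<open>f\<close> is already present.\<close>
    define n where "n = prod_encode (t, i)"
    have "f ` X \<subseteq> ?U n" using i U_mono[of i n] le_prod_encode_2[of i t] by (auto simp: n_def)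
    then have "embeds f (induced B X) (induced M (?U n))" using embeds_into_induced[OF f] by simp
    moreover have "induced M (?U n) = A n" using subM[of n] by (simp add: substruct_iff)
    ultimately have "embeds (\<lambda>x. fs ! x) (induced B X) (A n)"
      using fs by (auto intro: embeds_cong)
    then obtain g where g: "embeds g B (A (Suc n))" "\<forall>x \<in> X. g x = fs ! x"
      using AQ[of n] t unfolding Q_def n_def by auto
    then show ?thesis using embeds_into_super[OF g(1) subM] fs by auto
  qed
  then have "model M" using hyp nonneg unfolding model_def by blast
  then show ?thesis using UM A subM strM U_mono by (intro exI[of _ M] exI[of _ A]) auto
qed

text \<open>Start with \<open>n\<close> isolated points and extend by level amalgams, so every stage
  has predimension \<open>n\<close>. Every strong set lies in some stage, which bounds its
  predimension.\<close>

lemma level_model_exists: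
  "\<exists>M :: ('e, nat) struct. model M \<and> (\<exists>X. strong_in M X \<and> predim M X = of_nat n) \<and>
     (\<forall>X. strong_in M X \<longrightarrow> predim M X \<le> of_nat n)"
proof -
  let ?P = "\<lambda>(i :: nat) (C :: ('e, nat) struct). C \<in> K_\<alpha> ar \<alpha> \<and> predim C (universe C) = of_nat n"
  have "\<exists>M A. model M \<and> universe M = (\<Union>i. universe (A i)) \<and>
    (\<forall>i. ?P i (A i) \<and> substruct (A i) M \<and> strong_in M (universe (A i)) \<and>
       universe (A i) \<subseteq> universe (A (Suc i)))"
  proof (rule chain_model_exists)
    show "\<exists>A. ?P 0 A"
      using edgeless[of "{..<n}"] by (intro exI[of _ "of_edges {..<n} (\<lambda>_. {})"]) simp
    fix i :: nat and C B :: "('e, nat) struct" and X f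
    assume C: "?P i C" and B: "B \<in> K_\<alpha> ar \<alpha>" and X: "strong_in B X"
      and f: "embeds f (induced B X) C"
    have BL: "B \<in> K_L ar" using B by (simp add: K_\<alpha>_iff K_L_iff)
    let ?s = "max (card (universe C)) (card (universe B))"
    have "card (universe C) \<le> ?s" "card (universe B) \<le> ?s" by simp_all
    then obtain D g where "level_amalgam 0 C B X f D g"
      using level_amalgam_exists[of ?s 0] C BL X f by meson
    then show "\<exists>D g. ?P (Suc i) D \<and> substruct C D \<and> strong_in D (universe C) \<and>
        embeds g B D \<and> (\<forall>x \<in> X. g x = f x)"
      using C by (intro exI[of _ D] exI[of _ g]) (simp add: level_amalgam_def)
  qed auto
  then obtain M A where M: "model M" "universe M = (\<Union>i. universe (A i))"
    and all: "\<forall>i. ?P i (A i) \<and> substruct (A i) M \<and> strong_in M (universe (A i)) \<and>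
       universe (A i) \<subseteq> universe (A (Suc i))" by (elim exE conjE)
  from all have A: "\<And>i. ?P i (A i)" "\<And>i. substruct (A i) M"
    "\<And>i. strong_in M (universe (A i))" "\<And>i. universe (A i) \<subseteq> universe (A (Suc i))"
    by simp_all
  have top: "predim M (universe (A i)) = of_nat n" for i
    using A(1)[of i] predim_substruct[OF A(2)[of i], of "universe (A i)"] by simp
  have "predim M X \<le> of_nat n" if X: "strong_in M X" for X
  proof -
    have mono: "universe (A i) \<subseteq> universe (A j)" if "i \<le> j" for i j
      using that A(4) by (rule lift_Suc_mono_le[rotated])
    have "finite X" "X \<subseteq> (\<Union>i. universe (A i))" using X M(2) by (auto simp: strong_in_def)
    then obtain i where i: "X \<subseteq> universe (A i)"
      using finite_subset_UN_mono[of X "\<lambda>i. universe (A i)"] mono by blast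
    then show ?thesis
      using strong_in_le[OF X _ i] A(3)[of i] top[of i] by (simp add: strong_in_def)
  qed
  then show ?thesis using M(1) A(3) top by blast
qed

text \<open>Free amalgams with one extra isolated point raise the predimension by at least
  \<open>1\<close> at every stage.\<close>

lemma unbounded_model_exists:
  "\<exists>M :: ('e, nat) struct. model M \<and> (\<forall>n. \<exists>X. strong_in M X \<and> of_nat n \<le> predim M X)"
proof -
  let ?P = "\<lambda>(i :: nat) (C :: ('e, nat) struct). C \<in> K_\<alpha> ar \<alpha> \<and> of_nat i \<le> predim C (universe C)"
  have "\<exists>M A. model M \<and> universe M = (\<Union>i. universe (A i)) \<and>
    (\<forall>i. ?P i (A i) \<and> substruct (A i) M \<and> strong_in M (universe (A i)) \<and>
       universe (A i) \<subseteq> universe (A (Suc i)))"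
  proof (rule chain_model_exists)
    show "\<exists>A. ?P 0 A"
      using edgeless[of "{} :: nat set"] by (intro exI[of _ "of_edges {} (\<lambda>_. {})"]) simp
    fix i :: nat and C B :: "('e, nat) struct" and X f
    assume C: "?P i C" and B: "B \<in> K_\<alpha> ar \<alpha>" and X: "strong_in B X"
      and f: "embeds f (induced B X) C"
    have Bs: "hypergraph ar B" "finite (universe B)" using B by (simp_all add: K_\<alpha>_iff)
    have Cs: "hypergraph ar C" "finite (universe C)" using C by (simp_all add: K_\<alpha>_iff)
    let ?S = "card (universe C) + card (universe B) + 1"
    have "card (universe C) + card (universe B) \<le> ?S" by simp
    then obtain D g where D: "hypergraph ar D" "finite (universe D)" "substruct C D"
      "strong_in D (universe C)" and g: "embeds g B D" "\<forall>x \<in> X. g x = f x"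
      and p: "predim C (universe C) + of_nat (?S - (card (universe C) + card (universe B)))
        \<le> predim D (universe D)"
      using free_amalgam[OF Cs Bs X f] by blast
    have "D \<in> K_\<alpha> ar \<alpha>" using K_\<alpha>_strong_extension[OF _ D] C by blast
    then show "\<exists>D g. ?P (Suc i) D \<and> substruct C D \<and> strong_in D (universe C) \<and>
        embeds g B D \<and> (\<forall>x \<in> X. g x = f x)"
      using D g p C by (intro exI[of _ D] exI[of _ g]) auto
  qed auto
  then obtain M A where M: "model M"
    and all: "\<forall>i. ?P i (A i) \<and> substruct (A i) M \<and> strong_in M (universe (A i)) \<and>
       universe (A i) \<subseteq> universe (A (Suc i))" by (elim exE conjE)
  from all have A: "\<And>i. ?P i (A i)" "\<And>i. substruct (A i) M"
    "\<And>i. strong_in M (universe (A i))"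
    by simp_all
  have "of_nat n \<le> predim M (universe (A n))" for n
    using A(1)[of n] predim_substruct[OF A(2)[of n], of "universe (A n)"] by simp
  then show ?thesis using M A(3) by blast
qed


section \<open>Dimension\<close>

lemma strong_subsets_empty_struct:
  assumes M: "model M"
  shows "{\<delta>_rel \<alpha> B empty_struct | B. finite (universe B) \<and> strong_fin \<alpha> empty_struct B \<and> strong \<alpha> B M} =
    {predim M X | X. strong_in M X}" (is "?V = ?W")
proof -
  have z: "\<delta> \<alpha> (empty_struct :: ('e, 'a) struct) = 0"
    by (simp add: \<delta>_def empty_struct_def num_edges_def)
  show ?thesis
  proof
    show "?V \<subseteq> ?W"
      using z by (auto simp: \<delta>_rel_def strong_iff \<delta>_substruct)
    show "?W \<subseteq> ?V"
    proof
      fix v assume "v \<in> ?W"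
      then obtain X where X: "v = predim M X" "strong_in M X" by blast
      have Xs: "finite X" "X \<subseteq> universe M" using X(2) by (simp_all add: strong_in_def)
      have sub: "substruct (induced M X) M" using substruct_induced[OF Xs(2)] .
      have K: "induced M X \<in> K_\<alpha> ar \<alpha>" using model_induced_K_\<alpha>[OF M Xs] .
      have "[] \<notin> interp M E" for E
        using hypergraphD(2)[OF model_hypergraph[OF M], of "[]" E] ar_ge_2[of E] by auto
      then have "substruct empty_struct (induced M X)"
        by (auto simp: substruct_def empty_struct_def)
      moreover have "strong_in (induced M X) {}"
        using strong_in_substruct[OF model_empty_strong[OF M] sub] by simp
      ultimately have "strong_fin \<alpha> empty_struct (induced M X)"
        using Xs(1) by (simp add: strong_fin_iff) (simp add: empty_struct_def)
      moreover have "strong \<alpha> (induced M X) M" using sub X(2) by (simp add: strong_iff)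
      moreover have "v = \<delta>_rel \<alpha> (induced M X) empty_struct"
        using z X(1) by (simp add: \<delta>_rel_def \<delta>_substruct[OF sub])
      ultimately show "v \<in> ?V" using Xs(1) by (intro CollectI exI[of _ "induced M X"]) auto
    qed
  qed
qed

text \<open>The predimensions of strong sets lie on the grid, so a bounded family of them attains
  its maximum, and the \<open>GREATEST\<close> in the definition of dimension denotes it.\<close>

lemma dimension_cases:
  assumes M: "model M"
  obtains X where "strong_in M X" "\<And>Y. strong_in M Y \<Longrightarrow> predim M Y \<le> predim M X"
      "dimension \<alpha> M = Fin (predim M X)"
  | "\<And>r. \<exists>X. strong_in M X \<and> r < predim M X" "dimension \<alpha> M = \<infinity>"
proof -
  let ?V = "{predim M X | X. strong_in M X}"
  have dim: "dimension \<alpha> M = (if bdd_above ?V then Fin (GREATEST v. v \<in> ?V) else \<infinity>)"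
    using strong_subsets_empty_struct[OF M] by (simp add: dimension_def dimension_over_def)
  show thesis
  proof (cases "bdd_above ?V")
    case False
    then have "\<exists>X. strong_in M X \<and> r < predim M X" for r
      unfolding bdd_above_def by (force simp: not_le)
    then show thesis using that(2) False dim by simp
  next
    case True
    then obtain u where u: "\<And>X. strong_in M X \<Longrightarrow> predim M X \<le> u"
      unfolding bdd_above_def by blast
    let ?f = "\<lambda>X. nat \<lfloor>predim M X * c\<rfloor>"
    have "?f X \<le> nat \<lfloor>u * c\<rfloor>" if "strong_in M X" for X
      using u[OF that] c_pos by (intro nat_mono floor_mono mult_right_mono) auto
    then obtain X where X: "strong_in M X" "\<And>Y. strong_in M Y \<Longrightarrow> ?f Y \<le> ?f X"
      using ex_has_greatest_nat[of "strong_in M" "{}" ?f "Suc (nat \<lfloor>u * c\<rfloor>)"] model_empty_strong[OF M]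
      by (auto simp: less_Suc_eq_le)
    have max: "predim M Y \<le> predim M X" if Y: "strong_in M Y" for Y
    proof -
      have "0 \<le> predim M X * c"
        using model_nonneg[OF M, of X] X(1) c_pos by (simp add: strong_in_def)
      then have "\<lfloor>predim M Y * c\<rfloor> \<le> \<lfloor>predim M X * c\<rfloor>"
        using X(2)[OF Y] by (simp add: nat_le_eq_zle)
      then have "predim M Y * c \<le> predim M X * c"
        using predim_grid[of M X] predim_grid[of M Y] by (auto elim!: Ints_cases)
      then show ?thesis using c_pos by simp
    qed
    have "(GREATEST v. v \<in> ?V) = predim M X"
      using X(1) max by (intro Greatest_equality) auto
    then show thesis using that(1)[OF X(1) max] True dim by simp
  qed
qed

lemma dimension_infinite_iff:
  assumes "model M"
  shows "dimension \<alpha> M = \<infinity> \<longleftrightarrow> (\<forall>r. \<exists>X. strong_in M X \<and> r < predim M X)"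
  using assms by (rule dimension_cases) (auto simp: not_le[symmetric])

lemma dimension_FinD:
  assumes "model M" "dimension \<alpha> M = Fin d"
  shows "\<exists>X. strong_in M X \<and> predim M X = d" "strong_in M Y \<Longrightarrow> predim M Y \<le> d"
  by (rule dimension_cases[OF assms(1)]; use assms(2) in auto)+

lemma dimension_FinI:
  assumes "model M" "strong_in M X" "\<And>Y. strong_in M Y \<Longrightarrow> predim M Y \<le> predim M X"
  shows "dimension \<alpha> M = Fin (predim M X)"
  using assms(1)
proof (rule dimension_cases)
  fix Z assume "strong_in M Z" "\<And>Y. strong_in M Y \<Longrightarrow> predim M Y \<le> predim M Z"
    "dimension \<alpha> M = Fin (predim M Z)"
  then show ?thesis using assms(2,3) by (metis order_antisym)
next
  assume "\<And>r. \<exists>X. strong_in M X \<and> r < predim M X"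
  then show ?thesis using assms(3) by (metis not_le)
qed

text \<open>This is how equality of dimensions enters the back-and-forth argument: it supplies the
  set \<open>C0\<close> for \<open>strong_extension\<close>.\<close>

lemma equal_dimension_cofinal:
  assumes "model M" "model N" "dimension \<alpha> M = dimension \<alpha> N" "strong_in M X"
  shows "\<exists>C. strong_in N C \<and> predim M X \<le> predim N C"
proof (cases "dimension \<alpha> N = \<infinity>")
  case True
  then show ?thesis using dimension_infinite_iff[OF assms(2)] by (meson less_imp_le)
next
  case False
  then obtain d where d: "dimension \<alpha> N = Fin d" using dimension_cases[OF assms(2)] by metis
  then show ?thesis
    using dimension_FinD(1)[OF assms(2) d] dimension_FinD(2)[OF assms(1) _ assms(4)] assms(3) by metis
qed

section \<open>Invariance of dimension under isomorphism\<close>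

lemma iso_via_sym:
  assumes "iso_via f M N" "is_struct ar N"
  shows "iso_via (inv_into (universe M) f) N M"
proof -
  have f: "embeds f M N" "f ` universe M = universe N" using assms(1) by (simp_all add: iso_via_iff_embeds)
  then have "embeds (inv_into (universe M) f) N M"
    using embeds_inverse[OF f(1)] induced_universe[OF assms(2)] by simp
  moreover have "inv_into (universe M) f ` universe N = universe M"
    using f by (metis embeds_def inv_into_image_cancel order_refl)
  ultimately show ?thesis by (simp add: iso_via_iff_embeds)
qed

lemma iso_via_strong:
  assumes "iso_via f M N" "hypergraph ar N" "strong_in M X"
  shows "strong_in N (f ` X)" "predim N (f ` X) = predim M X"
  using assms strong_in_surj[of f M N X] predim_embeds[of f M N X] strong_in_subset[of M X]
  by (auto simp: iso_via_iff_embeds)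

lemma isomorphic_dimension:
  assumes M: "model M" and N: "model N" and iso: "isomorphic M N"
  shows "dimension \<alpha> M = dimension \<alpha> N"
proof -
  obtain f where f: "iso_via f M N" using iso by (auto simp: isomorphic_def)
  let ?g = "inv_into (universe M) f"
  have g: "iso_via ?g N M" using iso_via_sym[OF f hypergraph_is_struct[OF model_hypergraph[OF N]]] .
  note fs = iso_via_strong[OF f model_hypergraph[OF N]] and gs = iso_via_strong[OF g model_hypergraph[OF M]]
  show ?thesis
    using M
  proof (rule dimension_cases)
    fix X assume X: "strong_in M X" "\<And>Y. strong_in M Y \<Longrightarrow> predim M Y \<le> predim M X"
      "dimension \<alpha> M = Fin (predim M X)"
    have "predim N Y \<le> predim N (f ` X)" if "strong_in N Y" for Y
      using X(2)[OF gs(1)[OF that]] gs(2)[OF that] fs(2)[OF X(1)] by simp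
    then show ?thesis using dimension_FinI[OF N fs(1)[OF X(1)]] X(3) fs(2)[OF X(1)] by simp
  next
    assume inf: "\<And>r. \<exists>X. strong_in M X \<and> r < predim M X" and dim: "dimension \<alpha> M = \<infinity>"
    have "\<exists>X. strong_in N X \<and> r < predim N X" for r using inf[of r] fs by metis
    then show ?thesis using dimension_infinite_iff[OF N] dim by simp
  qed
qed

section \<open>Isomorphism of models\<close>

definition partial_iso :: "('e, 'a) struct \<Rightarrow> ('e, 'b) struct \<Rightarrow> 'a set \<times> ('a \<Rightarrow> 'b) \<Rightarrow> bool" where
  "partial_iso M N p \<longleftrightarrow> (\<forall>m. approx_iso m M N (fst p) (snd p))"

lemma partial_iso_iff:
  "partial_iso M N (X, f) \<longleftrightarrow>
     strong_in M X \<and> embeds f (induced M X) N \<and> strong_in N (f ` X)"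
  by (auto simp: partial_iso_def approx_iso_def strong_in_iff_k_strong)

lemma partial_iso_inverse:
  assumes "partial_iso M N (X, f)"
  shows "partial_iso N M (f ` X, inv_into X f)" "inv_into X f ` f ` X = X"
    "\<And>x. x \<in> X \<Longrightarrow> inv_into X f (f x) = x"
  using assms approx_iso_inverse[of _ M N X f] by (simp_all add: partial_iso_def)

lemma partial_iso_forth:
  assumes M: "model M" and N: "model N" and dim: "dimension \<alpha> M = dimension \<alpha> N"
    and p: "partial_iso M N (X, f)" and x: "x \<in> universe M"
  shows "\<exists>Y g. partial_iso M N (Y, g) \<and> X \<subseteq> Y \<and> x \<in> Y \<and> (\<forall>z \<in> X. g z = f z)"
proof -
  have X: "strong_in M X" "embeds f (induced M X) N" "strong_in N (f ` X)"
    using p by (simp_all add: partial_iso_iff)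
  obtain Y where Y: "insert x X \<subseteq> Y" "strong_in M Y"
    using closure_exists[OF model_nonneg[OF M], of "insert x X"] X(1) x by (auto simp: strong_in_def)
  have Ys: "finite Y" "Y \<subseteq> universe M" using Y(2) by (simp_all add: strong_in_def)
  have XY: "X \<subseteq> Y" using Y(1) by simp
  obtain C where C: "strong_in N C" "predim M Y \<le> predim N C"
    using equal_dimension_cofinal[OF M N dim Y(2)] by blast
  have "strong_in (induced M Y) X"
    using strong_in_substruct[OF X(1) substruct_induced[OF Ys(2)]] XY by simp
  moreover have "embeds f (induced (induced M Y) X) N" using X(2) XY by (simp add: induced_induced)
  moreover have "predim (induced M Y) (universe (induced M Y)) \<le> predim N C"
    using C(2) by (simp add: predim_induced)
  ultimately obtain g where "embeds g (induced M Y) N" "\<forall>z \<in> X. g z = f z" "strong_in N (g ` Y)"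
    using strong_extension[OF N model_induced_K_\<alpha>[OF M Ys] _ _ X(3) C(1)] by auto
  then show ?thesis using Y by (intro exI[of _ Y] exI[of _ g]) (simp add: partial_iso_iff)
qed

lemma partial_iso_back:
  assumes M: "model M" and N: "model N" and dim: "dimension \<alpha> M = dimension \<alpha> N"
    and p: "partial_iso M N (X, f)" and y: "y \<in> universe N"
  shows "\<exists>Y g. partial_iso M N (Y, g) \<and> X \<subseteq> Y \<and> y \<in> g ` Y \<and> (\<forall>z \<in> X. g z = f z)"
proof -
  note q = partial_iso_inverse[OF p]
  obtain Y g where Y: "partial_iso N M (Y, g)" "f ` X \<subseteq> Y" "y \<in> Y"
    "\<forall>z \<in> f ` X. g z = inv_into X f z"
    using partial_iso_forth[OF N M dim[symmetric] q(1) y] by (elim exE conjE)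
  note r = partial_iso_inverse[OF Y(1)]
  have z: "z \<in> g ` Y \<and> inv_into Y g z = f z" if "z \<in> X" for z
  proof -
    have "f z \<in> Y" "g (f z) = z" using that Y(2,4) q(3) by auto
    then show ?thesis using r(3) by (metis imageI)
  qed
  then have "X \<subseteq> g ` Y" "\<forall>z \<in> X. inv_into Y g z = f z" by auto
  moreover have "y \<in> inv_into Y g ` g ` Y" using r(2) Y(3) by simp
  ultimately show ?thesis
    using r(1) by (intro exI[of _ "g ` Y"] exI[of _ "inv_into Y g"] conjI)
qed

text \<open>Edgeless structures of every finite size extend the empty structure strongly, hence
  embed into \<open>M\<close>.\<close>

lemma model_infinite:
  fixes M :: "('e, 'a) struct"
  assumes M: "model M"
  shows "infinite (universe M)"
proof
  assume fin: "finite (universe M)"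
  let ?n = "Suc (card (universe M))"
  let ?B = "of_edges {..<?n} (\<lambda>_. {}) :: ('e, nat) struct"
  have B: "?B \<in> K_\<alpha> ar \<alpha>" using edgeless(1)[of "{..<?n}"] by simp
  have "strong_in ?B {}"
    using edgeless(2)[of "{..<?n}"] by (simp add: strong_in_def)
  moreover have "embeds undefined (induced ?B {}) M"
    using B by (intro embeds_empty model_hypergraph[OF M]) (simp add: K_\<alpha>_iff)
  ultimately obtain g where "embeds g ?B M" using model_extension[OF M B] by blast
  then have "inj_on g {..<?n}" "g ` {..<?n} \<subseteq> universe M" by (simp_all add: embeds_def)
  then have "card {..<?n} \<le> card (universe M)" using fin by (rule card_inj_on_le)
  then show False by simp
qed

lemma isomorphic_models:
  fixes M :: "('e, 'a) struct" and N :: "('e, 'b) struct"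
  assumes M: "model M" "countable (universe M)" and N: "model N" "countable (universe N)"
    and dim: "dimension \<alpha> M = dimension \<alpha> N"
  shows "isomorphic M N"
proof -
  have neM: "universe M \<noteq> {}" and neN: "universe N \<noteq> {}"
    using model_infinite[OF M(1)] model_infinite[OF N(1)] by auto
  let ?m = "from_nat_into (universe M)" and ?n = "from_nat_into (universe N)"
  \<comment> \<open>Stage \<open>i\<close> puts the \<open>i\<close>-th element of \<open>M\<close>
    into the domain and the \<open>i\<close>-th element of \<open>N\<close> into the image.\<close>
  define Q where "Q i p q \<longleftrightarrow> fst p \<subseteq> fst q \<and> (\<forall>z \<in> fst p. snd q z = snd p z) \<and>
      ?m i \<in> fst q \<and> ?n i \<in> snd q ` fst q" for i :: nat and p q :: "'a set \<times> ('a \<Rightarrow> 'b)"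
  have "\<exists>q. partial_iso M N q \<and> Q i p q" if p: "partial_iso M N p" for i p
  proof -
    obtain X f where Xf: "p = (X, f)" by fastforce
    obtain Y g where Y: "partial_iso M N (Y, g)" "X \<subseteq> Y" "?m i \<in> Y" "\<forall>z \<in> X. g z = f z"
      using partial_iso_forth[OF M(1) N(1) dim p[unfolded Xf] from_nat_into[OF neM]] by blast
    obtain Z h where Z: "partial_iso M N (Z, h)" "Y \<subseteq> Z" "?n i \<in> h ` Z" "\<forall>z \<in> Y. h z = g z"
      using partial_iso_back[OF M(1) N(1) dim Y(1) from_nat_into[OF neN]] by blast
    have "Q i p (Z, h)" using Y Z unfolding Q_def Xf by auto
    then show ?thesis using Z(1) by blast
  qed
  moreover have "partial_iso M N ({}, undefined)"
    using model_empty_strong[OF M(1)] model_empty_strong[OF N(1)]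
      embeds_empty[OF model_hypergraph[OF M(1)] model_hypergraph[OF N(1)]]
    by (simp add: partial_iso_iff)
  ultimately obtain p where p: "\<And>i. partial_iso M N (p i)" "\<And>i. Q i (p i) (p (Suc i))"
    using dependent_nat_choice[of "\<lambda>_. partial_iso M N" Q] by blast
  define X where "X i = fst (p i)" for i
  define f where "f i = snd (p i)" for i
  have P: "strong_in M (X i)" "embeds (f i) (induced M (X i)) N" for i
    using p(1)[of i] partial_iso_iff[of M N "X i" "f i"] by (simp_all add: X_def f_def)
  have step: "X i \<subseteq> X (Suc i)" "\<forall>z \<in> X i. f (Suc i) z = f i z"
    and mi: "?m i \<in> X (Suc i)" and ni: "?n i \<in> f (Suc i) ` X (Suc i)" for i
    using p(2)[of i] by (simp_all add: Q_def X_def f_def)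
  have mono: "X i \<subseteq> X j \<and> (\<forall>z \<in> X i. f j z = f i z)" if "i \<le> j" for i j
    using that by (induction rule: dec_induct) (use step in \<open>auto, blast\<close>)
  have UX: "universe M = (\<Union>i. X i)"
  proof
    show "universe M \<subseteq> (\<Union>i. X i)"
    proof
      fix x assume "x \<in> universe M"
      then obtain i where "x = ?m i" using from_nat_into_surj[OF M(2)] by metis
      then show "x \<in> (\<Union>i. X i)" using mi by blast
    qed
  qed (use P(1) in \<open>auto simp: strong_in_def\<close>)
  define F where "F x = f (LEAST i. x \<in> X i) x" for x
  have F: "F x = f i x" if "x \<in> X i" for x i
  proof -
    have "(LEAST i. x \<in> X i) \<le> i" "x \<in> X (LEAST i. x \<in> X i)"
      using that by (auto intro: Least_le LeastI)
    then show ?thesis using mono by (metis F_def)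
  qed
  have cover: "\<exists>i. Z \<subseteq> X i" if "finite Z" "Z \<subseteq> universe M" for Z
    by (rule finite_subset_UN_mono[OF that(1)]) (use that(2) mono in \<open>simp_all add: UX\<close>)
  have emb: "embeds F (induced M (X i)) N" for i
    by (rule embeds_cong[OF P(2)[of i]]) (simp add: F)
  have "inj_on F (universe M)"
  proof (rule inj_onI)
    fix x y assume xy: "x \<in> universe M" "y \<in> universe M" "F x = F y"
    then obtain i where "{x, y} \<subseteq> X i" using cover[of "{x, y}"] by auto
    then show "x = y" using emb[of i] xy(3) by (auto simp: embeds_def inj_on_def)
  qed
  moreover have "F ` universe M = universe N"
  proof
    show "F ` universe M \<subseteq> universe N" using emb unfolding UX embeds_def by fastforce
    show "universe N \<subseteq> F ` universe M"
    proof
      fix y assume "y \<in> universe N"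
      then obtain i where "y = ?n i" using from_nat_into_surj[OF N(2)] by metis
      then obtain x where "x \<in> X (Suc i)" "y = f (Suc i) x" using ni by blast
      then have "y = F x" "x \<in> universe M" using F unfolding UX by auto
      then show "y \<in> F ` universe M" by blast
    qed
  qed
  moreover have "xs \<in> interp M E \<longleftrightarrow> map F xs \<in> interp N E" if xs: "set xs \<subseteq> universe M" for xs E
  proof -
    obtain i where i: "set xs \<subseteq> X i" using cover[of "set xs"] xs by auto
    then show ?thesis using emb[of i] unfolding embeds_induced_iff by blast
  qed
  ultimately have "iso_via F M N" by (simp add: iso_via_iff_embeds embeds_def)
  then show ?thesis by (auto simp: isomorphic_def)
qed

section \<open>Generic structures\<close>

text \<open>The condition \<open>cofinal\<close> yields the chain of members of \<open>K\<close>;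
  \<open>bounded\<close> yields the room that \<open>strong_extension\<close> needs to realise
  \<open>B\<close> strongly.\<close>

lemma model_generic_wrt:
  fixes M :: "('e, 'a) struct"
  assumes M: "model M" "countable (universe M)" and K: "K \<subseteq> K_\<alpha> ar \<alpha>"
    and cofinal: "\<And>F. finite F \<Longrightarrow> F \<subseteq> universe M \<Longrightarrow>
      \<exists>X. F \<subseteq> X \<and> strong_in M X \<and> induced M X \<in> K"
    and bounded: "\<And>B. B \<in> K \<Longrightarrow>
      \<exists>C. strong_in M C \<and> predim B (universe B) \<le> predim M C"
  shows "generic_wrt ar \<alpha> K M"
proof -
  have Ms: "is_struct ar M" using hypergraph_is_struct[OF model_hypergraph[OF M(1)]] .
  have age: "A \<in> K_\<alpha> ar \<alpha>" if "finite (universe A)" "substruct A M" for A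
    using model_induced_K_\<alpha>[OF M(1) that(1)] that(2) unfolding substruct_iff by metis
  have "\<exists>A. (\<forall>i. A i \<in> K \<and> strong_fin \<alpha> (A i) (A (Suc i))) \<and> M = chain_union A"
  proof -
    have ne: "universe M \<noteq> {}" using model_infinite[OF M(1)] by auto
    let ?P = "\<lambda>(_ :: nat) X. strong_in M X \<and> induced M X \<in> K"
    let ?Q = "\<lambda>i X Y. X \<subseteq> Y \<and> from_nat_into (universe M) i \<in> Y"
    have step: "\<exists>Y. ?P (Suc i) Y \<and> ?Q i X Y" if X: "?P i X" for i X
      using cofinal[of "insert (from_nat_into (universe M) i) X"] X from_nat_into[OF ne, of i]
      by (auto simp: strong_in_def)
    have base: "\<exists>X. ?P 0 X" using cofinal[of "{}"] by auto
    obtain X where all: "\<forall>i. ?P i (X i) \<and> ?Q i (X i) (X (Suc i))"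
      using dependent_nat_choice[of ?P ?Q, OF base step] by (rule exE)
    then have X: "\<And>i. ?P i (X i)" "\<And>i. ?Q i (X i) (X (Suc i))" by simp_all
    have Xs: "finite (X i)" "X i \<subseteq> universe M" for i using X(1)[of i] by (simp_all add: strong_in_def)
    have mono: "X i \<subseteq> X j" if "i \<le> j" for i j
      by (rule lift_Suc_mono_le[OF _ that]) (simp add: X(2))
    have UX: "universe M = (\<Union>i. X i)"
    proof
      show "universe M \<subseteq> (\<Union>i. X i)"
      proof
        fix x assume "x \<in> universe M"
        then obtain i where "x = from_nat_into (universe M) i" using from_nat_into_surj[OF M(2)] by metis
        then show "x \<in> (\<Union>i. X i)" using X(2) by blast
      qed
    qed (use Xs in blast)
    have cover: "\<exists>i. Z \<subseteq> X i" if "finite Z" "Z \<subseteq> universe M" for Z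
      by (rule finite_subset_UN_mono[OF that(1)]) (use that(2) mono in \<open>simp_all add: UX\<close>)
    let ?A = "\<lambda>i. induced M (X i)"
    have "strong_fin \<alpha> (?A i) (?A (Suc i))" for i
    proof -
      have "X i \<subseteq> X (Suc i)" using X(2) by blast
      moreover from this have "strong_in (?A (Suc i)) (X i)"
        using X(1) by (intro strong_in_substruct[OF _ substruct_induced[OF Xs(2)]]) simp_all
      ultimately show ?thesis
        using Xs by (simp add: strong_fin_iff substruct_iff induced_induced)
    qed
    moreover have "M = chain_union ?A"
    proof -
      have "interp M E = (\<Union>i. interp (?A i) E)" for E
      proof
        show "interp M E \<subseteq> (\<Union>i. interp (?A i) E)"
        proof
          fix xs assume xs: "xs \<in> interp M E"
          then have "set xs \<subseteq> universe M" using Ms by (auto simp: is_struct_def)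
          then obtain i where "set xs \<subseteq> X i" using cover[of "set xs"] by auto
          then show "xs \<in> (\<Union>i. interp (?A i) E)" using xs by auto
        qed
      qed auto
      then have "interp M = interp (chain_union ?A)" by (auto simp: chain_union_def)
      moreover have "universe M = universe (chain_union ?A)" using UX by (simp add: chain_union_def)
      ultimately show ?thesis by simp
    qed
    ultimately show ?thesis using X(1) by (intro exI[of _ ?A]) auto
  qed
  moreover have "\<exists>B'. strong \<alpha> B' M \<and> isomorphic_over A B B'"
    if A: "A \<in> K" and B: "B \<in> K" and AB: "strong_fin \<alpha> A B" and AM: "strong \<alpha> A M" for A B
  proof -
    have BK: "B \<in> K_\<alpha> ar \<alpha>" using B K by blast
    then have "finite (universe B)" by (simp add: K_\<alpha>_iff)
    then have AB': "substruct A B" "strong_in B (universe A)" using AB by (simp_all add: strong_fin_iff)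
    have AM': "substruct A M" "strong_in M (universe A)" using AM by (simp_all add: strong_iff)
    have "induced B (universe A) = A" using AB'(1) by (simp add: substruct_iff)
    then have emb: "embeds (\<lambda>x. x) (induced B (universe A)) M" using embeds_id[OF AM'(1)] by simp
    obtain C where C: "strong_in M C" "predim B (universe B) \<le> predim M C"
      using bounded[OF B] by blast
    obtain g where g: "embeds g B M" "\<forall>x \<in> universe A. g x = x" "strong_in M (g ` universe B)"
      using strong_extension[OF M(1) BK AB'(2) emb _ C] AM'(2) by auto
    have "strong \<alpha> (induced M (g ` universe B)) M"
      using g(3) strong_in_subset[OF g(3)] by (simp add: strong_iff substruct_induced)
    moreover have "isomorphic_over A B (induced M (g ` universe B))"
      using embeds_iso_via[OF g(1)] g(2) unfolding isomorphic_over_def by blast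
    ultimately show ?thesis by blast
  qed
  ultimately show ?thesis using Ms M(2) age unfolding generic_wrt_def by blast
qed

lemma generic_of_infinite_dimension:
  assumes M: "model M" "countable (universe M)" and dim: "dimension \<alpha> M = \<infinity>"
  shows "is_generic ar \<alpha> M"
  unfolding is_generic_def
proof (rule model_generic_wrt[OF M order_refl])
  fix F assume F: "finite F" "F \<subseteq> universe M"
  obtain X where X: "F \<subseteq> X" "strong_in M X"
    using closure_exists[OF model_nonneg[OF M(1)] F] by blast
  then show "\<exists>X. F \<subseteq> X \<and> strong_in M X \<and> induced M X \<in> K_\<alpha> ar \<alpha>"
    using model_induced_K_\<alpha>[OF M(1)] by (auto simp: strong_in_def)
next
  fix B assume "B \<in> K_\<alpha> ar \<alpha>"
  show "\<exists>C. strong_in M C \<and> predim B (universe B) \<le> predim M C"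
    using dim dimension_infinite_iff[OF M(1)] by (meson less_imp_le)
qed

text \<open>Genericity realises \<open>n\<close> isolated points over the empty structure as a
  strong substructure of predimension \<open>n\<close>.\<close>

lemma generic_infinite_dimension:
  fixes M :: "('e, 'a) struct"
  assumes M: "model M" and gen: "is_generic ar \<alpha> M"
  shows "dimension \<alpha> M = \<infinity>"
proof -
  have "\<exists>X. strong_in M X \<and> r < predim M X" for r
  proof -
    obtain n :: nat where n: "r < of_nat n" using reals_Archimedean2[of r] by (rule exE)
    \<comment> \<open>The structures to be realised live on the carrier type of \<open>M\<close>,
      which must therefore offer \<open>n\<close> elements.\<close>
    have "infinite (UNIV :: 'a set)" using model_infinite[OF M] by (metis finite_subset subset_UNIV)
    then obtain U :: "'a set" where U: "finite U" "card U = n"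
      using infinite_arbitrarily_large by blast
    let ?B = "of_edges U (\<lambda>_. {}) :: ('e, 'a) struct" and ?A = "induced M {} :: ('e, 'a) struct"
    have B: "?B \<in> K_\<alpha> ar \<alpha>" using edgeless(1)[OF U(1)] .
    have A: "?A \<in> K_\<alpha> ar \<alpha>" using model_induced_K_\<alpha>[OF M] by simp
    have "embeds (\<lambda>x. x) (induced M {}) ?B"
      using B by (intro embeds_empty model_hypergraph[OF M]) (simp add: K_\<alpha>_iff)
    then have "substruct ?A ?B"
      by (auto simp: substruct_def embeds_def)
    moreover have "strong_in ?B {}" using edgeless(2)[OF U(1)] by (simp add: strong_in_def)
    ultimately have "strong_fin \<alpha> ?A ?B" using U(1) by (simp add: strong_fin_iff)
    moreover have "strong \<alpha> ?A M"
      using model_empty_strong[OF M] by (simp add: strong_iff substruct_induced)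
    ultimately obtain B' f where B': "strong \<alpha> B' M" "iso_via f ?B B'"
      using gen A B unfolding is_generic_def generic_wrt_def isomorphic_over_def by blast
    have sub: "substruct B' M" "strong_in M (universe B')" using B'(1) by (simp_all add: strong_iff)
    have f: "embeds f ?B B'" "f ` U = universe B'" using B'(2) by (simp_all add: iso_via_iff_embeds)
    have "predim M (universe B') = predim B' (f ` U)"
      using predim_substruct[OF sub(1), of "universe B'"] f(2) by simp
    also have "\<dots> = of_nat n" using predim_embeds[OF f(1), of U] edgeless(2)[OF U(1)] U(2) by simp
    finally show ?thesis using sub(2) n by auto
  qed
  then show ?thesis using dimension_infinite_iff[OF M] by simp
qed

text \<open>Let \<open>X0\<close> be a strong set of maximal predimension. Every strong set
  containing \<open>X0\<close> has the same predimension, and such sets are cofinal by closure;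
  \<open>k\<close> is \<open>c\<close> times this common value.\<close>

lemma level_generic_of_finite_dimension:
  fixes M :: "('e, 'a) struct"
  assumes M: "model M" "countable (universe M)" and dim: "dimension \<alpha> M \<noteq> \<infinity>"
  shows "\<exists>k. is_generic_level ar \<alpha> k M"
proof -
  obtain X0 where X0: "strong_in M X0"
    and max: "\<And>Y. strong_in M Y \<Longrightarrow> predim M Y \<le> predim M X0"
    using dimension_cases[OF M(1)] dim by metis
  have X0s: "finite X0" "X0 \<subseteq> universe M" using X0 by (simp_all add: strong_in_def)
  obtain z where z: "predim M X0 * c = of_int z" using predim_grid by (metis Ints_cases)
  have "0 \<le> predim M X0 * c" using model_nonneg[OF M(1) X0s] c_pos by simp
  then have "z \<ge> 0" by (simp add: z)
  then have k: "predim M X0 = of_nat (nat z) / c" using z c_pos by (simp add: field_simps)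
  let ?K = "K_level ar \<alpha> (nat z) :: ('e, 'a) struct set"
  have cofinal: "\<exists>X. F \<subseteq> X \<and> strong_in M X \<and> induced M X \<in> ?K"
    if F: "finite F" "F \<subseteq> universe M" for F
  proof -
    obtain X where X: "F \<union> X0 \<subseteq> X" "strong_in M X"
      using closure_exists[OF model_nonneg[OF M(1)], of "F \<union> X0"] F X0s by auto
    have Xs: "finite X" "X \<subseteq> universe M" using X(2) by (simp_all add: strong_in_def)
    have "predim M X = predim M X0"
      using max[OF X(2)] strong_in_le[OF X0 Xs(1) _ Xs(2)] X(1) by simp
    then have "induced M X \<in> ?K"
      using model_induced_K_\<alpha>[OF M(1) Xs] k
      by (simp add: K_level_def \<delta>_eq_predim predim_induced)
    then show ?thesis using X by auto
  qed
  have "generic_wrt ar \<alpha> ?K M"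
  proof (rule model_generic_wrt[OF M _ cofinal])
    fix B assume "B \<in> ?K"
    then have "predim B (universe B) = predim M X0" by (simp add: K_level_def \<delta>_eq_predim k)
    then show "\<exists>C. strong_in M C \<and> predim B (universe B) \<le> predim M C" using X0 by auto
  qed (auto simp: K_level_def)
  moreover have "\<exists>B \<in> ?K. substruct A B \<and> strong \<alpha> B M" if A: "finite (universe A)" "substruct A M" for A
  proof -
    have "universe A \<subseteq> universe M" using A(2) by (simp add: substruct_iff)
    then obtain X where X: "universe A \<subseteq> X" "strong_in M X" "induced M X \<in> ?K"
      using cofinal[OF A(1)] by blast
    have "substruct A (induced M X)" using A(2) X(1) by (simp add: substruct_iff induced_induced)
    moreover have "strong \<alpha> (induced M X) M"
      using X(2) strong_in_subset[OF X(2)] by (simp add: strong_iff substruct_induced)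
    ultimately show ?thesis using X(3) by blast
  qed
  ultimately show ?thesis unfolding is_generic_level_def by blast
qed

section \<open>Countable models\<close>

text \<open>The theory is defined through a chosen generic on \<open>nat\<close>. The unbounded
  model has infinite dimension and is therefore generic, so the choice is not vacuous; the chosen
  structure satisfies the axioms and transfers them in both directions.\<close>

lemma countable_models_iff:
  "M \<in> countable_models ar \<alpha> \<longleftrightarrow> model M \<and> countable (universe M)"
proof -
  obtain N :: "('e, nat) struct" where N: "model N"
    and unb: "\<And>n. \<exists>X. strong_in N X \<and> of_nat n \<le> predim N X"
    using unbounded_model_exists by blast
  have "\<exists>X. strong_in N X \<and> r < predim N X" for r
  proof -
    obtain n :: nat where "r < of_nat n" using reals_Archimedean2[of r] by (rule exE)
    then show ?thesis using unb[of n] by (metis less_le_trans)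
  qed
  then have "dimension \<alpha> N = \<infinity>" using dimension_infinite_iff[OF N] by simp
  then have "is_generic ar \<alpha> N" using generic_of_infinite_dimension[OF N] by simp
  then have "is_generic ar \<alpha> (SOME G :: ('e, nat) struct. is_generic ar \<alpha> G)" by (rule someI)
  then have G: "model (SOME G :: ('e, nat) struct. is_generic ar \<alpha> G)" (is "model ?G")
    by (rule generic_model)
  have S: "S_\<alpha> ar \<alpha> = {\<phi> \<in> sentences ar. holds_in ?G \<phi>}"
    by (simp add: S_\<alpha>_def complete_theory_def)
  show ?thesis
  proof
    assume "M \<in> countable_models ar \<alpha>"
    then show "model M \<and> countable (universe M)"
      using model_of_theory[OF G, of M] unfolding countable_models_def S by blast
  next
    assume M: "model M \<and> countable (universe M)"
    then have "holds_in M \<phi>" if "\<phi> \<in> S_\<alpha> ar \<alpha>" for \<phi>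
      using models_elementarily_equivalent[OF G, of M \<phi>] that unfolding S sentences_def by blast
    then show "M \<in> countable_models ar \<alpha>"
      using M hypergraph_is_struct[OF model_hypergraph] unfolding countable_models_def by blast
  qed
qed

lemma isomorphic_iff_dimension:
  assumes "M \<in> countable_models ar \<alpha>" "N \<in> countable_models ar \<alpha>"
  shows "isomorphic M N \<longleftrightarrow> dimension \<alpha> M = dimension \<alpha> N"
  using assms isomorphic_dimension isomorphic_models unfolding countable_models_iff by blast

text \<open>Isomorphism classes correspond to the dimensions that occur. These are countable because
  finite dimensions are rational, and infinite because every natural number occurs.\<close>

lemma iso_classes_eqpoll:
  "(iso_classes ar \<alpha> :: ('e, nat) struct set set) \<approx> (UNIV :: nat set)"
proof -
  let ?CM = "countable_models ar \<alpha> :: ('e, nat) struct set"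
  let ?D = "dimension \<alpha> ` ?CM"
  let ?cl = "\<lambda>d. {M \<in> ?CM. dimension \<alpha> M = d}"
  have "{(M, N). M \<in> ?CM \<and> N \<in> ?CM \<and> isomorphic M N} `` {M} = ?cl (dimension \<alpha> M)"
    if "M \<in> ?CM" for M
    using that by (auto simp: isomorphic_iff_dimension)
  then have "iso_classes ar \<alpha> = ?cl ` ?D"
    unfolding iso_classes_def quotient_def by auto
  moreover have "inj_on ?cl ?D" by (rule inj_onI) blast
  ultimately have "bij_betw ?cl ?D (iso_classes ar \<alpha>)" by (simp add: bij_betw_def)
  then have "?D \<approx> (iso_classes ar \<alpha> :: ('e, nat) struct set set)" unfolding eqpoll_def by blast
  moreover have "?D \<approx> (UNIV :: nat set)"
  proof -
    have "x \<in> range Fin \<union> {\<infinity>, -\<infinity>}" for x :: "rat extended" by (cases x) auto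
    then have "countable ?D"
      by (intro countable_subset[of ?D "range Fin \<union> {\<infinity>, -\<infinity>}"]) auto
    moreover have "infinite ?D"
    proof -
      have "Fin (of_nat n) \<in> ?D" for n
      proof -
        obtain M :: "('e, nat) struct" and X where M: "model M" "strong_in M X"
          "predim M X = of_nat n" "\<And>Y. strong_in M Y \<Longrightarrow> predim M Y \<le> of_nat n"
          using level_model_exists[of n] by blast
        have "dimension \<alpha> M = Fin (of_nat n)" using dimension_FinI[OF M(1,2)] M(3,4) by simp
        moreover have "M \<in> ?CM" using M(1) by (simp add: countable_models_iff)
        ultimately show ?thesis by (metis imageI)
      qed
      then have "range (\<lambda>n. Fin (of_nat n)) \<subseteq> ?D" by blast
      moreover have "inj (\<lambda>n :: nat. Fin (of_nat n :: rat))" by (simp add: inj_on_def)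
      ultimately show ?thesis using range_inj_infinite finite_subset by blast
    qed
    ultimately obtain e :: "rat extended \<Rightarrow> nat" where "bij_betw e ?D UNIV"
      by (rule countableE_infinite)
    then show ?thesis unfolding eqpoll_def by blast
  qed
  ultimately show ?thesis using eqpoll_sym eqpoll_trans by blast
qed

end

theorem theorem4p7:
  fixes ar :: "'e::finite \<Rightarrow> nat" and \<alpha> :: "'e \<Rightarrow> rat"
  assumes "\<forall>E. ar E \<ge> 2" and "\<forall>E. 0 < \<alpha> E \<and> \<alpha> E < 1"
  shows
    "(\<forall>M \<in> (countable_models ar \<alpha> :: ('e, 'a) struct set).
      \<forall>N \<in> (countable_models ar \<alpha> :: ('e, 'b) struct set).
        isomorphic M N \<longleftrightarrow> dimension \<alpha> M = dimension \<alpha> N) \<and>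
     (\<forall>M \<in> (countable_models ar \<alpha> :: ('e, 'a) struct set).
        dimension \<alpha> M = \<infinity> \<longleftrightarrow> is_generic ar \<alpha> M) \<and>
     (iso_classes ar \<alpha> :: ('e, nat) struct set set) \<approx> (UNIV :: nat set) \<and>
     (\<forall>M \<in> (countable_models ar \<alpha> :: ('e, 'a) struct set).
        is_generic ar \<alpha> M \<or> (\<exists>k. is_generic_level ar \<alpha> k M))"
proof -
  interpret rational_weights ar \<alpha> using assms by unfold_locales auto
  show ?thesis
  proof (intro conjI ballI)
    fix M :: "('e, 'a) struct" and N :: "('e, 'b) struct"
    assume "M \<in> countable_models ar \<alpha>" "N \<in> countable_models ar \<alpha>"
    then show "isomorphic M N \<longleftrightarrow> dimension \<alpha> M = dimension \<alpha> N" by (rule isomorphic_iff_dimension)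
  next
    fix M :: "('e, 'a) struct"
    assume "M \<in> countable_models ar \<alpha>"
    then have M: "model M" "countable (universe M)" by (simp_all add: countable_models_iff)
    show inf: "dimension \<alpha> M = \<infinity> \<longleftrightarrow> is_generic ar \<alpha> M"
      using generic_of_infinite_dimension[OF M] generic_infinite_dimension[OF M(1)] by blast
    show "is_generic ar \<alpha> M \<or> (\<exists>k. is_generic_level ar \<alpha> k M)"
      using level_generic_of_finite_dimension[OF M] inf by blast
  qed (rule iso_classes_eqpoll)
qed

end
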